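(* Let $q=p^\alpha$, with $p$ a prime number and $\alpha\geq 1$, let $n\geq 2$, and assume that $m=\mathrm{GCD}(n,q-1)$ is prime and that $(n,q)\notin\{(2,9),(3,4)\}$. Then there is a bijection between the set of isomorphism classes of noncommutative Hopf algebras that are graded twistings of $\mathcal{O}(\mathrm{SL}_n(\mathbb{F}_q))$ by $\mathbb{Z}_m$ and the set $\mathbb{X}_m^\bullet(\mathrm{SL}_n(\mathbb{F}_q))$.
   Context: The base field $k$ is algebraically closed of characteristic zero. For a finite group $G$, $\mathcal{O}(G)$ is the Hopf algebra of functions $G\to k$. For a group $\Gamma$, $\widehat{\Gamma}=\mathrm{Hom}(\Gamma,k^\times)$. A cocentral action of a finite abelian group $\Gamma$ on a finite group $G$ is a pair $(i,\alpha)$ where $i:\widehat{\Gamma}\to Z(G)$ is an injective group morphism and $\alpha:\Gamma\to\mathrm{Aut}(G)$, $g\mapsto\alpha_g$, is a group morphism such that each $\alpha_g$ fixes every element of $i(\widehat{\Gamma})$. It gives a grading $\mathcal{O}(G)=\bigoplus_{g\in\Gamma}\mathcal{O}(G)_g$ with $\mathcal{O}(G)_g=\{\phi : \phi(x\,i(\chi))=\chi(g)\phi(x)\ \forall x\in G,\chi\in\widehat\Gamma\}$, and an action of $\Gamma$ on $\mathcal{O}(G)$ by Hopf algebra automorphisms $\alpha_g(\phi)=\phi\circ\alpha_g^{-1}$. The graded twisting $\mathcal{O}(G)^{i,\alpha}$ is the Hopf algebra having $\mathcal{O}(G)$ as underlying coalgebra, with product $\phi\cdot\psi=\phi\,\alpha_g(\psi)$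 for $\phi\in\mathcal{O}(G)_g$, $\psi\in\mathcal{O}(G)$, and antipode $\phi\mapsto\alpha_{g^{-1}}(S(\phi))$ for $\phi\in\mathcal{O}(G)_g$. A graded twisting of $\mathcal{O}(G)$ by $\Gamma$ is a Hopf algebra of the form $\mathcal{O}(G)^{i,\alpha}$ for a cocentral action $(i,\alpha)$ of $\Gamma$ on $G$. Let $G$ be a finite group with cyclic center, $m$ a divisor of $|Z(G)|$, and $T_m$ the unique subgroup of order $m$ of $Z(G)$. Let $\mathrm{Aut}_{T_m}(G)$ be the group of automorphisms of $G$ preserving $T_m$, and $\mathrm{Aut}_{T_m}^\circ(G)$ the subgroup of those fixing each element of $T_m$. $\mathbb{X}_m(G)$ is the set of elements $\alpha_0\in\mathrm{Aut}^\circ_{T_m}(G)$ with $\alpha_0^m=\mathrm{id}_G$, modulo the equivalence relation: $\alpha_0\sim\beta_0$ iff there exist $f\in\mathrm{Aut}_{T_m}(G)$ and an integer $l$ prime to $m$ with $f^{-1}\circ\alpha_0\circ f=\beta_0^l$ and $f(t)=t^l$ for all $t\in T_m$. $\mathbb{X}_m^\bullet(G)\subset\mathbb{X}_m(G)$ is the subset of classes of those $\alpha_0$ that do not induce the identity on $G/T_m$. *)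

theory Defs
  imports
    "Jordan_Normal_Form.VS_Connect"
    "HOL-Algebra.Bij"
    "HOL-Algebra.Coset"
    "HOL-Algebra.Multiplicative_Group"
    "HOL-Algebra.Elementary_Groups"
begin

section \<open>Hopf algebras over a field\<close>

text \<open>
  The base field is a type \<open>'k\<close>, and \<open>class_ring\<close> is that type viewed as a ring with
  carrier. The tensor square of a vector space \<open>A\<close> is realised inside the dual of the space
  of bilinear forms on \<open>A\<close>: the pure tensor \<open>x \<otimes> y\<close> is the functional
  sending \<open>\<beta>\<close> to \<open>\<beta> x y\<close>. Over a field this functional determines the tensor. So an element of
  the tensor square is a function \<open>t\<close> of type \<open>('a \<Rightarrow> 'a \<Rightarrow> 'k) \<Rightarrow> 'k\<close>, of which only
  the values on bilinear forms matter. The image of \<open>t\<close> under \<open>f \<otimes> g\<close> is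
  the functional sending \<open>\<beta>\<close> to \<open>t (\<lambda>x y. \<beta> (f x) (g y))\<close>. The same is done for
  threefold tensors, with trilinear forms.
\<close>

record ('k, 'a) hopf = "('k, 'a) module" +
  comult :: "'a \<Rightarrow> ('a \<Rightarrow> 'a \<Rightarrow> 'k) \<Rightarrow> 'k"
  counit :: "'a \<Rightarrow> 'k"
  antipode :: "'a \<Rightarrow> 'a"

definition linear_form :: "('k::field, 'a, 'b) module_scheme \<Rightarrow> ('a \<Rightarrow> 'k) \<Rightarrow> bool" where
  "linear_form A f \<longleftrightarrow>
     (\<forall>x\<in>carrier A. \<forall>y\<in>carrier A. f (x \<oplus>\<^bsub>A\<^esub> y) = f x + f y) \<and>
     (\<forall>c. \<forall>x\<in>carrier A. f (c \<odot>\<^bsub>A\<^esub> x) = c * f x)"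

definition linear_map ::
    "('k::field, 'a, 'b) module_scheme \<Rightarrow> ('k, 'c, 'd) module_scheme \<Rightarrow> ('a \<Rightarrow> 'c) \<Rightarrow> bool" where
  "linear_map A B f \<longleftrightarrow>
     f \<in> carrier A \<rightarrow> carrier B \<and>
     (\<forall>x\<in>carrier A. \<forall>y\<in>carrier A. f (x \<oplus>\<^bsub>A\<^esub> y) = f x \<oplus>\<^bsub>B\<^esub> f y) \<and>
     (\<forall>c. \<forall>x\<in>carrier A. f (c \<odot>\<^bsub>A\<^esub> x) = c \<odot>\<^bsub>B\<^esub> f x)"

definition bilinear_forms :: "('k::field, 'a, 'b) module_scheme \<Rightarrow> ('a \<Rightarrow> 'a \<Rightarrow> 'k) set" where
  "bilinear_forms A = {\<beta>.
     (\<forall>x\<in>carrier A. linear_form A (\<lambda>y. \<beta> x y)) \<and>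
     (\<forall>y\<in>carrier A. linear_form A (\<lambda>x. \<beta> x y))}"

definition trilinear_forms :: "('k::field, 'a, 'b) module_scheme \<Rightarrow> ('a \<Rightarrow> 'a \<Rightarrow> 'a \<Rightarrow> 'k) set" where
  "trilinear_forms A = {\<tau>.
     (\<forall>y\<in>carrier A. \<forall>z\<in>carrier A. linear_form A (\<lambda>x. \<tau> x y z)) \<and>
     (\<forall>x\<in>carrier A. \<forall>z\<in>carrier A. linear_form A (\<lambda>y. \<tau> x y z)) \<and>
     (\<forall>x\<in>carrier A. \<forall>y\<in>carrier A. linear_form A (\<lambda>z. \<tau> x y z))}"

text \<open>The tensor \<open>t\<close> is the sum of the pure tensors \<open>x i \<otimes> y i\<close> for \<open>i < N\<close>.\<close>

definition tensor_sum ::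
    "('k::field, 'a, 'b) module_scheme \<Rightarrow> (('a \<Rightarrow> 'a \<Rightarrow> 'k) \<Rightarrow> 'k) \<Rightarrow> nat \<Rightarrow>
     (nat \<Rightarrow> 'a) \<Rightarrow> (nat \<Rightarrow> 'a) \<Rightarrow> bool" where
  "tensor_sum A t N x y \<longleftrightarrow>
     x \<in> {..<N} \<rightarrow> carrier A \<and> y \<in> {..<N} \<rightarrow> carrier A \<and>
     (\<forall>\<beta>\<in>bilinear_forms A. t \<beta> = (\<Sum>i<N. \<beta> (x i) (y i)))"

locale hopf_algebra = Module.module "class_ring :: 'k::field ring" A + ring A
  for A :: "('k::field, 'a, 'b) hopf_scheme" (structure) +
  assumes smult_mult_left:
      "\<lbrakk>x \<in> carrier A; y \<in> carrier A\<rbrakk> \<Longrightarrow> (c \<odot> x) \<otimes> y = c \<odot> (x \<otimes> y)"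
    and smult_mult_right:
      "\<lbrakk>x \<in> carrier A; y \<in> carrier A\<rbrakk> \<Longrightarrow> x \<otimes> (c \<odot> y) = c \<odot> (x \<otimes> y)"
    and comult_tensor:
      "a \<in> carrier A \<Longrightarrow> \<exists>N X Y. tensor_sum A (comult A a) N X Y"
    and comult_linear:
      "\<beta> \<in> bilinear_forms A \<Longrightarrow> linear_form A (\<lambda>a. comult A a \<beta>)"
    and counit_linear: "linear_form A (counit A)"
    and antipode_linear: "linear_map A A (antipode A)"
    and coassoc:
      "\<lbrakk>a \<in> carrier A; \<tau> \<in> trilinear_forms A\<rbrakk> \<Longrightarrow>
         comult A a (\<lambda>x z. comult A x (\<lambda>u v. \<tau> u v z)) =
         comult A a (\<lambda>x z. comult A z (\<lambda>u v. \<tau> x u v))"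
    and counit_left:
      "\<lbrakk>a \<in> carrier A; tensor_sum A (comult A a) N X Y\<rbrakk> \<Longrightarrow>
         (\<Oplus>\<^bsub>A\<^esub>i\<in>{..<N}. counit A (X i) \<odot> Y i) = a"
    and counit_right:
      "\<lbrakk>a \<in> carrier A; tensor_sum A (comult A a) N X Y\<rbrakk> \<Longrightarrow>
         (\<Oplus>\<^bsub>A\<^esub>i\<in>{..<N}. counit A (Y i) \<odot> X i) = a"
    and comult_one:
      "\<beta> \<in> bilinear_forms A \<Longrightarrow> comult A \<one> \<beta> = \<beta> \<one> \<one>"
    and comult_mult:
      "\<lbrakk>a \<in> carrier A; b \<in> carrier A; \<beta> \<in> bilinear_forms A\<rbrakk> \<Longrightarrow>
         comult A (a \<otimes> b) \<beta> =
         comult A a (\<lambda>x x'. comult A b (\<lambda>y y'. \<beta> (x \<otimes> y) (x' \<otimes> y')))"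
    and counit_one: "counit A \<one> = 1"
    and counit_mult:
      "\<lbrakk>a \<in> carrier A; b \<in> carrier A\<rbrakk> \<Longrightarrow> counit A (a \<otimes> b) = counit A a * counit A b"
    and antipode_left:
      "\<lbrakk>a \<in> carrier A; tensor_sum A (comult A a) N X Y\<rbrakk> \<Longrightarrow>
         (\<Oplus>\<^bsub>A\<^esub>i\<in>{..<N}. antipode A (X i) \<otimes> Y i) = counit A a \<odot> \<one>"
    and antipode_right:
      "\<lbrakk>a \<in> carrier A; tensor_sum A (comult A a) N X Y\<rbrakk> \<Longrightarrow>
         (\<Oplus>\<^bsub>A\<^esub>i\<in>{..<N}. X i \<otimes> antipode A (Y i)) = counit A a \<odot> \<one>"

definition noncommutative :: "('a, 'b) monoid_scheme \<Rightarrow> bool" where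
  "noncommutative A \<longleftrightarrow> (\<exists>x\<in>carrier A. \<exists>y\<in>carrier A. x \<otimes>\<^bsub>A\<^esub> y \<noteq> y \<otimes>\<^bsub>A\<^esub> x)"

definition hopf_isos ::
    "('k::field, 'a, 'c) hopf_scheme \<Rightarrow> ('k, 'b, 'd) hopf_scheme \<Rightarrow> ('a \<Rightarrow> 'b) set" where
  "hopf_isos A B = {f.
     linear_map A B f \<and> bij_betw f (carrier A) (carrier B) \<and>
     (\<forall>x\<in>carrier A. \<forall>y\<in>carrier A. f (x \<otimes>\<^bsub>A\<^esub> y) = f x \<otimes>\<^bsub>B\<^esub> f y) \<and>
     f \<one>\<^bsub>A\<^esub> = \<one>\<^bsub>B\<^esub> \<and>
     (\<forall>a\<in>carrier A. \<forall>\<beta>\<in>bilinear_forms B.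
        comult B (f a) \<beta> = comult A a (\<lambda>x y. \<beta> (f x) (f y))) \<and>
     (\<forall>a\<in>carrier A. counit B (f a) = counit A a) \<and>
     (\<forall>a\<in>carrier A. f (antipode A a) = antipode B (f a))}"

definition hopf_iso_rel :: "('k::field, 'a, 'b) hopf_scheme set \<Rightarrow>
    (('k, 'a, 'b) hopf_scheme \<times> ('k, 'a, 'b) hopf_scheme) set" where
  "hopf_iso_rel S = {(A, B). A \<in> S \<and> B \<in> S \<and> hopf_isos A B \<noteq> {}}"


section \<open>The Hopf algebra of functions on a finite group\<close>

definition delta_fun :: "('g, 'r) monoid_scheme \<Rightarrow> 'g \<Rightarrow> 'g \<Rightarrow> 'k::field" where
  "delta_fun G x = (\<lambda>z\<in>carrier G. if z = x then 1 else 0)"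

text \<open>
  The comultiplication sends \<open>\<phi>\<close> to the function \<open>(x, y) \<mapsto> \<phi> (x \<otimes> y)\<close>
  on \<open>G \<times> G\<close>, which as a tensor is
  the sum over all \<open>x, y\<close> of \<open>\<phi> (x \<otimes> y)\<close> times \<open>delta_fun G x \<otimes> delta_fun G y\<close>.
\<close>

definition function_hopf :: "('g, 'r) monoid_scheme \<Rightarrow> ('k::field, 'g \<Rightarrow> 'k) hopf" where
  "function_hopf G = \<lparr>
     carrier = extensional (carrier G),
     monoid.mult = (\<lambda>\<phi> \<psi>. \<lambda>x\<in>carrier G. \<phi> x * \<psi> x),
     one = (\<lambda>x\<in>carrier G. 1),
     zero = (\<lambda>x\<in>carrier G. 0),
     add = (\<lambda>\<phi> \<psi>. \<lambda>x\<in>carrier G. \<phi> x + \<psi> x),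
     smult = (\<lambda>c \<phi>. \<lambda>x\<in>carrier G. c * \<phi> x),
     comult = (\<lambda>\<phi> \<beta>. \<Sum>x\<in>carrier G. \<Sum>y\<in>carrier G.
                 \<phi> (x \<otimes>\<^bsub>G\<^esub> y) * \<beta> (delta_fun G x) (delta_fun G y)),
     counit = (\<lambda>\<phi>. \<phi> \<one>\<^bsub>G\<^esub>),
     antipode = (\<lambda>\<phi>. \<lambda>x\<in>carrier G. \<phi> (inv\<^bsub>G\<^esub> x))\<rparr>"


section \<open>Cocentral actions and graded twistings\<close>

definition group_center :: "('g, 'r) monoid_scheme \<Rightarrow> 'g set" where
  "group_center G = {z \<in> carrier G. \<forall>x\<in>carrier G. z \<otimes>\<^bsub>G\<^esub> x = x \<otimes>\<^bsub>G\<^esub> z}"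

text \<open>Characters are taken extensional, so that each is represented by one function only.\<close>

definition char_group :: "('c, 's) monoid_scheme \<Rightarrow> ('c \<Rightarrow> 'k::field) monoid" where
  "char_group \<Gamma> = \<lparr>
     carrier = hom \<Gamma> (mult_of class_ring) \<inter> extensional (carrier \<Gamma>),
     monoid.mult = (\<lambda>\<chi> \<psi>. \<lambda>g\<in>carrier \<Gamma>. \<chi> g * \<psi> g),
     one = (\<lambda>g\<in>carrier \<Gamma>. 1)\<rparr>"

locale cocentral_action = G: group G + \<Gamma>: comm_group \<Gamma>
  for G :: "('g, 'r) monoid_scheme" and \<Gamma> :: "('c, 's) monoid_scheme" +
  fixes i :: "('c \<Rightarrow> 'k::field) \<Rightarrow> 'g" and \<alpha> :: "'c \<Rightarrow> 'g \<Rightarrow> 'g"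
  assumes finite_G: "finite (carrier G)"
    and finite_Gamma: "finite (carrier \<Gamma>)"
    and i_hom: "i \<in> hom (char_group \<Gamma>) G"
    and i_central: "i ` carrier (char_group \<Gamma>) \<subseteq> group_center G"
    and i_inj: "inj_on i (carrier (char_group \<Gamma>))"
    and alpha_hom: "\<alpha> \<in> hom \<Gamma> (AutoGroup G)"
    and alpha_fixes: "\<lbrakk>g \<in> carrier \<Gamma>; \<chi> \<in> carrier (char_group \<Gamma>)\<rbrakk> \<Longrightarrow> \<alpha> g (i \<chi>) = i \<chi>"

definition homogeneous :: "('g, 'r) monoid_scheme \<Rightarrow> ('c, 's) monoid_scheme \<Rightarrow>
    (('c \<Rightarrow> 'k::field) \<Rightarrow> 'g) \<Rightarrow> 'c \<Rightarrow> ('g \<Rightarrow> 'k) set" where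
  "homogeneous G \<Gamma> i g = {\<phi> \<in> carrier (function_hopf G).
     \<forall>x\<in>carrier G. \<forall>\<chi>\<in>carrier (char_group \<Gamma>). \<phi> (x \<otimes>\<^bsub>G\<^esub> i \<chi>) = \<chi> g * \<phi> x}"

text \<open>The homogeneous components of a function; the description is unique, since the grading is a direct sum.\<close>

definition components :: "('g, 'r) monoid_scheme \<Rightarrow> ('c, 's) monoid_scheme \<Rightarrow>
    (('c \<Rightarrow> 'k::field) \<Rightarrow> 'g) \<Rightarrow> ('g \<Rightarrow> 'k) \<Rightarrow> 'c \<Rightarrow> 'g \<Rightarrow> 'k" where
  "components G \<Gamma> i \<phi> =
     (THE c. c \<in> (\<Pi>\<^sub>E g\<in>carrier \<Gamma>. homogeneous G \<Gamma> i g) \<and>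
             (\<forall>x\<in>carrier G. \<phi> x = (\<Sum>g\<in>carrier \<Gamma>. c g x)))"

definition act :: "('g, 'r) monoid_scheme \<Rightarrow> ('c \<Rightarrow> 'g \<Rightarrow> 'g) \<Rightarrow> 'c \<Rightarrow> ('g \<Rightarrow> 'k) \<Rightarrow> 'g \<Rightarrow> 'k" where
  "act G \<alpha> g \<phi> = (\<lambda>x\<in>carrier G. \<phi> (inv_into (carrier G) (\<alpha> g) x))"

text \<open>
  The product and the antipode of the twisting are prescribed on homogeneous functions and
  extended linearly through the homogeneous components.
\<close>

definition graded_twisting :: "('g, 'r) monoid_scheme \<Rightarrow> ('c, 's) monoid_scheme \<Rightarrow>
    (('c \<Rightarrow> 'k::field) \<Rightarrow> 'g) \<Rightarrow> ('c \<Rightarrow> 'g \<Rightarrow> 'g) \<Rightarrow> ('k, 'g \<Rightarrow> 'k) hopf" where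
  "graded_twisting G \<Gamma> i \<alpha> = (function_hopf G)\<lparr>
     monoid.mult := (\<lambda>\<phi> \<psi>. \<lambda>x\<in>carrier G.
        \<Sum>g\<in>carrier \<Gamma>. components G \<Gamma> i \<phi> g x * act G \<alpha> g \<psi> x),
     antipode := (\<lambda>\<phi>. \<lambda>x\<in>carrier G.
        \<Sum>g\<in>carrier \<Gamma>. act G \<alpha> (inv\<^bsub>\<Gamma>\<^esub> g)
          (antipode (function_hopf G) (components G \<Gamma> i \<phi> g)) x)\<rparr>"

definition noncomm_graded_twistings ::
    "('g, 'r) monoid_scheme \<Rightarrow> ('c, 's) monoid_scheme \<Rightarrow> ('k::field, 'g \<Rightarrow> 'k) hopf set" where
  "noncomm_graded_twistings G \<Gamma> =
     {H. hopf_algebra H \<and> noncommutative H \<and>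
         (\<exists>i \<alpha>. cocentral_action G \<Gamma> i \<alpha> \<and> H = graded_twisting G \<Gamma> i \<alpha>)}"

definition noncomm_graded_twisting_classes ::
    "('g, 'r) monoid_scheme \<Rightarrow> ('c, 's) monoid_scheme \<Rightarrow> ('k::field, 'g \<Rightarrow> 'k) hopf set set" where
  "noncomm_graded_twisting_classes G \<Gamma> =
     noncomm_graded_twistings G \<Gamma> // hopf_iso_rel (noncomm_graded_twistings G \<Gamma>)"


section \<open>The sets \<open>X\<^sub>m(G)\<close> and \<open>X\<^sub>m\<^sup>\<bullet>(G)\<close>\<close>

text \<open>For a cyclic center whose order is divisible by \<open>m\<close>, there is exactly one such subgroup.\<close>

definition central_subgroup :: "nat \<Rightarrow> ('g, 'r) monoid_scheme \<Rightarrow> 'g set" where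
  "central_subgroup m G =
     (THE T. subgroup T (G\<lparr>carrier := group_center G\<rparr>) \<and> card T = m)"

definition aut_preserving :: "('g, 'r) monoid_scheme \<Rightarrow> 'g set \<Rightarrow> ('g \<Rightarrow> 'g) set" where
  "aut_preserving G T = {f \<in> auto G. f ` T = T}"

definition aut_fixing :: "('g, 'r) monoid_scheme \<Rightarrow> 'g set \<Rightarrow> ('g \<Rightarrow> 'g) set" where
  "aut_fixing G T = {f \<in> auto G. \<forall>t\<in>T. f t = t}"

definition X_base :: "nat \<Rightarrow> ('g, 'r) monoid_scheme \<Rightarrow> ('g \<Rightarrow> 'g) set" where
  "X_base m G = {a \<in> aut_fixing G (central_subgroup m G).
     a [^]\<^bsub>AutoGroup G\<^esub> m = \<one>\<^bsub>AutoGroup G\<^esub>}"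

definition X_rel :: "nat \<Rightarrow> ('g, 'r) monoid_scheme \<Rightarrow> (('g \<Rightarrow> 'g) \<times> ('g \<Rightarrow> 'g)) set" where
  "X_rel m G = {(a, b). a \<in> X_base m G \<and> b \<in> X_base m G \<and>
     (\<exists>f \<in> aut_preserving G (central_subgroup m G). \<exists>l::int. coprime l (int m) \<and>
        inv\<^bsub>AutoGroup G\<^esub> f \<otimes>\<^bsub>AutoGroup G\<^esub> a \<otimes>\<^bsub>AutoGroup G\<^esub> f = b [^]\<^bsub>AutoGroup G\<^esub> l \<and>
        (\<forall>t\<in>central_subgroup m G. f t = t [^]\<^bsub>G\<^esub> l))}"

definition X_set :: "nat \<Rightarrow> ('g, 'r) monoid_scheme \<Rightarrow> ('g \<Rightarrow> 'g) set set" where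
  "X_set m G = X_base m G // X_rel m G"

definition induces_id_mod :: "('g, 'r) monoid_scheme \<Rightarrow> 'g set \<Rightarrow> ('g \<Rightarrow> 'g) \<Rightarrow> bool" where
  "induces_id_mod G T a \<longleftrightarrow> (\<forall>C\<in>carrier (G Mod T). a ` C = C)"

definition X_bullet :: "nat \<Rightarrow> ('g, 'r) monoid_scheme \<Rightarrow> ('g \<Rightarrow> 'g) set set" where
  "X_bullet m G = {E \<in> X_set m G. \<exists>a\<in>E. \<not> induces_id_mod G (central_subgroup m G) a}"


section \<open>Special linear groups\<close>

definition special_linear_group :: "nat \<Rightarrow> 'a::field mat monoid" where
  "special_linear_group n = \<lparr>
     carrier = {M \<in> carrier_mat n n. det M = 1},
     monoid.mult = (*),
     one = 1\<^sub>m n\<rparr>"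

end

theory Submission
  imports Defs
begin

text \<open>
  A cocentral action of \<open>\<int>\<^sub>m\<close>, with \<open>m\<close> prime, amounts to a central element \<open>z\<close> of order \<open>m\<close> and an
  automorphism \<open>a\<close> with \<open>a z = z\<close> and \<open>a\<^sup>m = 1\<close>; replacing \<open>z\<close> by a power of \<open>z\<close> amounts to replacing \<open>a\<close> by a
  power of \<open>a\<close>, so \<open>z\<close> may be fixed once and for all. Let \<open>T\<close> be the subgroup generated by \<open>z\<close>.

  A Hopf isomorphism \<open>F\<close> between the twistings given by \<open>a\<close> and \<open>b\<close> is an isomorphism of coalgebras of
  functions on \<open>G\<close>. Since \<open>G / T\<close> has trivial center, evaluation at \<open>z\<close> is carried to evaluation at
  some \<open>z\<^sup>s\<close>, so \<open>F\<close> multiplies degrees by \<open>s\<close>. In degree 0 it is composition with an automorphism of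
  \<open>G / T\<close>, and in degree 1 it shows that this automorphism carries the class of the extension \<open>G\<close> of
  \<open>G / T\<close> to its \<open>s\<close>-th power, up to a homomorphism from \<open>G\<close> to the multiplicative group of the field.
  As \<open>SL\<^sub>n\<close> is generated by transvections, which have order \<open>p\<close> prime to \<open>m\<close>, such homomorphisms are harmless and the
  automorphism lifts to an automorphism \<open>f\<close> of \<open>G\<close> with \<open>f z = z\<^sup>s\<close> and \<open>a f = f b\<^sup>s\<close>.
\<close>

section \<open>Finite fields and roots of unity, generation of \<open>SL\<^sub>n\<close> by transvections\<close>

text \<open>The obstacle is that the twisted product is not pointwise, so a Hopf isomorphism is not
  visibly composition with a map of groups. Twisted and pointwise products agree only when the left
  factor has degree 0, or at points of \<open>T\<close>, which the acting automorphisms fix. Hence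
  only an automorphism of G / T can be read off directly, and lifting it to G meets the linear
  characters of G. These need not be trivial: SL_2 over the field with 3 elements has a quotient of
  order 3. What holds in general is that their values are p-th roots of unity, where p is prime to m
  because m divides q - 1. This is the parameter \<open>r\<close> of the locale
  \<open>centreless_twist\<close>; an exponent divisible by r and congruent to 1 modulo m separates
  the two kinds of torsion. The isomorphism is studied through its transpose on functionals, that
  is, on the group algebra, where the central elements of G can be traced.\<close>

lemma finite_field_pow:
  fixes x :: "'a::{field,finite}"
  assumes "x \<noteq> 0"
  shows "x ^ (card (UNIV :: 'a set) - 1) = 1"
proof -
  let ?U = "UNIV - {0::'a}"
  have "bij_betw ((*) x) ?U ?U"
    by (rule bij_betw_byWitness[where f'="\<lambda>y. y / x"]) (use assms in auto)
  then have "(\<Prod>y\<in>?U. x * y) = (\<Prod>y\<in>?U. y)" by (rule prod.reindex_bij_betw)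
  then have "x ^ card ?U * (\<Prod>y\<in>?U. y) = (\<Prod>y\<in>?U. y)" by (simp add: prod.distrib)
  moreover have "(\<Prod>y\<in>?U. y) \<noteq> 0" by simp
  ultimately show ?thesis by (simp add: card_Diff_singleton)
qed

text \<open>Translation by 1 permutes the field; comparing the sum of all elements before and after
  leaves one copy of 1 for each element. This is the source of \<open>of_nat p = 0\<close> for
  SL_n.\<close>

lemma of_nat_card_finite_field: "of_nat (card (UNIV :: 'a set)) = (0 :: 'a::{field,finite})"
proof -
  have "bij ((+) (1 :: 'a))" by (rule bij_plus)
  then have "(\<Sum>y\<in>UNIV. 1 + y) = (\<Sum>y\<in>UNIV. y :: 'a)" by (rule sum.reindex_bij_betw)
  then show ?thesis by (simp add: sum.distrib)
qed

lemma
  assumes "n > 0"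
  shows finite_roots_of_unity: "finite {x :: 'a::field. x ^ n = 1}"
    and card_roots_of_unity_le: "card {x :: 'a. x ^ n = 1} \<le> n"
proof -
  let ?p = "Polynomial.monom 1 n - 1 :: 'a poly"
  have p: "?p \<noteq> 0"
  proof
    assume "?p = 0"
    then have "Polynomial.coeff ?p n = 0" by simp
    then show False using assms by simp
  qed
  have roots: "{x. poly ?p x = 0} = {x. x ^ n = 1}" by (simp add: poly_monom)
  have "degree ?p \<le> n"
    by (rule degree_diff_le) (simp_all add: degree_monom_eq)
  then show "card {x :: 'a. x ^ n = 1} \<le> n" using card_poly_roots_bound[OF p] roots by simp
  show "finite {x :: 'a. x ^ n = 1}" using poly_roots_finite[OF p] roots by simp
qed

text \<open>With \<open>d * m\<close> nonzero elements in the field, some nonzero \<open>x\<close>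
  has \<open>x ^ d \<noteq> 1\<close>, because \<open>x ^ d = 1\<close> has at most \<open>d\<close>
  solutions; then \<open>x ^ d\<close> is the root.\<close>

lemma ex_root_of_unity_finite_field:
  assumes "prime m" "m dvd card (UNIV :: 'a set) - 1"
  shows "\<exists>\<omega>::'a::{field,finite}. \<omega> ^ m = 1 \<and> \<omega> \<noteq> 1"
proof -
  let ?N = "card (UNIV :: 'a set) - 1"
  have "card {0, 1 :: 'a} \<le> card (UNIV :: 'a set)" by (rule card_mono) simp_all
  then have N: "?N > 0" by simp
  obtain d where d: "?N = d * m" using assms(2) by (metis dvd_def mult.commute)
  have "0 < d * m" using N by (simp only: d[symmetric])
  then have "d > 0" by simp
  moreover have "d < d * m" using calculation prime_gt_1_nat[OF assms(1)] by simp
  ultimately have dp: "d > 0" "d < ?N" by (simp_all only: d)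
  have "\<exists>x::'a. x \<noteq> 0 \<and> x ^ d \<noteq> 1"
  proof (rule ccontr)
    assume "\<not> (\<exists>x::'a. x \<noteq> 0 \<and> x ^ d \<noteq> 1)"
    then have "UNIV - {0} \<subseteq> {x::'a. x ^ d = 1}" by auto
    then have "card (UNIV - {0::'a}) \<le> card {x::'a. x ^ d = 1}" by (rule card_mono[rotated]) simp
    then show False using card_roots_of_unity_le[OF dp(1), where 'a='a] dp by (simp add: card_Diff_singleton)
  qed
  then obtain x :: 'a where x: "x \<noteq> 0" "x ^ d \<noteq> 1" by blast
  have "(x ^ d) ^ m = 1" using finite_field_pow[OF x(1)] d by (simp add: power_mult)
  then show ?thesis using x(2) by blast
qed

text \<open>A zero of 1 + X + ... + X^(m-1) is an m-th root of unity, and it is not 1 because the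
  value at 1 is \<open>m\<close>, nonzero in characteristic 0.\<close>

lemma ex_root_of_unity_alg_closed:
  assumes "prime m"
  shows "\<exists>\<zeta>::'k::{alg_closed_field,field_char_0}. \<zeta> ^ m = 1 \<and> \<zeta> \<noteq> 1"
proof -
  have m: "m > 1" using assms by (rule prime_gt_1_nat)
  let ?p = "\<Sum>i<m. Polynomial.monom 1 i :: 'k poly"
  have "Polynomial.coeff ?p (m - 1) = 1" using m by (simp add: coeff_sum)
  then have "degree ?p \<ge> m - 1" by (intro le_degree) simp
  then have "degree ?p > 0" using m by simp
  then obtain w where "poly ?p w = 0" using alg_closed_imp_poly_has_root by blast
  then have w: "(\<Sum>i<m. w ^ i) = 0" by (simp add: poly_sum poly_monom)
  then have "w ^ m = 1" using power_diff_1_eq[of w m] by simp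
  moreover have "w \<noteq> 1" using w m by auto
  ultimately show ?thesis by blast
qed

section \<open>Row reduction in SL_n by transvections\<close>

lemma det_addrow_neq:
  "k \<noteq> l \<Longrightarrow> l < n \<Longrightarrow> A \<in> carrier_mat n n \<Longrightarrow> det (addrow c k l A) = det (A :: 'a::comm_ring_1 mat)"
  by (simp add: addrow_mat det_mult[of _ n] det_addrow_mat)

lemma addrow_addrow_neg:
  "k \<noteq> l \<Longrightarrow> k < n \<Longrightarrow> l < n \<Longrightarrow> A \<in> carrier_mat n n \<Longrightarrow>
    addrow (- c) k l (addrow c k l A) = (A :: 'a::comm_ring_1 mat)"
  by (rule eq_matI) auto

text \<open>New factors come on the left only, matching row operations. Inverses need not be
  adjoined, since the inverse of a transvection is a transvection.\<close>

inductive_set transvection_products :: "nat \<Rightarrow> 'a::field mat set" for n where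
  one: "1\<^sub>m n \<in> transvection_products n"
| step: "A \<in> transvection_products n \<Longrightarrow> k < n \<Longrightarrow> l < n \<Longrightarrow> k \<noteq> l \<Longrightarrow>
    addrow_mat n c k l * A \<in> transvection_products n"

lemma transvection_products_carrier: "A \<in> transvection_products n \<Longrightarrow> A \<in> carrier_mat n n \<and> det A = 1"
  by (induction rule: transvection_products.induct) (auto simp: det_mult[of _ n] det_addrow_mat intro!: mult_carrier_mat[of _ n n])

text \<open>A row operation is undone by the one with coefficient \<open>- c\<close>. The
  elimination therefore argues backwards: a matrix may be replaced by any matrix obtained from it by
  a row operation.\<close>

lemma transvection_products_addrow:
  assumes "k < n" "l < n" "k \<noteq> l" "A \<in> carrier_mat n n" "addrow c k l A \<in> transvection_products n"
  shows "A \<in> transvection_products n"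
proof -
  let ?B = "addrow c k l A"
  have B: "?B \<in> carrier_mat n n" using assms(4) by auto
  have "A = addrow (- c) k l ?B" using addrow_addrow_neg[OF assms(3,1,2,4)] by simp
  also have "\<dots> = addrow_mat n (- c) k l * ?B" using addrow_mat[OF B assms(2)] .
  also have "\<dots> \<in> transvection_products n" by (rule transvection_products.step) (use assms in auto)
  finally show ?thesis .
qed

definition unit_cols :: "nat \<Rightarrow> 'a::field mat \<Rightarrow> bool" where
  "unit_cols k A \<longleftrightarrow> (\<forall>l<k. \<forall>i<dim_row A. A $$ (i, l) = (if i = l then 1 else 0))"

lemma unit_cols_addrow:
  assumes "unit_cols k A" "A \<in> carrier_mat n n" "k \<le> n" "j < n" "k \<le> j"
  shows "unit_cols k (addrow c i j A)"
  using assms by (auto simp: unit_cols_def)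

text \<open>Induction on the number of nonzero entries of column \<open>k\<close> off the pivot.
  Subtracting multiples of row \<open>k\<close> keeps the earlier columns, because row
  \<open>k\<close> vanishes there. The assumption \<open>cont\<close> stands for the elimination in
  the remaining columns.\<close>

lemma clear_column:
  fixes A :: "'a::field mat"
  assumes "A \<in> carrier_mat n n" "det A = 1" "k < n" "unit_cols k A" "A $$ (k, k) = 1"
    and cont: "\<And>B :: 'a mat. B \<in> carrier_mat n n \<Longrightarrow> det B = 1 \<Longrightarrow> unit_cols (Suc k) B \<Longrightarrow> B \<in> transvection_products n"
  shows "A \<in> transvection_products n"
  using assms(1-5)
proof (induction "card {i. i < n \<and> i \<noteq> k \<and> A $$ (i, k) \<noteq> 0}" arbitrary: A rule: less_induct)
  case less
  let ?S = "\<lambda>A. {i. i < n \<and> i \<noteq> k \<and> A $$ (i, k) \<noteq> 0}"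
  show ?case
  proof (cases "?S A = {}")
    case True
    then have "unit_cols (Suc k) A"
      using less.prems(1,4,5) by (auto simp: unit_cols_def less_Suc_eq)
    then show ?thesis by (rule cont[OF less.prems(1,2)])
  next
    case False
    then obtain i where i: "i < n" "i \<noteq> k" "A $$ (i, k) \<noteq> 0" by blast
    let ?B = "addrow (- A $$ (i, k)) i k A"
    have B: "?B \<in> carrier_mat n n" using less.prems by auto
    have entry: "?B $$ (i', k) = (if i' = i then 0 else A $$ (i', k))" if "i' < n" for i'
      using that less.prems(1,3,5) i(1) by simp
    then have "?S ?B \<subseteq> ?S A" by (auto split: if_splits)
    moreover have "i \<in> ?S A" "i \<notin> ?S ?B" using entry[OF i(1)] i by auto
    ultimately have "?S ?B \<subset> ?S A" by blast
    then have "card (?S ?B) < card (?S A)" by (intro psubset_card_mono) simp_all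
    moreover have "det ?B = 1" using less.prems i by (simp add: det_addrow_neq[of _ _ n])
    moreover have "unit_cols k ?B" using less.prems by (intro unit_cols_addrow) auto
    moreover have "?B $$ (k, k) = 1" using less.prems i by simp
    ultimately have "?B \<in> transvection_products n"
      by (intro less.hyps[OF _ B]) (use less.prems(3) in auto)
    then show ?thesis using transvection_products_addrow[OF i(1) less.prems(3) i(2) less.prems(1)] by blast
  qed
qed

lemma ex_pivot:
  assumes A: "A \<in> carrier_mat n n" and det: "det A \<noteq> 0" and k: "k < n" and u: "unit_cols k A"
  shows "\<exists>i. k \<le> i \<and> i < n \<and> A $$ (i, k) \<noteq> 0"
proof (rule ccontr)
  assume none: "\<not> (\<exists>i. k \<le> i \<and> i < n \<and> A $$ (i, k) \<noteq> 0)"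
  \<comment> \<open>If column \<open>k\<close> vanished from row \<open>k\<close> on, it would be a
    combination of the preceding unit columns with its own entries as coefficients; \<open>v\<close>
    records this linear relation.\<close>
  define v where "v = vec n (\<lambda>i. if i < k then - A $$ (i, k) else if i = k then 1 else 0)"
  have v: "v \<in> carrier_vec n" by (simp add: v_def)
  have "v $ k = 1" using k by (simp add: v_def)
  then have nz: "v \<noteq> 0\<^sub>v n" using k by auto
  have "A *\<^sub>v v = 0\<^sub>v n"
  proof (rule eq_vecI)
    fix i assume "i < dim_vec (0\<^sub>v n :: 'a vec)"
    then have i: "i < n" by simp
    have "(A *\<^sub>v v) $ i = (\<Sum>l\<in>{0..<n}. A $$ (i, l) * v $ l)"
      using A i v by (simp add: scalar_prod_def)
    also have "\<dots> = (\<Sum>l\<in>{0..<n}. (if l = i \<and> i < k then - A $$ (i, k) else 0) + (if l = k then A $$ (i, k) else 0))"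
      by (rule sum.cong[OF refl]) (use u A i in \<open>auto simp: unit_cols_def v_def\<close>)
    also have "\<dots> = (if i < k then - A $$ (i, k) else 0) + A $$ (i, k)"
      using i k by (simp add: sum.distrib)
    also have "\<dots> = 0" using none i by auto
    finally show "(A *\<^sub>v v) $ i = 0\<^sub>v n $ i" using i by simp
  qed (use A in simp)
  then have "det A = 0" using det_0_iff_vec_prod_zero_field[OF A] v nz by blast
  then show False using det by simp
qed

text \<open>Transvections cannot rescale a row, so the pivot is made 1 by means of a nonzero entry
  below it. Such an entry is created if necessary, except in the last column, where the determinant
  does the work.\<close>

lemma unit_cols_imp_transvection_products:
  fixes A :: "'a::field mat"
  assumes "A \<in> carrier_mat n n" "det A = 1" "k \<le> n" "unit_cols k A"
  shows "A \<in> transvection_products n"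
  using assms
proof (induction "n - k" arbitrary: k A)
  case 0
  then have "A = 1\<^sub>m n" by (intro eq_matI) (auto simp: unit_cols_def)
  then show ?case by (simp add: transvection_products.one)
next
  case (Suc d)
  have k: "k < n" and d: "d = n - Suc k" using Suc.hyps(2) by auto
  have cont: "B \<in> transvection_products n"
    if "B \<in> carrier_mat n n" "det B = 1" "unit_cols (Suc k) B" for B :: "'a mat"
    using Suc.hyps(1)[OF d that(1,2) _ that(3)] k by simp
  note clear = clear_column[OF _ _ k _ _ cont]
  have below: "B \<in> transvection_products n"
    if B: "B \<in> carrier_mat n n" "det B = 1" "unit_cols k B" and j: "j < n" "k < j" "B $$ (j, k) \<noteq> 0" for B :: "'a mat" and j
  proof -
    \<comment> \<open>The coefficient is chosen so that the new entry at position (k, k) is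
      1.\<close>
    let ?C = "addrow ((1 - B $$ (k, k)) / B $$ (j, k)) k j B"
    have "?C \<in> transvection_products n"
    proof (rule clear)
      show "unit_cols k ?C" using B j k by (intro unit_cols_addrow) auto
    qed (use B j k in \<open>auto simp: det_addrow_neq[of _ _ n]\<close>)
    then show ?thesis using transvection_products_addrow[OF k j(1) _ B(1)] j by blast
  qed
  obtain i where i: "k \<le> i" "i < n" "A $$ (i, k) \<noteq> 0"
    using ex_pivot[OF Suc.prems(1) _ k Suc.prems(4)] Suc.prems(2) by auto
  show ?case
  proof (cases "Suc k = n")
    case True
    \<comment> \<open>With all earlier columns equal to unit columns, the determinant is the last
      diagonal entry, which is therefore 1.\<close>
    have "upper_triangular A"
      using Suc.prems True by (auto simp: upper_triangular_def unit_cols_def)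
    then have "det A = (\<Prod>i = 0..<n. A $$ (i, i))"
      using det_upper_triangular[of A n] Suc.prems(1) by (simp add: prod_list_diag_prod)
    also have "\<dots> = (\<Prod>i = 0..<k. A $$ (i, i)) * A $$ (k, k)" using True by auto
    also have "(\<Prod>i = 0..<k. A $$ (i, i)) = 1"
      using Suc.prems by (intro prod.neutral) (auto simp: unit_cols_def)
    finally have "A $$ (k, k) = 1" using Suc.prems(2) by simp
    then show ?thesis by (rule clear[OF Suc.prems(1,2,4)])
  next
    case False
    show ?thesis
    proof (cases "i = k")
      case False
      then show ?thesis using below[OF Suc.prems(1,2,4)] i by auto
    next
      case True
      have sk: "Suc k < n" using k \<open>Suc k \<noteq> n\<close> by simp
      show ?thesis
      proof (cases "A $$ (Suc k, k) = 0")
        case False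
        then show ?thesis using below[OF Suc.prems(1,2,4) sk] by simp
      next
        case zero: True
        \<comment> \<open>Copying the nonzero pivot into the next row makes the case
          \<open>below\<close> applicable.\<close>
        let ?C = "addrow 1 (Suc k) k A"
        have "?C \<in> transvection_products n"
        proof (rule below[OF _ _ _ sk])
          show "unit_cols k ?C" using Suc.prems k by (intro unit_cols_addrow) auto
        qed (use Suc.prems sk i True zero k in \<open>auto simp: det_addrow_neq[of _ _ n]\<close>)
        then show ?thesis by (rule transvection_products_addrow[OF sk k _ Suc.prems(1), rotated]) simp
      qed
    qed
  qed
qed

lemma SL_eq_transvection_products:
  "{A \<in> carrier_mat n n. det A = (1 :: 'a::field)} = transvection_products n"
  using transvection_products_carrier unit_cols_imp_transvection_products[of _ n 0]
  by (auto simp: unit_cols_def)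

section \<open>Linear characters of SL_n, and its elements central modulo scalars\<close>

lemma addrow_mat_mult:
  assumes "k < n" "l < n" "k \<noteq> l"
  shows "addrow_mat n c k l * addrow_mat n d k l = addrow_mat n (c + d) k (l :: nat) "
proof -
  have "addrow_mat n c k l * addrow_mat n d k l = addrow c k l (addrow_mat n d k l)"
    by (rule addrow_mat[symmetric]) (use assms in auto)
  also have "\<dots> = addrow_mat n (c + d) k l"
    by (rule eq_matI) (use assms in \<open>auto simp: algebra_simps\<close>)
  finally show ?thesis .
qed

text \<open>For fixed \<open>k\<close> and \<open>l\<close> the transvections form a copy of the
  additive group of the field, in which \<open>p\<close> kills everything; a character thus sends
  each of them to a p-th root of unity. Transvections generate, and the values commute.\<close>

lemma SL_char_torsion:
  fixes D :: "'a::field mat \<Rightarrow> 'k::field"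
  assumes p: "of_nat p = (0 :: 'a)"
    and mult: "\<And>A B. \<lbrakk>A \<in> carrier_mat n n; det A = 1; B \<in> carrier_mat n n; det B = 1\<rbrakk> \<Longrightarrow> D (A * B) = D A * D B"
    and nz: "\<And>A. \<lbrakk>A \<in> carrier_mat n n; det A = 1\<rbrakk> \<Longrightarrow> D A \<noteq> 0"
    and A: "A \<in> carrier_mat n n" "det A = 1"
  shows "D A ^ p = 1"
proof -
  have D1: "D (1\<^sub>m n) = 1"
    using mult[of "1\<^sub>m n" "1\<^sub>m n"] nz[of "1\<^sub>m n"] by simp
  have "A \<in> transvection_products n" using A SL_eq_transvection_products by blast
  then show ?thesis
  proof (induction rule: transvection_products.induct)
    case one then show ?case by (simp add: D1)
  next
    case (step A k l c)
    let ?E = "\<lambda>c :: 'a. addrow_mat n c k l"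
    have E: "?E c \<in> carrier_mat n n" "det (?E c) = 1" for c using step by (auto simp: det_addrow_mat)
    have E0: "?E 0 = 1\<^sub>m n" by (rule eq_matI) (use step in auto)
    have "D (?E c) ^ t = D (?E (of_nat t * c))" for t
    proof (induction t)
      case 0
      then show ?case by (simp add: E0 D1)
    next
      case (Suc t)
      then show ?case
        using mult[OF E E, of c "of_nat t * c"] addrow_mat_mult[of k n l c "of_nat t * c"] step
        by (simp add: algebra_simps)
    qed
    from this[of p] have "D (?E c) ^ p = 1"
      using p D1 E0 by simp
    moreover have "A \<in> carrier_mat n n" "det A = 1" using step transvection_products_carrier by auto
    ultimately show ?case using step mult[OF E] by (simp add: power_mult_distrib)
  qed
qed

text \<open>Entries of M E = c E M are compared, with E elementary. If c = 1, column
  \<open>i\<close> vanishes off the diagonal and the diagonal entries at \<open>i\<close> and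
  \<open>j\<close> agree. This shows that SL_n modulo scalars has trivial centre.\<close>

lemma scalar_of_commute_up_to_scalar:
  fixes M :: "'a::field mat"
  assumes M: "M \<in> carrier_mat n n" "det M \<noteq> 0" and n: "n \<ge> 2"
    and comm: "\<And>i j. \<lbrakk>i < n; j < n; i \<noteq> j\<rbrakk> \<Longrightarrow> \<exists>c. M * addrow_mat n 1 i j = c \<cdot>\<^sub>m (addrow_mat n 1 i j * M)"
  shows "\<exists>d. M = d \<cdot>\<^sub>m 1\<^sub>m n"
proof -
  have entries: "(\<forall>k<n. k \<noteq> i \<longrightarrow> M $$ (k, i) = 0) \<and> M $$ (i, i) = M $$ (j, j)"
    if ij: "i < n" "j < n" "i \<noteq> j" for i j
  proof -
    obtain c where c: "M * addrow_mat n 1 i j = c \<cdot>\<^sub>m (addrow_mat n 1 i j * M)" using comm ij by blast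
    have "addcol 1 j i M = c \<cdot>\<^sub>m addrow 1 i j M"
      using c addcol_mat[OF M(1) ij(1), of 1 j] addrow_mat[OF M(1) ij(2), of 1 i] by simp
    then have eq: "addcol 1 j i M $$ (k, l) = (c \<cdot>\<^sub>m addrow 1 i j M) $$ (k, l)" for k l by simp
    have e: "M $$ (k, l) + (if l = j then M $$ (k, i) else 0)
        = c * (M $$ (k, l) + (if k = i then M $$ (j, l) else 0))" if "k < n" "l < n" for k l
      using eq[of k l] M(1) that by (auto simp: algebra_simps split: if_splits)
    \<comment> \<open>For c different from 1 every row of \<open>M\<close> other than row
      \<open>i\<close> vanishes, in particular row \<open>j\<close>, against the invertibility of
      \<open>M\<close>.\<close>
    have c1: "c = 1"
    proof (rule ccontr)
      assume c1: "c \<noteq> 1"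
      have zero: "M $$ (k, l) = 0" if "k < n" "l < n" "k \<noteq> i" for k l
      proof (cases "l = j")
        case False
        then have "(1 - c) * M $$ (k, l) = 0" using e[of k l] that by (simp add: algebra_simps)
        then show ?thesis using c1 by simp
      next
        case True
        have "(1 - c) * M $$ (k, i) = 0" using e[of k i] that ij by (simp add: algebra_simps)
        then have "M $$ (k, i) = 0" using c1 by simp
        then have "(1 - c) * M $$ (k, j) = 0" using e[of k j] that ij by (simp add: algebra_simps)
        then show ?thesis using c1 True by simp
      qed
      have "M\<^sup>T *\<^sub>v unit_vec n j = 0\<^sub>v n"
        by (rule eq_vecI) (use M(1) ij zero in auto)
      moreover have "unit_vec n j \<noteq> (0\<^sub>v n :: 'a vec)"
        using ij by (metis index_unit_vec(1) index_zero_vec(1) zero_neq_one)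
      ultimately have "det M\<^sup>T = 0"
        using det_0_iff_vec_prod_zero_field[of "M\<^sup>T" n] M(1) by (metis transpose_carrier_mat unit_vec_carrier)
      then show False using M by (simp add: det_transpose)
    qed
    have "M $$ (k, i) = 0" if "k < n" "k \<noteq> i" for k using e[of k j] that ij c1 by simp
    moreover have "M $$ (i, i) = M $$ (j, j)" using e[of i j] ij c1 by simp
    ultimately show ?thesis by blast
  qed
  have "M = M $$ (0, 0) \<cdot>\<^sub>m 1\<^sub>m n"
  proof (rule eq_matI)
    fix k l assume kl: "k < dim_row (M $$ (0, 0) \<cdot>\<^sub>m 1\<^sub>m n)" "l < dim_col (M $$ (0, 0) \<cdot>\<^sub>m 1\<^sub>m n)"
    then have kl: "k < n" "l < n" by auto
    obtain j where j: "j < n" "j \<noteq> l"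
      using n kl by (cases "l = 0") (auto intro: that[of 1] that[of 0])
    have "M $$ (k, l) = 0" if "k \<noteq> l" using entries[of l j] j kl that by blast
    moreover have "M $$ (l, l) = M $$ (0, 0)" using entries[of l 0] kl by (cases "l = 0") auto
    ultimately show "M $$ (k, l) = (M $$ (0, 0) \<cdot>\<^sub>m 1\<^sub>m n) $$ (k, l)" using kl by auto
  qed (use M in auto)
  then show ?thesis by blast
qed

section \<open>SL_n over a finite field as a finite group\<close>

lemma group_special_linear: "group (special_linear_group n :: 'a::field mat monoid)"
proof (rule groupI)
  fix A assume "A \<in> carrier (special_linear_group n :: 'a mat monoid)"
  then have A: "A \<in> carrier_mat n n" "det A = 1" by (auto simp: special_linear_group_def)
  then have "A \<in> Units (ring_mat TYPE('a) n ())" by (intro det_non_zero_imp_unit) simp_all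
  then obtain B where B: "B \<in> carrier_mat n n" "B * A = 1\<^sub>m n" unfolding Units_def ring_mat_def by auto
  then have "det B = 1" using det_mult[OF B(1) A(1)] A(2) by simp
  then show "\<exists>B\<in>carrier (special_linear_group n). B \<otimes>\<^bsub>special_linear_group n\<^esub> A = \<one>\<^bsub>special_linear_group n\<^esub>"
    using B by (auto simp: special_linear_group_def)
qed (auto simp: special_linear_group_def det_mult[of _ n] assoc_mult_mat[of _ n n _ n _ n])

lemma finite_special_linear: "finite (carrier (special_linear_group n :: 'a::{field,finite} mat monoid))"
proof (rule finite_subset)
  let ?P = "({..<n} \<times> {..<n}) \<rightarrow>\<^sub>E (UNIV :: 'a set)"
  show "carrier (special_linear_group n :: 'a mat monoid) \<subseteq> (\<lambda>f. mat n n f) ` ?P"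
  proof
    fix A assume "A \<in> carrier (special_linear_group n :: 'a mat monoid)"
    then have "A = mat n n (restrict (\<lambda>ij. A $$ ij) ({..<n} \<times> {..<n}))"
      by (intro eq_matI) (auto simp: special_linear_group_def)
    then show "A \<in> (\<lambda>f. mat n n f) ` ?P"
      by (rule image_eqI[where x="restrict (\<lambda>ij. A $$ ij) ({..<n} \<times> {..<n})" and f="mat n n"]) auto
  qed
  show "finite ((\<lambda>f. mat n n f) ` ?P)" by (intro finite_imageI finite_PiE) auto
qed

section \<open>Homogeneous components for a central element of prime order\<close>

text \<open>For an exponent \<open>j\<close> prime to \<open>m\<close>, a Bezout relation writes
  \<open>x\<close> as a product of powers of \<open>x [^] j\<close> and \<open>x [^] m\<close>, both
  trivial.\<close>

lemma (in group) int_pow_eq_one_iff_prime: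
  assumes "x \<in> carrier G" "prime m" "x [^] m = \<one>" "x \<noteq> \<one>"
  shows "x [^] (j::int) = \<one> \<longleftrightarrow> int m dvd j"
proof
  assume j: "x [^] j = \<one>"
  show "int m dvd j"
  proof (rule ccontr)
    assume "\<not> int m dvd j"
    then have "coprime (int m) j" using \<open>prime m\<close> by (simp add: prime_imp_coprime)
    then obtain u v where "u * j + v * int m = 1"
      by (metis bezout_int coprime_imp_gcd_eq_1 gcd.commute)
    then have "x = x [^] (j * u + int m * v)" using assms by (simp add: mult.commute)
    also have "\<dots> = (x [^] j) [^] u \<otimes> (x [^] int m) [^] v"
      using assms by (simp add: int_pow_mult int_pow_pow)
    also have "\<dots> = \<one>" using assms j by (simp add: int_pow_int)
    finally show False using assms by simp
  qed
next
  assume "int m dvd j"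
  then obtain k where "j = int m * k" by blast
  then show "x [^] j = \<one>" using assms by (simp add: int_pow_pow[symmetric] int_pow_int)
qed

lemma powi_eq_one_iff_prime:
  fixes \<zeta> :: "'k::field"
  assumes "prime m" "\<zeta> ^ m = 1" "\<zeta> \<noteq> 1"
  shows "\<zeta> powi j = 1 \<longleftrightarrow> int m dvd j"
proof -
  have nz: "\<zeta> \<noteq> 0" using assms by (metis power_0_left prime_gt_0_nat zero_neq_one less_irrefl)
  show ?thesis
  proof
    assume j: "\<zeta> powi j = 1"
    show "int m dvd j"
    proof (rule ccontr)
      assume "\<not> int m dvd j"
      then have "coprime (int m) j" using \<open>prime m\<close> by (simp add: prime_imp_coprime)
      then obtain u v where "u * j + v * int m = 1"
        by (metis bezout_int coprime_imp_gcd_eq_1 gcd.commute)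
      then have "\<zeta> = \<zeta> powi (j * u + int m * v)" by (simp add: mult.commute)
      also have "\<dots> = (\<zeta> powi j) powi u * (\<zeta> powi int m) powi v"
        using nz by (simp add: power_int_add power_int_mult)
      also have "\<dots> = 1" using assms j by simp
      finally show False using assms by simp
    qed
  next
    assume "int m dvd j"
    then obtain k where "j = int m * k" by blast
    then show "\<zeta> powi j = 1" using assms by (simp add: power_int_mult)
  qed
qed

text \<open>Degrees are integers throughout, summed over the residues \<open>{0..<int m}\<close>;
  for a periodic summand the index may be shifted without reducing it.\<close>

lemma sum_mod_shift:
  fixes f :: "int \<Rightarrow> 'b::comm_monoid_add" and m :: nat
  assumes "m > 0" and per: "\<And>j. f (j mod int m) = f j"
  shows "(\<Sum>j\<in>{0..<int m}. f (j + c)) = (\<Sum>j\<in>{0..<int m}. f j)"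
proof (rule sum.reindex_bij_witness[where i="\<lambda>j. (j - c) mod int m" and j="\<lambda>j. (j + c) mod int m"])
  fix j assume "j \<in> {0..<int m}"
  then show "((j + c) mod int m - c) mod int m = j" "((j - c) mod int m + c) mod int m = j"
    by (simp_all add: mod_diff_left_eq mod_add_left_eq)
qed (use assms in auto)

text \<open>Multiplication by a unit modulo \<open>m\<close> permutes the residues. It serves every
  comparison in which degrees are rescaled.\<close>

lemma sum_mod_mult:
  fixes f :: "int \<Rightarrow> 'b::comm_monoid_add" and m :: nat
  assumes "m > 0" and per: "\<And>j. f (j mod int m) = f j" and l: "(l * l') mod int m = 1 mod int m"
  shows "(\<Sum>j\<in>{0..<int m}. f (l * j)) = (\<Sum>j\<in>{0..<int m}. f j)"
proof (rule sum.reindex_bij_witness[where i="\<lambda>j. (l' * j) mod int m" and j="\<lambda>j. (l * j) mod int m"])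
  fix j assume j: "j \<in> {0..<int m}"
  have "(l * l' * j) mod int m = j" 
    using j l by (metis mod_mult_left_eq mult_1 mod_pos_pos_trivial atLeastLessThan_iff)
  then show "(l' * (l * j mod int m)) mod int m = j" "(l * (l' * j mod int m)) mod int m = j"
    by (simp_all add: mod_mult_right_eq ac_simps)
qed (use assms in auto)

text \<open>Orthogonality of the characters of a cyclic group: shifting the index multiplies the sum
  by \<open>\<zeta> powi g\<close>, so the sum vanishes unless this factor is 1.\<close>

lemma sum_power_int_root:
  fixes \<zeta> :: "'k::field"
  assumes "prime m" "\<zeta> ^ m = 1" "\<zeta> \<noteq> 1"
  shows "(\<Sum>j\<in>{0..<int m}. \<zeta> powi (j * g)) = (if int m dvd g then of_nat m else 0)"
proof (cases "int m dvd g")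
  case True
  then have "\<zeta> powi (j * g) = 1" for j
    using powi_eq_one_iff_prime[OF assms] by simp
  then show ?thesis using True by simp
next
  case False
  have nz: "\<zeta> \<noteq> 0" using assms by (metis power_0_left prime_gt_0_nat zero_neq_one less_irrefl)
  let ?w = "\<zeta> powi g" and ?S = "\<Sum>j\<in>{0..<int m}. \<zeta> powi (j * g)"
  have "?S = (\<Sum>j\<in>{0..<int m}. \<zeta> powi ((j + 1) * g))"
  proof (rule sum_mod_shift[symmetric])
    fix j
    have "int m dvd (j - j mod int m) * g" by (simp add: minus_mod_eq_mult_div)
    then have "\<zeta> powi ((j - j mod int m) * g) = 1" using powi_eq_one_iff_prime[OF assms] by simp
    then show "\<zeta> powi ((j mod int m) * g) = \<zeta> powi (j * g)"
      using nz by (simp add: left_diff_distrib power_int_diff)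
  qed (use assms prime_gt_0_nat in auto)
  also have "\<dots> = ?w * ?S"
    using nz by (simp add: distrib_right power_int_add sum_distrib_left mult.commute[of "\<zeta> powi g"])
  finally have "(?w - 1) * ?S = 0" by (simp add: algebra_simps)
  then show ?thesis using False powi_eq_one_iff_prime[OF assms, of g] by simp
qed

text \<open>The root \<open>\<zeta>\<close> selects a generating character of Z_m, the one with
  value \<open>\<zeta>\<close> at 1, and \<open>z\<close> is its intended image in the centre.
  Characteristic 0 allows averaging over the powers of \<open>z\<close>.\<close>

locale central_twist = group G for G :: "('g, 'r) monoid_scheme" (structure) +
  fixes m :: nat and z :: 'g and \<zeta> :: "'k::field_char_0"
  assumes finite_G: "finite (carrier G)" and prime_m: "prime m"
    and z_center: "z \<in> group_center G" and z_pow_m: "z [^] m = \<one>" and z_neq_one: "z \<noteq> \<one>"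
    and zeta_pow_m: "\<zeta> ^ m = 1" and zeta_neq_one: "\<zeta> \<noteq> 1"
begin

abbreviation I where "I \<equiv> {0..<int m}"

lemma m_pos: "m > 0" using prime_m by (simp add: prime_gt_0_nat)

lemma zeta_nz: "\<zeta> \<noteq> 0"
  using zeta_pow_m m_pos by (metis power_0_left zero_neq_one less_irrefl)

lemma zeta_one_iff: "\<zeta> powi j = 1 \<longleftrightarrow> int m dvd j"
  by (rule powi_eq_one_iff_prime[OF prime_m zeta_pow_m zeta_neq_one])

lemma zeta_eq_iff: "\<zeta> powi i = \<zeta> powi j \<longleftrightarrow> i mod int m = j mod int m"
  using zeta_one_iff[of "i - j"] zeta_nz by (simp add: power_int_diff mod_eq_dvd_iff)

lemma z_closed [simp, intro]: "z \<in> carrier G"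
  using z_center by (simp add: group_center_def)

lemma z_comm: "x \<in> carrier G \<Longrightarrow> z \<otimes> x = x \<otimes> z"
  using z_center by (simp add: group_center_def)

lemma zp_one_iff: "z [^] (j::int) = \<one> \<longleftrightarrow> int m dvd j"
  by (rule int_pow_eq_one_iff_prime[OF z_closed prime_m z_pow_m z_neq_one])

lemma zp_eq_iff: "z [^] (i::int) = z [^] j \<longleftrightarrow> i mod int m = j mod int m"
proof -
  have "z [^] i = z [^] (i - j) \<otimes> z [^] j" by (simp add: int_pow_mult[symmetric])
  then have "z [^] i = z [^] j \<longleftrightarrow> z [^] (i - j) = \<one>" by (simp add: r_cancel_one')
  then show ?thesis by (simp add: zp_one_iff mod_eq_dvd_iff)
qed

lemma zp_mod [simp]: "z [^] (j mod int m) = z [^] (j::int)"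
  by (simp add: zp_eq_iff)

lemma zp_comm: "x \<in> carrier G \<Longrightarrow> z [^] (j::int) \<otimes> x = x \<otimes> z [^] j"
proof -
  assume x: "x \<in> carrier G"
  have "subgroup {y \<in> carrier G. y \<otimes> x = x \<otimes> y} G"
  proof
    fix y assume y: "y \<in> {y \<in> carrier G. y \<otimes> x = x \<otimes> y}"
    then have yc: "y \<in> carrier G" by simp
    from y have "inv y \<otimes> (y \<otimes> x) \<otimes> inv y = inv y \<otimes> (x \<otimes> y) \<otimes> inv y" by simp
    moreover have "inv y \<otimes> (y \<otimes> x) = x" using x yc by (simp add: m_assoc[symmetric])
    moreover have "inv y \<otimes> (x \<otimes> y) \<otimes> inv y = inv y \<otimes> x" using x yc by (simp add: m_assoc)
    ultimately show "inv y \<in> {y \<in> carrier G. y \<otimes> x = x \<otimes> y}"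
      using y by simp
  next
    fix y y' assume "y \<in> {y \<in> carrier G. y \<otimes> x = x \<otimes> y}" "y' \<in> {y \<in> carrier G. y \<otimes> x = x \<otimes> y}"
    then show "y \<otimes> y' \<in> {y \<in> carrier G. y \<otimes> x = x \<otimes> y}"
      using x by clarsimp (metis m_assoc)
  qed (use x in auto)
  then have "z [^] j \<in> {y \<in> carrier G. y \<otimes> x = x \<otimes> y}"
    by (rule subgroup_int_pow_closed) (simp add: x z_comm)
  then show ?thesis by simp
qed

lemma zp_middle:
  assumes "x \<in> carrier G" "y \<in> carrier G"
  shows "(x \<otimes> z [^] (j::int)) \<otimes> y = (x \<otimes> y) \<otimes> z [^] j"
  using assms zp_comm[OF assms(2), of j] by (simp add: m_assoc)

lemma zp_middle2:
  assumes "x \<in> carrier G" "y \<in> carrier G"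
  shows "(x \<otimes> z [^] (i::int)) \<otimes> (y \<otimes> z [^] (j::int)) = (x \<otimes> y) \<otimes> z [^] (i + j)"
proof -
  have "z [^] i \<otimes> (y \<otimes> z [^] j) = y \<otimes> z [^] (i + j)"
    using assms zp_comm[OF assms(2), of i] by (simp add: m_assoc[symmetric] int_pow_mult)
  then show ?thesis using assms by (simp add: m_assoc)
qed

lemma zp_inv: "x \<in> carrier G \<Longrightarrow> inv (x \<otimes> z [^] (j::int)) = inv x \<otimes> z [^] (- j)"
  by (simp add: inv_mult_group int_pow_neg zp_comm[of "inv x" "- j", simplified int_pow_neg[OF z_closed]])

definition proj :: "('g \<Rightarrow> 'k) \<Rightarrow> int \<Rightarrow> 'g \<Rightarrow> 'k" where
  "proj \<phi> g x = (\<Sum>j\<in>I. \<zeta> powi (- (j * g)) * \<phi> (x \<otimes> z [^] j)) / of_nat m"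

definition homog :: "int \<Rightarrow> ('g \<Rightarrow> 'k) \<Rightarrow> bool" where
  "homog g \<phi> \<longleftrightarrow> (\<forall>x\<in>carrier G. \<forall>j::int. \<phi> (x \<otimes> z [^] j) = \<zeta> powi (j * g) * \<phi> x)"

text \<open>One translation by \<open>z\<close> suffices: nonnegative powers follow by induction,
  all others by reducing the exponent modulo \<open>m\<close>.\<close>

lemma homogI:
  assumes "\<And>x. x \<in> carrier G \<Longrightarrow> \<phi> (x \<otimes> z) = \<zeta> powi g * \<phi> x"
  shows "homog g \<phi>"
proof -
  have nat: "\<phi> (x \<otimes> z [^] (int n)) = \<zeta> powi (int n * g) * \<phi> x" if x: "x \<in> carrier G" for n x
  proof (induction n)
    case 0 then show ?case using x by simp
  next
    case (Suc n)
    have "x \<otimes> z [^] (int (Suc n)) = (x \<otimes> z [^] int n) \<otimes> z"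
      unfolding int_pow_int using x by (simp add: m_assoc)
    then have "\<phi> (x \<otimes> z [^] (int (Suc n))) = \<zeta> powi g * (\<zeta> powi (int n * g) * \<phi> x)"
      using Suc assms x by simp
    then show ?case using zeta_nz by (simp add: distrib_right power_int_add)
  qed
  show ?thesis
    unfolding homog_def
  proof (intro ballI allI)
    fix x and j :: int assume x: "x \<in> carrier G"
    have eq: "(j mod int m * g) mod int m = (j * g) mod int m" by (simp add: mod_mult_left_eq)
    have "\<phi> (x \<otimes> z [^] j) = \<phi> (x \<otimes> z [^] (int (nat (j mod int m))))"
      using m_pos by simp
    also have "\<dots> = \<zeta> powi (j mod int m * g) * \<phi> x"
      using m_pos by (subst nat[OF x]) simp
    also have "\<zeta> powi (j mod int m * g) = \<zeta> powi (j * g)"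
      by (simp add: zeta_eq_iff eq)
    finally show "\<phi> (x \<otimes> z [^] j) = \<zeta> powi (j * g) * \<phi> x" .
  qed
qed

lemma homogD: "homog g \<phi> \<Longrightarrow> x \<in> carrier G \<Longrightarrow> \<phi> (x \<otimes> z [^] (j::int)) = \<zeta> powi (j * g) * \<phi> x"
  by (simp add: homog_def)

lemma homog_cong: "homog g \<phi> \<Longrightarrow> (\<And>x. x \<in> carrier G \<Longrightarrow> \<phi> x = \<psi> x) \<Longrightarrow> homog g \<psi>"
  by (simp add: homog_def)

lemma proj_cong:
  assumes "\<And>x. x \<in> carrier G \<Longrightarrow> \<phi> x = \<psi> x" "x \<in> carrier G"
  shows "proj \<phi> g x = proj \<psi> g x"
  using assms by (simp add: proj_def)

lemma zeta_mod_mult: "\<zeta> powi (j * (g mod int m)) = \<zeta> powi (j * g)"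
  "\<zeta> powi ((g mod int m) * j) = \<zeta> powi (g * j)"
  by (simp_all add: zeta_eq_iff mod_mult_right_eq mod_mult_left_eq)

lemma proj_mod [simp]: "proj \<phi> (g mod int m) = proj \<phi> g"
  by (rule ext) (simp add: proj_def power_int_minus zeta_mod_mult)

lemma proj_mod_eq: "g mod int m = h mod int m \<Longrightarrow> proj \<phi> g = proj \<phi> h"
  by (metis proj_mod)

lemma homog_proj: "homog g (proj \<phi> g)"
proof (rule homogI)
  fix x assume x: "x \<in> carrier G"
  have "(\<Sum>j\<in>I. \<zeta> powi (- (j * g)) * \<phi> (x \<otimes> z \<otimes> z [^] j))
      = (\<Sum>j\<in>I. \<zeta> powi g * (\<zeta> powi (- ((j + 1) * g)) * \<phi> (x \<otimes> z [^] (j + 1))))"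
  proof (rule sum.cong[OF refl])
    fix j
    have "\<zeta> powi g * \<zeta> powi (- ((j + 1) * g)) = \<zeta> powi (- (j * g))"
      using zeta_nz by (simp add: power_int_add[symmetric] algebra_simps)
    moreover have "x \<otimes> z \<otimes> z [^] j = x \<otimes> z [^] (j + 1)"
      using x zp_comm[of z j] by (simp add: int_pow_mult m_assoc)
    ultimately show "\<zeta> powi (- (j * g)) * \<phi> (x \<otimes> z \<otimes> z [^] j)
        = \<zeta> powi g * (\<zeta> powi (- ((j + 1) * g)) * \<phi> (x \<otimes> z [^] (j + 1)))"
      by (metis mult.assoc)
  qed
  also have "\<dots> = \<zeta> powi g * (\<Sum>j\<in>I. \<zeta> powi (- ((j + 1) * g)) * \<phi> (x \<otimes> z [^] (j + 1)))"
    by (simp add: sum_distrib_left)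
  also have "(\<Sum>j\<in>I. \<zeta> powi (- ((j + 1) * g)) * \<phi> (x \<otimes> z [^] (j + 1)))
      = (\<Sum>j\<in>I. \<zeta> powi (- (j * g)) * \<phi> (x \<otimes> z [^] j))"
    by (rule sum_mod_shift[OF m_pos, where f="\<lambda>j. \<zeta> powi (- (j * g)) * \<phi> (x \<otimes> z [^] j)"])
       (simp add: power_int_minus zeta_mod_mult)
  finally show "proj \<phi> g (x \<otimes> z) = \<zeta> powi g * proj \<phi> g x"
    by (simp add: proj_def)
qed

lemma proj_homog:
  assumes "homog h \<phi>" "x \<in> carrier G"
  shows "proj \<phi> g x = (if g mod int m = h mod int m then \<phi> x else 0)"
proof -
  have "\<zeta> powi (- (j * g)) * \<phi> (x \<otimes> z [^] j) = \<zeta> powi (j * (h - g)) * \<phi> x" for j :: int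
    using homogD[OF assms, of j] zeta_nz by (simp add: power_int_add[symmetric] algebra_simps power_int_diff power_int_minus divide_simps)
  then have "proj \<phi> g x = (\<Sum>j\<in>I. \<zeta> powi (j * (h - g))) * \<phi> x / of_nat m"
    by (simp add: proj_def sum_distrib_right)
  also have "\<dots> = (if g mod int m = h mod int m then \<phi> x else 0)"
    using m_pos by (simp add: sum_power_int_root[OF prime_m zeta_pow_m zeta_neq_one] mod_eq_dvd_iff dvd_diff_commute)
  finally show ?thesis .
qed

text \<open>Fourier inversion: summing over the degrees first leaves only the translate with
  \<open>j = 0\<close>, by orthogonality.\<close>

lemma sum_proj:
  assumes "x \<in> carrier G"
  shows "(\<Sum>g\<in>I. proj \<phi> g x) = \<phi> x"
proof -
  have "(\<Sum>g\<in>I. proj \<phi> g x) = (\<Sum>g\<in>I. \<Sum>j\<in>I. \<zeta> powi (- (j * g)) * \<phi> (x \<otimes> z [^] j)) / of_nat m"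
    by (simp add: proj_def sum_divide_distrib)
  also have "(\<Sum>g\<in>I. \<Sum>j\<in>I. \<zeta> powi (- (j * g)) * \<phi> (x \<otimes> z [^] j))
     = (\<Sum>j\<in>I. (\<Sum>g\<in>I. \<zeta> powi (g * (- j))) * \<phi> (x \<otimes> z [^] j))"
    by (subst sum.swap) (simp add: sum_distrib_right mult.commute[of "_ :: int"])
  also have "\<dots> = (\<Sum>j\<in>I. if j = 0 then of_nat m * \<phi> x else 0)"
  proof (rule sum.cong[OF refl])
    fix j assume "j \<in> I"
    then have "int m dvd - j \<longleftrightarrow> j = 0"
      using zdvd_not_zless[of j "int m"] by force
    then show "(\<Sum>g\<in>I. \<zeta> powi (g * (- j))) * \<phi> (x \<otimes> z [^] j) = (if j = 0 then of_nat m * \<phi> x else 0)"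
      using assms sum_power_int_root[OF prime_m zeta_pow_m zeta_neq_one, of "- j"]
      by simp
  qed
  also have "\<dots> = of_nat m * \<phi> x" using m_pos by simp
  finally show ?thesis using m_pos by simp
qed

lemma proj_mult_homog:
  assumes "homog h \<phi>" "x \<in> carrier G"
  shows "proj (\<lambda>y. \<phi> y * \<psi> y) g x = \<phi> x * proj \<psi> (g - h) x"
proof -
  have "\<zeta> powi (- (j * g)) * (\<phi> (x \<otimes> z [^] j) * \<psi> (x \<otimes> z [^] j))
     = \<phi> x * (\<zeta> powi (- (j * (g - h))) * \<psi> (x \<otimes> z [^] j))" for j :: int
    using homogD[OF assms, of j] zeta_nz
    by (simp add: right_diff_distrib power_int_diff power_int_minus divide_simps)
  then show ?thesis unfolding proj_def by (simp only: sum_distrib_left times_divide_eq_right)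
qed

lemma proj_sum: "proj (\<lambda>y. \<Sum>i\<in>A. f i y) g x = (\<Sum>i\<in>A. proj (f i) g x)"
  unfolding proj_def sum_distrib_left
  by (subst sum.swap) (simp add: sum_divide_distrib)

lemma proj_add: "proj (\<lambda>y. \<phi> y + \<psi> y) g x = proj \<phi> g x + proj \<psi> g x"
  by (simp add: proj_def distrib_left sum.distrib add_divide_distrib)

lemma proj_scale: "proj (\<lambda>y. c * \<phi> y) g x = c * proj \<phi> g x"
  by (simp add: proj_def sum_distrib_left mult.left_commute)

lemma proj_rtrans:
  assumes "x \<in> carrier G" "y \<in> carrier G"
  shows "proj (\<lambda>w. \<phi> (w \<otimes> y)) g x = proj \<phi> g (x \<otimes> y)"
  using assms by (simp add: proj_def zp_middle)

lemma proj_const_one: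
  assumes "x \<in> carrier G" shows "proj (\<lambda>y. 1) g x = (if int m dvd g then 1 else 0)"
  using proj_homog[of 0 "\<lambda>y. 1" x g] assms by (simp add: homog_def dvd_eq_mod_eq_0)

lemma sum_delta_fun:
  assumes "y \<in> carrier G"
  shows "(\<Sum>x\<in>carrier G. f x * delta_fun G x y) = f y"
    "(\<Sum>x\<in>carrier G. delta_fun G x y * f x) = f y"
  using assms finite_G by (simp_all add: delta_fun_def if_distrib[of "(*) _"] if_distrib[of "\<lambda>t. t * _"] cong: if_cong)

text \<open>\<open>f\<close> is the combination of the delta functions with its values as
  coefficients, and \<open>proj\<close> is linear.\<close>

lemma proj_delta:
  assumes "w \<in> carrier G"
  shows "(\<Sum>x\<in>carrier G. f x * proj (delta_fun G x) g w) = proj f g w"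
proof -
  have "(\<Sum>x\<in>carrier G. f x * proj (delta_fun G x) g w) = proj (\<lambda>y. \<Sum>x\<in>carrier G. f x * delta_fun G x y) g w"
    by (simp add: proj_sum proj_scale)
  also have "\<dots> = proj f g w"
    by (rule proj_cong) (simp_all add: sum_delta_fun assms)
  finally show ?thesis .
qed

lemma homog_ltrans:
  assumes "homog g \<phi>" "w \<in> carrier G"
  shows "homog g (\<lambda>y. \<phi> (w \<otimes> y))"
  using assms by (auto simp: homog_def m_assoc[symmetric])

text \<open>The comultiplication maps degree \<open>g\<close> into the tensor square of degree
  \<open>g\<close>: in each variable separately, (x, y) \<mapsto> \<open>\<phi>\<close> (x y) has
  the degree of \<open>\<phi>\<close>, so mixed components vanish.\<close>

lemma proj_delta2:
  assumes "w \<in> carrier G" "v \<in> carrier G"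
  shows "(\<Sum>x\<in>carrier G. \<Sum>y\<in>carrier G. \<phi> (x \<otimes> y) * (proj (delta_fun G x) g w * proj (delta_fun G y) h v))
       = (if g mod int m = h mod int m then proj \<phi> g (w \<otimes> v) else 0)"
proof -
  have "(\<Sum>x\<in>carrier G. \<Sum>y\<in>carrier G. \<phi> (x \<otimes> y) * (proj (delta_fun G x) g w * proj (delta_fun G y) h v))
      = (\<Sum>y\<in>carrier G. (\<Sum>x\<in>carrier G. \<phi> (x \<otimes> y) * proj (delta_fun G x) g w) * proj (delta_fun G y) h v)"
    by (subst sum.swap) (simp add: sum_distrib_right mult.assoc)
  also have "\<dots> = (\<Sum>y\<in>carrier G. proj \<phi> g (w \<otimes> y) * proj (delta_fun G y) h v)"
    using assms by (intro sum.cong refl) (simp add: proj_delta[of w "\<lambda>x. \<phi> (x \<otimes> _)"] proj_rtrans)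
  also have "\<dots> = proj (\<lambda>y. proj \<phi> g (w \<otimes> y)) h v"
    using assms by (simp add: proj_delta)
  also have "\<dots> = (if g mod int m = h mod int m then proj \<phi> g (w \<otimes> v) else 0)"
    using proj_homog[OF homog_ltrans[OF homog_proj assms(1)] assms(2)] by auto
  finally show ?thesis .
qed

end

section \<open>Automorphisms fixing the central element and the twisted product\<close>

lemma auto_closed: "f \<in> auto G \<Longrightarrow> x \<in> carrier G \<Longrightarrow> f x \<in> carrier G"
  by (auto simp: auto_def hom_def)

lemma auto_mult: "f \<in> auto G \<Longrightarrow> x \<in> carrier G \<Longrightarrow> y \<in> carrier G \<Longrightarrow> f (x \<otimes>\<^bsub>G\<^esub> y) = f x \<otimes>\<^bsub>G\<^esub> f y"
  by (auto simp: auto_def hom_def)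

lemma auto_bij: "f \<in> auto G \<Longrightarrow> bij_betw f (carrier G) (carrier G)"
  by (simp add: auto_def Bij_def)

lemma auto_extensional: "f \<in> auto G \<Longrightarrow> f \<in> extensional (carrier G)"
  by (simp add: auto_def Bij_def)

lemma auto_eqI:
  "f \<in> auto G \<Longrightarrow> h \<in> auto G \<Longrightarrow> (\<And>x. x \<in> carrier G \<Longrightarrow> f x = h x) \<Longrightarrow> f = h"
  by (rule extensionalityI[OF auto_extensional auto_extensional])

lemma carrier_AutoGroup [simp]: "carrier (AutoGroup G) = auto G"
  by (simp add: AutoGroup_def)

lemma one_AutoGroup_apply [simp]: "x \<in> carrier G \<Longrightarrow> \<one>\<^bsub>AutoGroup G\<^esub> x = x"
  by (simp add: AutoGroup_def BijGroup_def)

lemma mult_AutoGroup_apply: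
  "f \<in> auto G \<Longrightarrow> h \<in> auto G \<Longrightarrow> x \<in> carrier G \<Longrightarrow> (f \<otimes>\<^bsub>AutoGroup G\<^esub> h) x = f (h x)"
  by (simp add: AutoGroup_def BijGroup_def auto_def compose_def)

context group
begin

interpretation AG: group "AutoGroup G" by (rule AutoGroup)

lemma autoI:
  assumes "f \<in> hom G G" "bij_betw f (carrier G) (carrier G)" "f \<in> extensional (carrier G)"
  shows "f \<in> auto G"
  using assms by (simp add: auto_def Bij_def)

lemma auto_one: "f \<in> auto G \<Longrightarrow> f \<one> = \<one>"
  by (rule hom_one[OF _ is_group is_group]) (simp add: auto_def)

lemma auto_inv: "f \<in> auto G \<Longrightarrow> x \<in> carrier G \<Longrightarrow> f (inv x) = inv (f x)"
  by (rule group_hom.hom_inv) (auto simp: group_hom_def group_hom_axioms_def auto_def)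

lemma auto_int_pow: "f \<in> auto G \<Longrightarrow> x \<in> carrier G \<Longrightarrow> f (x [^] (j::int)) = f x [^] j"
  by (rule hom_int_pow[OF _ _ is_group is_group]) (auto simp: auto_def)

lemma inv_AutoGroup_apply:
  assumes "f \<in> auto G" "x \<in> carrier G"
  shows "f ((inv\<^bsub>AutoGroup G\<^esub> f) x) = x" "(inv\<^bsub>AutoGroup G\<^esub> f) (f x) = x"
    "inv_into (carrier G) f x = (inv\<^bsub>AutoGroup G\<^esub> f) x"
proof -
  let ?i = "inv\<^bsub>AutoGroup G\<^esub> f"
  have i: "?i \<in> auto G" using AG.inv_closed[of f] assms by simp
  have "f (?i x) = (f \<otimes>\<^bsub>AutoGroup G\<^esub> ?i) x" by (rule mult_AutoGroup_apply[OF assms(1) i assms(2), symmetric])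
  then show 1: "f (?i x) = x" using assms by (simp add: one_AutoGroup_apply)
  have "?i (f x) = (?i \<otimes>\<^bsub>AutoGroup G\<^esub> f) x" by (rule mult_AutoGroup_apply[OF i assms(1,2), symmetric])
  then show "?i (f x) = x" using assms by (simp add: one_AutoGroup_apply)
  show "inv_into (carrier G) f x = ?i x"
    using 1 assms by (intro inv_into_f_eq) (auto simp: auto_closed[OF i] bij_betw_def dest: auto_bij)
qed

end

context central_twist
begin

sublocale AG: group "AutoGroup G" by (rule AutoGroup)

text \<open>The possible values at the generator 1 of an action of Z_m that fixes \<open>z\<close>.
  Once the centre is generated by \<open>z\<close>, this set is \<open>X_base m G\<close>.\<close>

definition torsion_auts :: "('g \<Rightarrow> 'g) set" where
  "torsion_auts = {a \<in> auto G. a z = z \<and> a [^]\<^bsub>AutoGroup G\<^esub> m = \<one>\<^bsub>AutoGroup G\<^esub>}"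

abbreviation ap :: "('g \<Rightarrow> 'g) \<Rightarrow> int \<Rightarrow> 'g \<Rightarrow> 'g" where
  "ap a j \<equiv> a [^]\<^bsub>AutoGroup G\<^esub> j"

lemma torsion_auts_auto: "a \<in> torsion_auts \<Longrightarrow> a \<in> auto G"
  by (simp add: torsion_auts_def)

lemma ap_auto: "a \<in> torsion_auts \<Longrightarrow> ap a j \<in> auto G"
  using AG.int_pow_closed[of a j] by (simp add: torsion_auts_def)

lemma ap_closed [simp]: "a \<in> torsion_auts \<Longrightarrow> x \<in> carrier G \<Longrightarrow> ap a j x \<in> carrier G"
  by (rule auto_closed[OF ap_auto])

lemma ap_mult: "a \<in> torsion_auts \<Longrightarrow> x \<in> carrier G \<Longrightarrow> y \<in> carrier G \<Longrightarrow> ap a j (x \<otimes> y) = ap a j x \<otimes> ap a j y"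
  by (rule auto_mult[OF ap_auto])

lemma ap_1 [simp]: "a \<in> torsion_auts \<Longrightarrow> ap a 1 = a"
  by (simp add: torsion_auts_def AG.int_pow_1)

lemma ap_add: "a \<in> torsion_auts \<Longrightarrow> x \<in> carrier G \<Longrightarrow> ap a (i + j) x = ap a i (ap a j x)"
  using AG.int_pow_mult[of a i j] mult_AutoGroup_apply[OF ap_auto ap_auto] by (simp add: torsion_auts_def)

lemma ap_pow_m: "a \<in> torsion_auts \<Longrightarrow> ap a (int m * k) = \<one>\<^bsub>AutoGroup G\<^esub>"
  by (simp add: torsion_auts_def AG.int_pow_pow[symmetric] int_pow_int)

lemma ap_eq: assumes "a \<in> torsion_auts" "i mod int m = j mod int m" shows "ap a i = ap a j"
proof -
  obtain k where k: "i = j + int m * k" using assms(2) by (metis mod_eqE)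
  have "ap a i = ap a j \<otimes>\<^bsub>AutoGroup G\<^esub> ap a (int m * k)"
    unfolding k using assms by (intro AG.int_pow_mult) (simp add: torsion_auts_def)
  then show ?thesis using assms(1) ap_auto[OF assms(1), of j] by (simp add: ap_pow_m)
qed

lemma ap_mod [simp]: "a \<in> torsion_auts \<Longrightarrow> ap a (j mod int m) = ap a j"
  by (rule ap_eq) simp_all

lemma ap_mod_minus [simp]: "a \<in> torsion_auts \<Longrightarrow> ap a (- (j mod int m)) = ap a (- j)"
  by (rule ap_eq) (simp_all add: mod_minus_eq)

lemma ap_neg_apply [simp]:
  "a \<in> torsion_auts \<Longrightarrow> x \<in> carrier G \<Longrightarrow> ap a j (ap a (- j) x) = x"
  "a \<in> torsion_auts \<Longrightarrow> x \<in> carrier G \<Longrightarrow> ap a (- j) (ap a j x) = x"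
  using ap_add[of a x j "- j"] ap_add[of a x "- j" j] by simp_all

lemma ap_z: assumes "a \<in> torsion_auts" shows "ap a j z = z"
proof -
  have "ap a (int n) z = z" for n
  proof (induction n)
    case (Suc n)
    have "ap a (int (Suc n)) z = ap a (int n) (a z)"
      using ap_add[OF assms, of z "int n" 1] assms by (simp add: add.commute)
    then show ?case using Suc assms by (simp add: torsion_auts_def)
  qed simp
  from this[of "nat (j mod int m)"] show ?thesis using m_pos assms by simp
qed

lemma ap_zp: "a \<in> torsion_auts \<Longrightarrow> x \<in> carrier G \<Longrightarrow> ap a j (x \<otimes> z [^] (i::int)) = ap a j x \<otimes> z [^] i"
  by (simp add: ap_mult auto_int_pow[OF ap_auto] ap_z)

lemma ap_torsion_auts: assumes "a \<in> torsion_auts" shows "ap a j \<in> torsion_auts"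
proof -
  have "ap a j [^]\<^bsub>AutoGroup G\<^esub> m = ap a (int m * j)"
    using assms by (simp add: torsion_auts_def AG.int_pow_pow int_pow_int[symmetric] mult.commute)
  then show ?thesis using ap_auto[OF assms] ap_z[OF assms] ap_pow_m[OF assms] by (simp add: torsion_auts_def)
qed

lemma ap_ap: "a \<in> torsion_auts \<Longrightarrow> ap (ap a i) j = ap a (i * j)"
  by (simp add: AG.int_pow_pow torsion_auts_def)

lemma proj_ap:
  assumes "a \<in> torsion_auts" "x \<in> carrier G"
  shows "proj (\<lambda>y. \<phi> (ap a j y)) g x = proj \<phi> g (ap a j x)"
  using assms by (simp add: proj_def ap_zp)

text \<open>The sign in \<open>- g\<close> arises because an automorphism acts on functions by
  composition with its inverse.\<close>

definition tmult :: "('g \<Rightarrow> 'g) \<Rightarrow> ('g \<Rightarrow> 'k) \<Rightarrow> ('g \<Rightarrow> 'k) \<Rightarrow> 'g \<Rightarrow> 'k" where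
  "tmult a \<phi> \<psi> = (\<lambda>x\<in>carrier G. \<Sum>g\<in>I. proj \<phi> g x * \<psi> (ap a (- g) x))"

text \<open>Here the inverse of \<open>g\<close> acts, so the two inversions cancel and
  \<open>ap a g\<close> appears without a sign.\<close>

definition tanti :: "('g \<Rightarrow> 'g) \<Rightarrow> ('g \<Rightarrow> 'k) \<Rightarrow> 'g \<Rightarrow> 'k" where
  "tanti a \<phi> = (\<lambda>x\<in>carrier G. \<Sum>g\<in>I. proj \<phi> g (inv (ap a g x)))"

definition twist :: "('g \<Rightarrow> 'g) \<Rightarrow> ('k, 'g \<Rightarrow> 'k) hopf" where
  "twist a = (function_hopf G)\<lparr>monoid.mult := tmult a, antipode := tanti a\<rparr>"

lemma tmult_cong:
  assumes "a \<in> torsion_auts" "\<And>x. x \<in> carrier G \<Longrightarrow> \<phi> x = \<phi>' x" "\<And>x. x \<in> carrier G \<Longrightarrow> \<psi> x = \<psi>' x"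
  shows "tmult a \<phi> \<psi> = tmult a \<phi>' \<psi>'"
  unfolding tmult_def using assms by (intro restrict_ext sum.cong refl) (simp add: proj_cong[of \<phi> \<phi>'])

lemma tmult_homog:
  assumes "a \<in> torsion_auts" "homog h \<phi>" "x \<in> carrier G"
  shows "tmult a \<phi> \<psi> x = \<phi> x * \<psi> (ap a (- h) x)"
proof -
  have "tmult a \<phi> \<psi> x = (\<Sum>g\<in>I. if g = h mod int m then \<phi> x * \<psi> (ap a (- g) x) else 0)"
    unfolding tmult_def restrict_apply'[OF assms(3)]
    by (intro sum.cong refl) (simp add: proj_homog[OF assms(2,3)])
  also have "\<dots> = \<phi> x * \<psi> (ap a (- (h mod int m)) x)" using m_pos by simp
  finally show ?thesis using assms by simp
qed

lemma proj_tmult: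
  assumes "a \<in> torsion_auts" "x \<in> carrier G"
  shows "proj (tmult a \<phi> \<psi>) g x = (\<Sum>h\<in>I. proj \<phi> h x * proj \<psi> (g - h) (ap a (- h) x))"
proof -
  have "proj (tmult a \<phi> \<psi>) g x = proj (\<lambda>y. \<Sum>h\<in>I. proj \<phi> h y * \<psi> (ap a (- h) y)) g x"
    using assms by (intro proj_cong) (simp_all add: tmult_def)
  also have "\<dots> = (\<Sum>h\<in>I. proj (\<lambda>y. proj \<phi> h y * \<psi> (ap a (- h) y)) g x)"
    by (rule proj_sum)
  also have "\<dots> = (\<Sum>h\<in>I. proj \<phi> h x * proj \<psi> (g - h) (ap a (- h) x))"
    by (intro sum.cong refl) (simp add: proj_mult_homog[OF homog_proj assms(2), where \<psi>="\<lambda>y. \<psi> (ap a _ y)"] proj_ap[OF assms])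
  finally show ?thesis .
qed

text \<open>The action preserves degrees, so components of degrees \<open>h\<close> and
  \<open>g - h\<close> multiply into degree \<open>g\<close>, while the two actions compose to that
  of \<open>g\<close>.\<close>

lemma tmult_assoc:
  assumes a: "a \<in> torsion_auts"
  shows "tmult a (tmult a \<phi> \<psi>) \<theta> = tmult a \<phi> (tmult a \<psi> \<theta>)"
proof (rule extensionalityI[where A="carrier G"])
  fix x assume x: "x \<in> carrier G"
  have "tmult a (tmult a \<phi> \<psi>) \<theta> x
      = (\<Sum>g\<in>I. \<Sum>h\<in>I. proj \<phi> h x * (proj \<psi> (g - h) (ap a (- h) x) * \<theta> (ap a (- g) x)))"
    unfolding tmult_def[of a "tmult a \<phi> \<psi>"] using x
    by (simp add: proj_tmult[OF a x] sum_distrib_right mult.assoc)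
  also have "\<dots> = (\<Sum>h\<in>I. proj \<phi> h x * (\<Sum>g\<in>I. proj \<psi> (g - h) (ap a (- h) x) * \<theta> (ap a (- g) x)))"
    by (subst sum.swap) (simp add: sum_distrib_left)
  also have "\<dots> = (\<Sum>h\<in>I. proj \<phi> h x * tmult a \<psi> \<theta> (ap a (- h) x))"
  proof (intro sum.cong refl arg_cong2[where f="(*)"])
    fix h
    let ?f = "\<lambda>g. proj \<psi> (g - h) (ap a (- h) x) * \<theta> (ap a (- g) x)"
    \<comment> \<open>The summation variable passes from the total degree to the degree of the
      middle factor.\<close>
    have "(\<Sum>g\<in>I. ?f g) = (\<Sum>g\<in>I. ?f (g + h))"
    proof (rule sum_mod_shift[OF m_pos, symmetric])
      fix j show "?f (j mod int m) = ?f j"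
        using a proj_mod_eq[of "j mod int m - h" "j - h"] by (simp add: mod_diff_left_eq)
    qed
    also have "\<dots> = tmult a \<psi> \<theta> (ap a (- h) x)"
      unfolding tmult_def using a x by (simp add: ap_add[symmetric])
    finally show "(\<Sum>g\<in>I. ?f g) = tmult a \<psi> \<theta> (ap a (- h) x)" .
  qed
  also have "\<dots> = tmult a \<phi> (tmult a \<psi> \<theta>) x"
    unfolding tmult_def[of a \<phi>] using x by simp
  finally show "tmult a (tmult a \<phi> \<psi>) \<theta> x = tmult a \<phi> (tmult a \<psi> \<theta>) x" .
qed (simp_all add: tmult_def)

lemma tmult_one_left:
  assumes "a \<in> torsion_auts" "\<phi> \<in> extensional (carrier G)"
  shows "tmult a (\<lambda>x\<in>carrier G. 1) \<phi> = \<phi>"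
proof (rule extensionalityI[where A="carrier G"])
  fix x assume x: "x \<in> carrier G"
  have "homog 0 (\<lambda>x\<in>carrier G. 1::'k)" by (simp add: homog_def)
  from tmult_homog[OF assms(1) this x, of \<phi>]
  show "tmult a (\<lambda>x\<in>carrier G. 1) \<phi> x = \<phi> x" using x by simp
qed (simp_all add: tmult_def assms)

lemma tmult_one_right:
  assumes "a \<in> torsion_auts" "\<phi> \<in> extensional (carrier G)"
  shows "tmult a \<phi> (\<lambda>x\<in>carrier G. 1) = \<phi>"
proof (rule extensionalityI[where A="carrier G"])
  fix x assume x: "x \<in> carrier G"
  show "tmult a \<phi> (\<lambda>x\<in>carrier G. 1) x = \<phi> x"
    unfolding tmult_def using x assms sum_proj[OF x, of \<phi>] by simp
qed (simp_all add: tmult_def assms)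

lemma twist_simps [simp]:
  "carrier (twist a) = extensional (carrier G)"
  "monoid.mult (twist a) = tmult a"
  "one (twist a) = (\<lambda>x\<in>carrier G. 1)"
  "zero (twist a) = (\<lambda>x\<in>carrier G. 0)"
  "add (twist a) = (\<lambda>\<phi> \<psi>. \<lambda>x\<in>carrier G. \<phi> x + \<psi> x)"
  "smult (twist a) = (\<lambda>c \<phi>. \<lambda>x\<in>carrier G. c * \<phi> x)"
  "comult (twist a) = (\<lambda>\<phi> \<beta>. \<Sum>x\<in>carrier G. \<Sum>y\<in>carrier G.
                 \<phi> (x \<otimes> y) * \<beta> (delta_fun G x) (delta_fun G y))"
  "counit (twist a) = (\<lambda>\<phi>. \<phi> \<one>)"
  "antipode (twist a) = tanti a"
  by (simp_all add: twist_def function_hopf_def)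

end

section \<open>The twisting is a Hopf algebra\<close>

lemma sum_rotate:
  "(\<Sum>x\<in>A. \<Sum>y\<in>B. \<Sum>w\<in>C. f x y w) = (\<Sum>y\<in>B. \<Sum>w\<in>C. \<Sum>x\<in>A. f x y w)"
  by (subst sum.swap, rule sum.cong[OF refl], rule sum.swap)

context central_twist
begin

lemma delta_ext [simp]: "delta_fun G x \<in> extensional (carrier G)"
  by (simp add: delta_fun_def)

text \<open>\<open>linear_form\<close> gives additivity for two summands only, so the expansion in
  delta functions is an induction on the set to which \<open>\<phi>\<close> is cut down.\<close>

lemma linear_form_expand:
  assumes L: "linear_form (twist a) L" and \<phi>: "\<phi> \<in> extensional (carrier G)"
  shows "L \<phi> = (\<Sum>x\<in>carrier G. \<phi> x * L (delta_fun G x))"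
proof -
  have add: "L (\<lambda>x\<in>carrier G. f x + h x) = L f + L h"
    if "f \<in> extensional (carrier G)" "h \<in> extensional (carrier G)" for f h
    using L that by (simp add: linear_form_def)
  have scale: "L (\<lambda>x\<in>carrier G. c * f x) = c * L f" if "f \<in> extensional (carrier G)" for f c
    using L that by (simp add: linear_form_def)
  have "L (\<lambda>x\<in>carrier G. if x \<in> A then \<phi> x else 0) = (\<Sum>x\<in>A. \<phi> x * L (delta_fun G x))"
    if "A \<subseteq> carrier G" for A
    using finite_subset[OF that finite_G] that
  proof (induction A rule: finite_induct)
    case empty
    have "(\<lambda>x\<in>carrier G. if x \<in> {} then \<phi> x else 0) = (\<lambda>x\<in>carrier G. 0 * (\<lambda>x\<in>carrier G. 0) x)"
      by (rule restrict_ext) simp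
    moreover have "L (\<lambda>x\<in>carrier G. 0 * (\<lambda>x\<in>carrier G. 0) x) = 0"
      using scale[of "\<lambda>x\<in>carrier G. 0" 0] by (simp only: restrict_extensional mult_zero_left)
    ultimately show ?case by (metis sum.empty)
  next
    case (insert y A)
    let ?r = "\<lambda>x\<in>carrier G. if x \<in> A then \<phi> x else 0"
    have "(\<lambda>x\<in>carrier G. if x \<in> insert y A then \<phi> x else 0)
        = (\<lambda>x\<in>carrier G. (\<lambda>x\<in>carrier G. \<phi> y * delta_fun G y x) x + ?r x)"
      using insert.hyps by (intro restrict_ext) (auto simp: delta_fun_def)
    then have "L (\<lambda>x\<in>carrier G. if x \<in> insert y A then \<phi> x else 0)
        = L (\<lambda>x\<in>carrier G. \<phi> y * delta_fun G y x) + L ?r"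
      by (simp only: add restrict_extensional)
    also have "\<dots> = \<phi> y * L (delta_fun G y) + (\<Sum>x\<in>A. \<phi> x * L (delta_fun G x))"
      using insert.prems by (simp only: scale delta_ext insert.IH insert_subset)
    finally show ?case by (simp only: sum.insert[OF insert.hyps])
  qed
  from this[OF subset_refl] have "L (\<lambda>x\<in>carrier G. if x \<in> carrier G then \<phi> x else 0)
      = (\<Sum>x\<in>carrier G. \<phi> x * L (delta_fun G x))" .
  moreover have "(\<lambda>x\<in>carrier G. if x \<in> carrier G then \<phi> x else 0) = \<phi>"
    using \<phi> by (intro extensionalityI[where A="carrier G"]) auto
  ultimately show ?thesis by simp
qed

lemma bilinear_form_expand:
  assumes "\<beta> \<in> bilinear_forms (twist a)"
    and "f \<in> extensional (carrier G)" "h \<in> extensional (carrier G)"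
  shows "\<beta> f h = (\<Sum>x\<in>carrier G. \<Sum>y\<in>carrier G. f x * h y * \<beta> (delta_fun G x) (delta_fun G y))"
proof -
  have "\<beta> f h = (\<Sum>x\<in>carrier G. f x * \<beta> (delta_fun G x) h)"
    by (rule linear_form_expand[where L="\<lambda>f. \<beta> f h" and a=a]) (use assms in \<open>auto simp: bilinear_forms_def\<close>)
  also have "\<dots> = (\<Sum>x\<in>carrier G. f x * (\<Sum>y\<in>carrier G. h y * \<beta> (delta_fun G x) (delta_fun G y)))"
    by (intro sum.cong refl arg_cong2[where f="(*)"] linear_form_expand[where L="\<beta> _" and a=a])
       (use assms in \<open>auto simp: bilinear_forms_def\<close>)
  finally show ?thesis by (simp add: sum_distrib_left mult.assoc)
qed

lemma bilinear_formI:
  assumes "\<And>f f' h. \<beta> (\<lambda>x\<in>carrier G. f x + f' x) h = \<beta> f h + \<beta> f' h"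
    and "\<And>c f h. \<beta> (\<lambda>x\<in>carrier G. c * f x) h = c * \<beta> f h"
    and "\<And>f h h'. \<beta> f (\<lambda>x\<in>carrier G. h x + h' x) = \<beta> f h + \<beta> f h'"
    and "\<And>c f h. \<beta> f (\<lambda>x\<in>carrier G. c * h x) = c * \<beta> f h"
  shows "\<beta> \<in> bilinear_forms (twist a)"
  using assms by (simp add: bilinear_forms_def linear_form_def)

lemma abelian_group_twist: "abelian_group (twist a)"
proof (rule abelian_groupI)
  fix f assume f: "f \<in> carrier (twist a)"
  show "\<exists>h\<in>carrier (twist a). h \<oplus>\<^bsub>twist a\<^esub> f = \<zero>\<^bsub>twist a\<^esub>"
    by (rule bexI[where x="\<lambda>x\<in>carrier G. - f x"]) (auto intro: restrict_ext)
  show "\<zero>\<^bsub>twist a\<^esub> \<oplus>\<^bsub>twist a\<^esub> f = f"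
    using f by (auto intro!: extensionalityI[where A="carrier G"])
qed (auto intro!: restrict_ext simp: algebra_simps)

lemma finsum_twist:
  assumes "finite S"
  shows "finsum (twist a) (\<lambda>i. \<lambda>x\<in>carrier G. f i x) S = (\<lambda>x\<in>carrier G. \<Sum>i\<in>S. f i x)"
proof -
  interpret abelian_group "twist a" by (rule abelian_group_twist)
  show ?thesis
    using assms
  proof (induction S rule: finite_induct)
    case empty then show ?case by simp
  next
    case (insert j S)
    have "finsum (twist a) (\<lambda>i. \<lambda>x\<in>carrier G. f i x) (insert j S)
      = (\<lambda>x\<in>carrier G. f j x) \<oplus>\<^bsub>twist a\<^esub> finsum (twist a) (\<lambda>i. \<lambda>x\<in>carrier G. f i x) S"
      using insert.hyps by (intro finsum_insert) auto
    also have "\<dots> = (\<lambda>x\<in>carrier G. \<Sum>i\<in>insert j S. f i x)"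
      unfolding insert.IH using insert.hyps by (auto intro!: restrict_ext)
    finally show ?case .
  qed
qed

lemma proj_restrict_add: "x \<in> carrier G \<Longrightarrow> proj (\<lambda>x\<in>carrier G. f x + h x) g x = proj f g x + proj h g x"
  using proj_cong[of "\<lambda>x\<in>carrier G. f x + h x" "\<lambda>x. f x + h x" x g] by (simp add: proj_add)

lemma proj_restrict_scale: "x \<in> carrier G \<Longrightarrow> proj (\<lambda>x\<in>carrier G. c * f x) g x = c * proj f g x"
  using proj_cong[of "\<lambda>x\<in>carrier G. c * f x" "\<lambda>x. c * f x" x g] by (simp add: proj_scale)

lemma ring_twist:
  assumes "a \<in> torsion_auts" shows "ring (twist a)"
proof (rule ringI[OF abelian_group_twist])
  show "monoid (twist a)"
    by (rule monoidI)
       (use tmult_one_left[OF assms] tmult_one_right[OF assms] tmult_assoc[OF assms] in \<open>simp_all add: tmult_def\<close>)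
next
  fix f h k assume "f \<in> carrier (twist a)" "h \<in> carrier (twist a)" "k \<in> carrier (twist a)"
  show "(f \<oplus>\<^bsub>twist a\<^esub> h) \<otimes>\<^bsub>twist a\<^esub> k = f \<otimes>\<^bsub>twist a\<^esub> k \<oplus>\<^bsub>twist a\<^esub> h \<otimes>\<^bsub>twist a\<^esub> k"
    by (auto simp: tmult_def proj_restrict_add distrib_right sum.distrib intro!: restrict_ext)
  show "k \<otimes>\<^bsub>twist a\<^esub> (f \<oplus>\<^bsub>twist a\<^esub> h) = k \<otimes>\<^bsub>twist a\<^esub> f \<oplus>\<^bsub>twist a\<^esub> k \<otimes>\<^bsub>twist a\<^esub> h"
    using assms by (auto simp: tmult_def distrib_left sum.distrib intro!: restrict_ext)
qed

lemma module_twist: "Module.module (class_ring :: 'k ring) (twist a)"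
proof (rule Module.moduleI[OF _ abelian_group_twist])
  show "cring (class_ring :: 'k ring)" by (rule class_cring.cring_axioms)
qed (auto intro!: restrict_ext extensionalityI[where A="carrier G"] simp: algebra_simps)

lemma tmult_restrict:
  assumes "a \<in> torsion_auts" "x \<in> carrier G"
  shows "tmult a (\<lambda>x\<in>carrier G. f x + f' x) h x = tmult a f h x + tmult a f' h x"
    "tmult a (\<lambda>x\<in>carrier G. c * f x) h x = c * tmult a f h x"
    "tmult a f (\<lambda>x\<in>carrier G. h x + h' x) x = tmult a f h x + tmult a f h' x"
    "tmult a f (\<lambda>x\<in>carrier G. c * h x) x = c * tmult a f h x"
  using assms by (simp_all add: tmult_def proj_restrict_add proj_restrict_scale distrib_left distrib_right
      sum.distrib sum_distrib_left mult.assoc mult.left_commute)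

lemma tanti_restrict:
  assumes "a \<in> torsion_auts"
  shows "tanti a (\<lambda>x\<in>carrier G. f x + h x) = (\<lambda>x\<in>carrier G. tanti a f x + tanti a h x)"
    "tanti a (\<lambda>x\<in>carrier G. c * f x) = (\<lambda>x\<in>carrier G. c * tanti a f x)"
  using assms by (auto simp: tanti_def proj_restrict_add proj_restrict_scale sum.distrib sum_distrib_left
      intro!: restrict_ext)

lemma tmult_delta:
  assumes "a \<in> torsion_auts" "w \<in> carrier G"
  shows "(\<Sum>u\<in>carrier G. f u * tmult a \<phi> (delta_fun G u) w) = tmult a \<phi> f w"
proof -
  have "(\<Sum>u\<in>carrier G. f u * tmult a \<phi> (delta_fun G u) w)
      = (\<Sum>g\<in>I. proj \<phi> g w * (\<Sum>u\<in>carrier G. f u * delta_fun G u (ap a (- g) w)))"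
    using assms unfolding tmult_def by (simp add: sum_distrib_left mult.left_commute) (rule sum.swap)
  also have "\<dots> = tmult a \<phi> f w" using assms by (simp add: tmult_def sum_delta_fun)
  finally show ?thesis .
qed

text \<open>Multiplicativity of the comultiplication, tested at the points \<open>w\<close> and
  \<open>w'\<close>. It rests on two facts: only equal degrees occur on the two sides of the tensor,
  and \<open>ap a (- g)\<close> is multiplicative.\<close>

lemma comult_tmult_aux:
  assumes a: "a \<in> torsion_auts" and w: "w \<in> carrier G" and w': "w' \<in> carrier G"
  shows "(\<Sum>x\<in>carrier G. \<Sum>y\<in>carrier G. \<phi> (x \<otimes> y) * (\<Sum>u\<in>carrier G. \<Sum>v\<in>carrier G.
       \<psi> (u \<otimes> v) * (tmult a (delta_fun G x) (delta_fun G u) w * tmult a (delta_fun G y) (delta_fun G v) w')))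
     = tmult a \<phi> \<psi> (w \<otimes> w')" (is "?lhs = _")
proof -
  let ?P = "\<lambda>x g. proj (delta_fun G x) g"
  have inner: "(\<Sum>u\<in>carrier G. \<Sum>v\<in>carrier G.
       \<psi> (u \<otimes> v) * (tmult a (delta_fun G x) (delta_fun G u) w * tmult a (delta_fun G y) (delta_fun G v) w'))
     = (\<Sum>g\<in>I. \<Sum>h\<in>I. \<psi> (ap a (- g) w \<otimes> ap a (- h) w') * (?P x g w * ?P y h w'))" for x y
  proof -
    have "(\<Sum>u\<in>carrier G. \<Sum>v\<in>carrier G.
       \<psi> (u \<otimes> v) * (tmult a (delta_fun G x) (delta_fun G u) w * tmult a (delta_fun G y) (delta_fun G v) w'))
      = (\<Sum>u\<in>carrier G. (\<Sum>v\<in>carrier G. \<psi> (u \<otimes> v) * tmult a (delta_fun G y) (delta_fun G v) w')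
           * tmult a (delta_fun G x) (delta_fun G u) w)"
      by (simp add: sum_distrib_right mult.assoc mult.left_commute) (simp add: mult.commute)
    also have "\<dots> = tmult a (delta_fun G x) (\<lambda>u. tmult a (delta_fun G y) (\<lambda>v. \<psi> (u \<otimes> v)) w') w"
      using tmult_delta[OF a w'] by (simp add: tmult_delta[OF a w])
    also have "\<dots> = (\<Sum>g\<in>I. \<Sum>h\<in>I. \<psi> (ap a (- g) w \<otimes> ap a (- h) w') * (?P x g w * ?P y h w'))"
      using w w' by (simp add: tmult_def sum_distrib_left mult.commute mult.left_commute)
    finally show ?thesis .
  qed
  have "?lhs = (\<Sum>x\<in>carrier G. \<Sum>y\<in>carrier G. \<Sum>g\<in>I. \<Sum>h\<in>I.
      \<psi> (ap a (- g) w \<otimes> ap a (- h) w') * (\<phi> (x \<otimes> y) * (?P x g w * ?P y h w')))"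
    unfolding inner by (simp add: sum_distrib_left mult.left_commute)
  also have "\<dots> = (\<Sum>x\<in>carrier G. \<Sum>g\<in>I. \<Sum>h\<in>I. \<Sum>y\<in>carrier G.
      \<psi> (ap a (- g) w \<otimes> ap a (- h) w') * (\<phi> (x \<otimes> y) * (?P x g w * ?P y h w')))"
    by (rule sum.cong[OF refl], rule sum_rotate)
  also have "\<dots> = (\<Sum>g\<in>I. \<Sum>h\<in>I. \<Sum>x\<in>carrier G. \<Sum>y\<in>carrier G.
      \<psi> (ap a (- g) w \<otimes> ap a (- h) w') * (\<phi> (x \<otimes> y) * (?P x g w * ?P y h w')))"
    by (rule sum_rotate)
  \<comment> \<open>Here the sums over \<open>x\<close> and \<open>y\<close> are carried out, which
    forces \<open>g = h\<close>.\<close>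
  also have "\<dots> = (\<Sum>g\<in>I. \<Sum>h\<in>I. \<psi> (ap a (- g) w \<otimes> ap a (- h) w')
       * (if g mod int m = h mod int m then proj \<phi> g (w \<otimes> w') else 0))"
    by (simp add: sum_distrib_left[symmetric] proj_delta2[OF w w'])
  also have "\<dots> = (\<Sum>g\<in>I. \<Sum>h\<in>I. if h = g then \<psi> (ap a (- g) w \<otimes> ap a (- g) w') * proj \<phi> g (w \<otimes> w') else 0)"
    by (intro sum.cong refl) auto
  also have "\<dots> = tmult a \<phi> \<psi> (w \<otimes> w')"
    using a w w' by (simp add: tmult_def ap_mult mult.commute)
  finally show ?thesis .
qed

text \<open>An arbitrary bilinear form is a combination of evaluations at pairs of points, indexed
  by \<open>r\<close>; for each pair the claim is the pointwise identity just shown.\<close>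

lemma comult_tmult:
  assumes a: "a \<in> torsion_auts" and \<beta>: "\<beta> \<in> bilinear_forms (twist a)"
  shows "comult (twist a) (tmult a \<phi> \<psi>) \<beta> =
    comult (twist a) \<phi> (\<lambda>x x'. comult (twist a) \<psi> (\<lambda>y y'. \<beta> (tmult a x y) (tmult a x' y')))"
proof -
  let ?C = "carrier G \<times> carrier G"
  let ?b = "\<lambda>r. \<beta> (delta_fun G (fst r)) (delta_fun G (snd r))"
  let ?K = "\<lambda>p q r. tmult a (delta_fun G (fst p)) (delta_fun G (fst q)) (fst r)
      * tmult a (delta_fun G (snd p)) (delta_fun G (snd q)) (snd r)"
  let ?f = "\<lambda>p. \<phi> (fst p \<otimes> snd p)" and ?h = "\<lambda>q. \<psi> (fst q \<otimes> snd q)"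
  have ext: "tmult a f h \<in> extensional (carrier G)" for f h by (simp add: tmult_def)
  have "comult (twist a) \<phi> (\<lambda>x x'. comult (twist a) \<psi> (\<lambda>y y'. \<beta> (tmult a x y) (tmult a x' y')))
      = (\<Sum>p\<in>?C. ?f p * (\<Sum>q\<in>?C. ?h q * (\<Sum>r\<in>?C. ?K p q r * ?b r)))"
    by (simp add: bilinear_form_expand[OF \<beta> ext ext] sum.cartesian_product case_prod_unfold)
  also have "\<dots> = (\<Sum>r\<in>?C. (\<Sum>p\<in>?C. ?f p * (\<Sum>q\<in>?C. ?h q * ?K p q r)) * ?b r)"
  proof -
    have "(\<Sum>p\<in>?C. ?f p * (\<Sum>q\<in>?C. ?h q * (\<Sum>r\<in>?C. ?K p q r * ?b r)))
       = (\<Sum>p\<in>?C. \<Sum>q\<in>?C. \<Sum>r\<in>?C. ?f p * (?h q * (?K p q r * ?b r)))"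
      by (simp only: sum_distrib_left)
    also have "\<dots> = (\<Sum>p\<in>?C. \<Sum>r\<in>?C. \<Sum>q\<in>?C. ?f p * (?h q * (?K p q r * ?b r)))"
      by (intro sum.cong refl sum.swap)
    also have "\<dots> = (\<Sum>r\<in>?C. \<Sum>p\<in>?C. \<Sum>q\<in>?C. ?f p * (?h q * (?K p q r * ?b r)))"
      by (rule sum.swap)
    also have "\<dots> = (\<Sum>r\<in>?C. (\<Sum>p\<in>?C. ?f p * (\<Sum>q\<in>?C. ?h q * ?K p q r)) * ?b r)"
      by (simp only: sum_distrib_left sum_distrib_right mult.assoc)
    finally show ?thesis .
  qed
  also have "\<dots> = (\<Sum>r\<in>?C. tmult a \<phi> \<psi> (fst r \<otimes> snd r) * ?b r)"
  proof (intro sum.cong refl arg_cong2[where f="(*)"])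
    fix r assume "r \<in> ?C"
    then have r: "fst r \<in> carrier G" "snd r \<in> carrier G" by auto
    show "(\<Sum>p\<in>?C. ?f p * (\<Sum>q\<in>?C. ?h q * ?K p q r)) = tmult a \<phi> \<psi> (fst r \<otimes> snd r)"
      using comult_tmult_aux[OF a r, of \<phi> \<psi>] by (simp add: sum.cartesian_product case_prod_unfold)
  qed
  finally show ?thesis by (simp add: sum.cartesian_product case_prod_unfold)
qed

text \<open>Inversion turns translation by a power of \<open>z\<close> into translation by the
  inverse power, so the antipode negates degrees and a single summand has degree
  \<open>g\<close>.\<close>

lemma proj_tanti:
  assumes a: "a \<in> torsion_auts" and w: "w \<in> carrier G"
  shows "proj (tanti a f) g w = proj f (- g) (inv (ap a (- g) w))"
proof -
  have hom: "homog (- h) (\<lambda>x. proj f h (inv (ap a h x)))" for h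
  proof -
    have "homog h (proj f h)" by (rule homog_proj)
    then show ?thesis unfolding homog_def using a by (simp add: ap_zp zp_inv)
  qed
  have "proj (tanti a f) g w = proj (\<lambda>x. \<Sum>h\<in>I. proj f h (inv (ap a h x))) g w"
    using w by (intro proj_cong) (simp_all add: tanti_def)
  also have "\<dots> = (\<Sum>h\<in>I. if h = (- g) mod int m then proj f h (inv (ap a h w)) else 0)"
  proof (unfold proj_sum, intro sum.cong refl)
    fix h assume h: "h \<in> I"
    have "g mod int m = (- h) mod int m \<longleftrightarrow> (- g) mod int m = h mod int m"
      by (metis minus_minus mod_minus_cong)
    then show "proj (\<lambda>x. proj f h (inv (ap a h x))) g w
      = (if h = (- g) mod int m then proj f h (inv (ap a h w)) else 0)"
      using proj_homog[OF hom w] h by auto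
  qed
  also have "\<dots> = proj f (- g) (inv (ap a (- g) w))"
    using m_pos a by simp
  finally show ?thesis .
qed

lemma sum_proj_neg: "x \<in> carrier G \<Longrightarrow> (\<Sum>g\<in>I. proj \<phi> (- g) x) = \<phi> x"
proof -
  assume x: "x \<in> carrier G"
  have "(\<Sum>g\<in>I. proj \<phi> (- 1 * g) x) = (\<Sum>g\<in>I. proj \<phi> g x)"
    by (rule sum_mod_mult[where l'="- 1", OF m_pos]) auto
  then show ?thesis using sum_proj[OF x] by simp
qed

text \<open>The antipode reverses the degree and undoes the shift, so in degree \<open>- g\<close>
  the argument becomes \<open>inv (?s g) \<otimes> ?s g\<close>. What remains is the sum of all
  components at the identity.\<close>

lemma antipode_left_eval:
  assumes a: "a \<in> torsion_auts" and w: "w \<in> carrier G"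
  shows "(\<Sum>x\<in>carrier G. \<Sum>y\<in>carrier G. \<phi> (x \<otimes> y) * tmult a (tanti a (delta_fun G x)) (delta_fun G y) w) = \<phi> \<one>"
proof -
  let ?s = "\<lambda>g. ap a (- g) w"
  have "(\<Sum>x\<in>carrier G. \<Sum>y\<in>carrier G. \<phi> (x \<otimes> y) * tmult a (tanti a (delta_fun G x)) (delta_fun G y) w)
     = (\<Sum>x\<in>carrier G. tmult a (tanti a (delta_fun G x)) (\<lambda>y. \<phi> (x \<otimes> y)) w)"
    using a w by (simp add: tmult_delta)
  also have "\<dots> = (\<Sum>g\<in>I. \<Sum>x\<in>carrier G. \<phi> (x \<otimes> ?s g) * proj (delta_fun G x) (- g) (inv (?s g)))"
    using a w by (simp add: tmult_def proj_tanti mult.commute) (rule sum.swap)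
  also have "\<dots> = (\<Sum>g\<in>I. proj \<phi> (- g) (inv (?s g) \<otimes> ?s g))"
    using a w by (simp add: proj_delta[of _ "\<lambda>x. \<phi> (x \<otimes> _)"] proj_rtrans)
  also have "\<dots> = \<phi> \<one>" using a w by (simp add: sum_proj_neg)
  finally show ?thesis .
qed

text \<open>Equal degrees are forced by the comultiplication, and then \<open>ap a g\<close> cancels
  \<open>ap a (- g)\<close>, leaving the components at \<open>w \<otimes> inv w\<close>.\<close>

lemma antipode_right_eval:
  assumes a: "a \<in> torsion_auts" and w: "w \<in> carrier G"
  shows "(\<Sum>x\<in>carrier G. \<Sum>y\<in>carrier G. \<phi> (x \<otimes> y) * tmult a (delta_fun G x) (tanti a (delta_fun G y)) w) = \<phi> \<one>"
proof -
  let ?s = "\<lambda>g h. inv (ap a h (ap a (- g) w))"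
  have "(\<Sum>x\<in>carrier G. \<Sum>y\<in>carrier G. \<phi> (x \<otimes> y) * tmult a (delta_fun G x) (tanti a (delta_fun G y)) w)
     = (\<Sum>x\<in>carrier G. \<Sum>y\<in>carrier G. \<Sum>g\<in>I. \<Sum>h\<in>I.
          \<phi> (x \<otimes> y) * (proj (delta_fun G x) g w * proj (delta_fun G y) h (?s g h)))"
    using a w by (simp add: tmult_def tanti_def sum_distrib_left)
  also have "\<dots> = (\<Sum>x\<in>carrier G. \<Sum>g\<in>I. \<Sum>h\<in>I. \<Sum>y\<in>carrier G.
          \<phi> (x \<otimes> y) * (proj (delta_fun G x) g w * proj (delta_fun G y) h (?s g h)))"
    by (rule sum.cong[OF refl], rule sum_rotate)
  also have "\<dots> = (\<Sum>g\<in>I. \<Sum>h\<in>I. \<Sum>x\<in>carrier G. \<Sum>y\<in>carrier G.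
          \<phi> (x \<otimes> y) * (proj (delta_fun G x) g w * proj (delta_fun G y) h (?s g h)))"
    by (rule sum_rotate)
  also have "\<dots> = (\<Sum>g\<in>I. \<Sum>h\<in>I. if h = g then proj \<phi> g (w \<otimes> ?s g g) else 0)"
    using a w by (intro sum.cong refl) (auto simp: proj_delta2)
  also have "\<dots> = (\<Sum>g\<in>I. proj \<phi> g \<one>)"
    using a w by simp
  also have "\<dots> = \<phi> \<one>" by (simp add: sum_proj)
  finally show ?thesis .
qed

text \<open>The axioms quantify over every presentation of the comultiplication as a sum of pure
  tensors. A bilinear test form takes the same value on each, so the delta functions may be used
  instead.\<close>

lemma tensor_sum_eval:
  assumes "tensor_sum (twist a) (comult (twist a) \<phi>) N X Y" "\<beta> \<in> bilinear_forms (twist a)"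
  shows "(\<Sum>i<N. \<beta> (X i) (Y i)) = (\<Sum>x\<in>carrier G. \<Sum>y\<in>carrier G. \<phi> (x \<otimes> y) * \<beta> (delta_fun G x) (delta_fun G y))"
  using assms by (simp add: tensor_sum_def)

lemma finsum_eval:
  fixes N :: nat
  assumes "\<And>i. i < N \<Longrightarrow> F i \<in> extensional (carrier G)"
  shows "finsum (twist a) F {..<N} = (\<lambda>x\<in>carrier G. \<Sum>i<N. F i x)"
proof -
  interpret abelian_group "twist a" by (rule abelian_group_twist)
  have "finsum (twist a) F {..<N} = finsum (twist a) (\<lambda>i. \<lambda>x\<in>carrier G. F i x) {..<N}"
    using assms by (intro finsum_cong') (auto simp: extensional_restrict)
  also have "\<dots> = (\<lambda>x\<in>carrier G. \<Sum>i<N. F i x)"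
    by (rule finsum_twist) simp
  finally show ?thesis .
qed

theorem hopf_algebra_twist:
  assumes a: "a \<in> torsion_auts"
  shows "hopf_algebra (twist a)"
proof -
  interpret M: Module.module "class_ring :: 'k ring" "twist a" by (rule module_twist)
  interpret R: ring "twist a" by (rule ring_twist[OF a])
  let ?E = "extensional (carrier G)"
  have fin: "finite (carrier G)" by (rule finite_G)
  have XY: "X i \<in> ?E" "Y i \<in> ?E"
    if "tensor_sum (twist a) (comult (twist a) \<phi>) N X Y" "i < N" for \<phi> N X Y i
    using that by (auto simp: tensor_sum_def)
  show ?thesis
  proof
    fix x y :: "'g \<Rightarrow> 'k" and c
    assume "x \<in> carrier (twist a)" "y \<in> carrier (twist a)"
    show "(c \<odot>\<^bsub>twist a\<^esub> x) \<otimes>\<^bsub>twist a\<^esub> y = c \<odot>\<^bsub>twist a\<^esub> (x \<otimes>\<^bsub>twist a\<^esub> y)"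
      using tmult_restrict[OF a] by (auto simp: tmult_def intro!: extensionalityI[where A="carrier G"])
    show "x \<otimes>\<^bsub>twist a\<^esub> (c \<odot>\<^bsub>twist a\<^esub> y) = c \<odot>\<^bsub>twist a\<^esub> (x \<otimes>\<^bsub>twist a\<^esub> y)"
      using tmult_restrict[OF a] by (auto simp: tmult_def intro!: extensionalityI[where A="carrier G"])
  next
    fix \<phi> assume \<phi>: "\<phi> \<in> carrier (twist a)"
    let ?C = "carrier G \<times> carrier G"
    obtain e where e: "bij_betw e {0..<card ?C} ?C"
      using ex_bij_betw_nat_finite[of ?C] fin by blast
    \<comment> \<open>Pure tensors carry no scalar, so the coefficient is absorbed into the left
      factor; \<open>e\<close> enumerates the pairs of group elements.\<close>
    define X where "X i = (\<lambda>x\<in>carrier G. \<phi> (fst (e i) \<otimes> snd (e i)) * delta_fun G (fst (e i)) x)" for i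
    define Y :: "nat \<Rightarrow> 'g \<Rightarrow> 'k" where "Y i = delta_fun G (snd (e i))" for i
    have "tensor_sum (twist a) (comult (twist a) \<phi>) (card ?C) X Y"
      unfolding tensor_sum_def
    proof (intro conjI ballI)
      fix \<beta> assume \<beta>: "\<beta> \<in> bilinear_forms (twist a)"
      have "(\<Sum>i<card ?C. \<beta> (X i) (Y i)) = (\<Sum>i\<in>{0..<card ?C}. (\<lambda>r. \<phi> (fst r \<otimes> snd r) * \<beta> (delta_fun G (fst r)) (delta_fun G (snd r))) (e i))"
      proof (rule sum.cong)
        fix i
        have "linear_form (twist a) (\<lambda>f. \<beta> f (Y i))" using \<beta> by (simp add: bilinear_forms_def Y_def)
        then show "\<beta> (X i) (Y i) = (\<lambda>r. \<phi> (fst r \<otimes> snd r) * \<beta> (delta_fun G (fst r)) (delta_fun G (snd r))) (e i)"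
          by (simp add: linear_form_def X_def Y_def)
      qed auto
      also have "\<dots> = (\<Sum>r\<in>?C. \<phi> (fst r \<otimes> snd r) * \<beta> (delta_fun G (fst r)) (delta_fun G (snd r)))"
        by (rule sum.reindex_bij_betw[OF e])
      finally show "comult (twist a) \<phi> \<beta> = (\<Sum>i<card ?C. \<beta> (X i) (Y i))"
        by (simp add: sum.cartesian_product case_prod_unfold)
    qed (auto simp: X_def Y_def)
    then show "\<exists>N X Y. tensor_sum (twist a) (comult (twist a) \<phi>) N X Y" by blast
  next
    fix \<beta> assume "\<beta> \<in> bilinear_forms (twist a)"
    show "linear_form (twist a) (\<lambda>\<phi>. comult (twist a) \<phi> \<beta>)"
      by (simp add: linear_form_def distrib_right sum.distrib sum_distrib_left mult.assoc)
  next
    show "linear_form (twist a) (counit (twist a))" by (simp add: linear_form_def)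
  next
    show "linear_map (twist a) (twist a) (antipode (twist a))"
      using tanti_restrict[OF a] by (auto simp: linear_map_def) (simp add: tanti_def)
  next
    fix \<phi> and \<tau> :: "('g \<Rightarrow> 'k) \<Rightarrow> ('g \<Rightarrow> 'k) \<Rightarrow> ('g \<Rightarrow> 'k) \<Rightarrow> 'k"
    assume \<phi>: "\<phi> \<in> carrier (twist a)"
    let ?d = "delta_fun G" and ?C = "carrier G"
    have "comult (twist a) \<phi> (\<lambda>x z. comult (twist a) x (\<lambda>u v. \<tau> u v z))
      = (\<Sum>x\<in>?C. \<Sum>y\<in>?C. \<Sum>u\<in>?C. \<Sum>v\<in>?C. \<phi> (x \<otimes> y) * (?d x (u \<otimes> v) * \<tau> (?d u) (?d v) (?d y)))"
      by (simp add: sum_distrib_left)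
    also have "\<dots> = (\<Sum>y\<in>?C. \<Sum>x\<in>?C. \<Sum>u\<in>?C. \<Sum>v\<in>?C. \<phi> (x \<otimes> y) * (?d x (u \<otimes> v) * \<tau> (?d u) (?d v) (?d y)))"
      by (rule sum.swap)
    also have "\<dots> = (\<Sum>y\<in>?C. \<Sum>u\<in>?C. \<Sum>v\<in>?C. \<Sum>x\<in>?C. \<phi> (x \<otimes> y) * (?d x (u \<otimes> v) * \<tau> (?d u) (?d v) (?d y)))"
      by (rule sum.cong[OF refl], rule sum_rotate)
    also have "\<dots> = (\<Sum>y\<in>?C. \<Sum>u\<in>?C. \<Sum>v\<in>?C. \<phi> (u \<otimes> v \<otimes> y) * \<tau> (?d u) (?d v) (?d y))"
      by (intro sum.cong refl)
         (simp add: mult.assoc[symmetric] sum_distrib_right[symmetric] sum_delta_fun(1)[of _ "\<lambda>x. \<phi> (x \<otimes> _)"])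
    also have "\<dots> = (\<Sum>u\<in>?C. \<Sum>v\<in>?C. \<Sum>y\<in>?C. \<phi> (u \<otimes> v \<otimes> y) * \<tau> (?d u) (?d v) (?d y))"
      by (rule sum_rotate)
    also have "\<dots> = (\<Sum>x\<in>?C. \<Sum>u\<in>?C. \<Sum>v\<in>?C. \<Sum>y\<in>?C. \<phi> (x \<otimes> y) * (?d y (u \<otimes> v) * \<tau> (?d x) (?d u) (?d v)))"
      by (intro sum.cong refl)
         (simp add: mult.assoc[symmetric] sum_distrib_right[symmetric] sum_delta_fun(1)[of _ "\<lambda>y. \<phi> (_ \<otimes> y)"] m_assoc)
    also have "\<dots> = (\<Sum>x\<in>?C. \<Sum>y\<in>?C. \<Sum>u\<in>?C. \<Sum>v\<in>?C. \<phi> (x \<otimes> y) * (?d y (u \<otimes> v) * \<tau> (?d x) (?d u) (?d v)))"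
      by (rule sum.cong[OF refl], rule sum_rotate[symmetric])
    also have "\<dots> = comult (twist a) \<phi> (\<lambda>x z. comult (twist a) z (\<lambda>u v. \<tau> x u v))"
      by (simp add: sum_distrib_left)
    finally show "comult (twist a) \<phi> (\<lambda>x z. comult (twist a) x (\<lambda>u v. \<tau> u v z))
      = comult (twist a) \<phi> (\<lambda>x z. comult (twist a) z (\<lambda>u v. \<tau> x u v))" .
  next
    fix \<phi> N X Y
    assume \<phi>: "\<phi> \<in> carrier (twist a)" and t: "tensor_sum (twist a) (comult (twist a) \<phi>) N X Y"
    show "(\<Oplus>\<^bsub>twist a\<^esub>i\<in>{..<N}. counit (twist a) (X i) \<odot>\<^bsub>twist a\<^esub> Y i) = \<phi>"
    proof (rule extensionalityI[where A="carrier G"])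
      fix w assume w: "w \<in> carrier G"
      have "(\<Sum>i<N. X i \<one> * Y i w) = (\<Sum>x\<in>carrier G. \<Sum>y\<in>carrier G. \<phi> (x \<otimes> y) * (delta_fun G x \<one> * delta_fun G y w))"
        using w by (intro tensor_sum_eval[OF t] bilinear_formI) (auto simp: algebra_simps)
      also have "\<dots> = (\<Sum>x\<in>carrier G. \<phi> (x \<otimes> w) * delta_fun G x \<one>)"
        using w by (simp add: mult.assoc[symmetric] sum_delta_fun(1)[of _ "\<lambda>y. \<phi> (_ \<otimes> y) * _"])
      also have "\<dots> = \<phi> w"
        using w by (simp add: sum_delta_fun(1)[of _ "\<lambda>x. \<phi> (x \<otimes> _)"])
      finally show "(\<Oplus>\<^bsub>twist a\<^esub>i\<in>{..<N}. counit (twist a) (X i) \<odot>\<^bsub>twist a\<^esub> Y i) w = \<phi> w"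
        using w by (subst finsum_eval) auto
    qed (use \<phi> in \<open>auto simp: finsum_eval\<close>)
    show "(\<Oplus>\<^bsub>twist a\<^esub>i\<in>{..<N}. counit (twist a) (Y i) \<odot>\<^bsub>twist a\<^esub> X i) = \<phi>"
    proof (rule extensionalityI[where A="carrier G"])
      fix w assume w: "w \<in> carrier G"
      have "(\<Sum>i<N. Y i \<one> * X i w) = (\<Sum>x\<in>carrier G. \<Sum>y\<in>carrier G. \<phi> (x \<otimes> y) * (delta_fun G y \<one> * delta_fun G x w))"
        using w by (intro tensor_sum_eval[OF t] bilinear_formI) (auto simp: algebra_simps)
      also have "\<dots> = \<phi> w" using w
        by (simp add: mult.assoc[symmetric] sum_distrib_right[symmetric] sum_delta_fun(1)[of _ "\<lambda>y. \<phi> (_ \<otimes> y)"]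
              sum_delta_fun(1)[of _ \<phi>])
      finally show "(\<Oplus>\<^bsub>twist a\<^esub>i\<in>{..<N}. counit (twist a) (Y i) \<odot>\<^bsub>twist a\<^esub> X i) w = \<phi> w"
        using w by (subst finsum_eval) auto
    qed (use \<phi> in \<open>auto simp: finsum_eval\<close>)
    show "(\<Oplus>\<^bsub>twist a\<^esub>i\<in>{..<N}. antipode (twist a) (X i) \<otimes>\<^bsub>twist a\<^esub> Y i) = counit (twist a) \<phi> \<odot>\<^bsub>twist a\<^esub> \<one>\<^bsub>twist a\<^esub>"
    proof (rule extensionalityI[where A="carrier G"])
      fix w assume w: "w \<in> carrier G"
      have "(\<Sum>i<N. tmult a (tanti a (X i)) (Y i) w) = \<phi> \<one>"
        unfolding antipode_left_eval[OF a w, symmetric]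
        by (intro tensor_sum_eval[OF t] bilinear_formI) (simp_all only: tanti_restrict[OF a] tmult_restrict[OF a w])
      then show "(\<Oplus>\<^bsub>twist a\<^esub>i\<in>{..<N}. antipode (twist a) (X i) \<otimes>\<^bsub>twist a\<^esub> Y i) w
         = (counit (twist a) \<phi> \<odot>\<^bsub>twist a\<^esub> \<one>\<^bsub>twist a\<^esub>) w"
        using w by (subst finsum_eval) (auto simp: tmult_def)
    qed (auto simp: finsum_eval tmult_def)
    show "(\<Oplus>\<^bsub>twist a\<^esub>i\<in>{..<N}. X i \<otimes>\<^bsub>twist a\<^esub> antipode (twist a) (Y i)) = counit (twist a) \<phi> \<odot>\<^bsub>twist a\<^esub> \<one>\<^bsub>twist a\<^esub>"
    proof (rule extensionalityI[where A="carrier G"])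
      fix w assume w: "w \<in> carrier G"
      have "(\<Sum>i<N. tmult a (X i) (tanti a (Y i)) w) = \<phi> \<one>"
        unfolding antipode_right_eval[OF a w, symmetric]
        by (intro tensor_sum_eval[OF t] bilinear_formI) (simp_all only: tanti_restrict[OF a] tmult_restrict[OF a w])
      then show "(\<Oplus>\<^bsub>twist a\<^esub>i\<in>{..<N}. X i \<otimes>\<^bsub>twist a\<^esub> antipode (twist a) (Y i)) w
         = (counit (twist a) \<phi> \<odot>\<^bsub>twist a\<^esub> \<one>\<^bsub>twist a\<^esub>) w"
        using w by (subst finsum_eval) (auto simp: tmult_def)
    qed (auto simp: finsum_eval tmult_def)
  next
    fix \<beta> assume \<beta>: "\<beta> \<in> bilinear_forms (twist a)"
    show "comult (twist a) \<one>\<^bsub>twist a\<^esub> \<beta> = \<beta> \<one>\<^bsub>twist a\<^esub> \<one>\<^bsub>twist a\<^esub>"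
      using bilinear_form_expand[OF \<beta>, of "\<lambda>x\<in>carrier G. 1" "\<lambda>x\<in>carrier G. 1"] by simp
  next
    fix \<phi> \<psi> \<beta> assume \<beta>: "\<beta> \<in> bilinear_forms (twist a)"
    show "comult (twist a) (\<phi> \<otimes>\<^bsub>twist a\<^esub> \<psi>) \<beta> =
         comult (twist a) \<phi> (\<lambda>x x'. comult (twist a) \<psi> (\<lambda>y y'. \<beta> (x \<otimes>\<^bsub>twist a\<^esub> y) (x' \<otimes>\<^bsub>twist a\<^esub> y')))"
      using comult_tmult[OF a \<beta>] by simp
  next
    show "counit (twist a) \<one>\<^bsub>twist a\<^esub> = 1" by simp
  next
    fix \<phi> \<psi>
    \<comment> \<open>The identity is fixed by the action, so at this point the product is not
      twisted.\<close>
    have "ap a (- g) \<one> = \<one>" for g using auto_one[OF ap_auto[OF a]] .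
    then show "counit (twist a) (\<phi> \<otimes>\<^bsub>twist a\<^esub> \<psi>) = counit (twist a) \<phi> * counit (twist a) \<psi>"
      using sum_proj[of \<one> \<phi>] by (simp add: tmult_def sum_distrib_right[symmetric])
  qed
qed

end

section \<open>Cocentral actions of \<open>\<int>\<^sub>m\<close>\<close>

text \<open>The \<open>m\<close> powers of \<open>\<zeta>\<close> are distinct, and the equation has
  at most \<open>m\<close> solutions.\<close>

lemma root_of_unity_eq_power:
  fixes \<zeta> w :: "'k::field"
  assumes "prime m" "\<zeta> ^ m = 1" "\<zeta> \<noteq> 1" "w ^ m = 1"
  shows "\<exists>j::nat. w = \<zeta> ^ j"
proof -
  have m: "m > 0" using assms by (simp add: prime_gt_0_nat)
  have nz: "\<zeta> \<noteq> 0" using assms m by (metis power_0_left zero_neq_one less_irrefl)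
  have fin: "finite {x::'k. x ^ m = 1}" and le: "card {x::'k. x ^ m = 1} \<le> m"
    using finite_roots_of_unity[OF m] card_roots_of_unity_le[OF m] by simp_all
  let ?A = "(\<lambda>j. \<zeta> powi j) ` {0..<int m}"
  have "inj_on (\<lambda>j. \<zeta> powi j) {0..<int m}"
  proof (rule inj_onI)
    fix i j assume ij: "i \<in> {0..<int m}" "j \<in> {0..<int m}" "\<zeta> powi i = \<zeta> powi j"
    then have "int m dvd i - j"
      using powi_eq_one_iff_prime[OF assms(1-3), of "i - j"] nz by (simp add: power_int_diff)
    then have "i mod int m = j mod int m" by (simp add: mod_eq_dvd_iff)
    then show "i = j" using ij by simp
  qed
  then have "card ?A = m" by (simp add: card_image)
  moreover have "?A \<subseteq> {x. x ^ m = 1}"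
  proof clarsimp
    fix j
    have "(\<zeta> powi j) ^ m = \<zeta> powi (j * int m)" by (simp add: power_int_mult)
    then show "(\<zeta> powi j) ^ m = 1" using powi_eq_one_iff_prime[OF assms(1-3)] by simp
  qed
  ultimately have "?A = {x. x ^ m = 1}" using fin le by (intro card_seteq) auto
  then obtain j where "j \<in> {0..<int m}" "w = \<zeta> powi j" using assms(4) by blast
  then have "w = \<zeta> ^ nat j" by (simp add: power_int_def)
  then show ?thesis by blast
qed

definition root_char :: "nat \<Rightarrow> 'k::field \<Rightarrow> int \<Rightarrow> int \<Rightarrow> 'k" where
  "root_char m \<zeta> j = (\<lambda>g\<in>carrier (integer_mod_group m). \<zeta> powi (j * g))"

text \<open>A character is determined by its value at the generator 1, which is an m-th root of
  unity and hence a power of \<open>\<zeta>\<close>.\<close>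

lemma carrier_char_group_mod:
  fixes \<zeta> :: "'k::field"
  assumes "prime m" "\<zeta> ^ m = 1" "\<zeta> \<noteq> 1"
  shows "carrier (char_group (integer_mod_group m) :: (int \<Rightarrow> 'k) monoid) = range (root_char m \<zeta>)"
proof -
  have m: "m > 0" using assms by (simp add: prime_gt_0_nat)
  have nz: "\<zeta> \<noteq> 0" using assms m by (metis power_0_left zero_neq_one less_irrefl)
  have car: "carrier (integer_mod_group m) = {0..<int m}" using m by (simp add: carrier_integer_mod_group)
  have one: "1 \<in> {0..<int m}" using prime_gt_1_nat[OF assms(1)] by simp
  have "root_char m \<zeta> j \<in> hom (integer_mod_group m) (mult_of class_ring)" for j
  proof (rule homI)
    fix g h assume "g \<in> carrier (integer_mod_group m)" "h \<in> carrier (integer_mod_group m)"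
    moreover have "\<zeta> powi (j * ((g + h) mod int m)) = \<zeta> powi (j * g + j * h)"
    proof -
      have "int m dvd j * ((g + h) mod int m) - (j * g + j * h)"
        by (metis distrib_left mod_eq_dvd_iff mod_mult_right_eq)
      then have "\<zeta> powi (j * ((g + h) mod int m) - (j * g + j * h)) = 1"
        using powi_eq_one_iff_prime[OF assms] by simp
      then show ?thesis using nz by (simp add: power_int_diff)
    qed
    ultimately show "root_char m \<zeta> j (g \<otimes>\<^bsub>integer_mod_group m\<^esub> h)
        = root_char m \<zeta> j g \<otimes>\<^bsub>mult_of class_ring\<^esub> root_char m \<zeta> j h"
      using nz m by (simp add: root_char_def car power_int_add)
  qed (use nz in \<open>simp add: root_char_def\<close>)
  then have "range (root_char m \<zeta>) \<subseteq> carrier (char_group (integer_mod_group m))"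
    by (auto simp: char_group_def root_char_def)
  moreover have "\<chi> \<in> range (root_char m \<zeta>)" if \<chi>: "\<chi> \<in> carrier (char_group (integer_mod_group m))" for \<chi>
  proof -
    have hom: "\<chi> ((g + h) mod int m) = \<chi> g * \<chi> h" if "g \<in> {0..<int m}" "h \<in> {0..<int m}" for g h
      using \<chi> that by (auto simp: char_group_def hom_def car)
    have "\<chi> 0 \<noteq> 0" using \<chi> m by (auto simp: char_group_def hom_def car)
    moreover have "\<chi> 0 * \<chi> 0 = \<chi> 0" using hom[of 0 0] m by simp
    ultimately have zero: "\<chi> 0 = 1" by simp
    have pow: "\<chi> (int n mod int m) = \<chi> 1 ^ n" for n
    proof (induction n)
      case (Suc n)
      have "\<chi> (int (Suc n) mod int m) = \<chi> ((1 + int n mod int m) mod int m)"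
        by (simp add: mod_add_right_eq add.commute)
      also have "\<dots> = \<chi> 1 * \<chi> (int n mod int m)" using m one by (intro hom) auto
      finally show ?case using Suc by simp
    qed (simp add: zero)
    have "\<chi> 1 ^ m = 1" using pow[of m] zero by simp
    then obtain j where j: "\<chi> 1 = \<zeta> powi j" 
      using root_of_unity_eq_power[OF assms, of "\<chi> 1"] by (metis power_int_of_nat)
    have "\<chi> = root_char m \<zeta> j"
    proof (rule extensionalityI[where A="carrier (integer_mod_group m)"])
      fix g assume g: "g \<in> carrier (integer_mod_group m)"
      have "\<chi> g = \<chi> 1 ^ nat g" using pow[of "nat g"] g by (simp add: car)
      then show "\<chi> g = root_char m \<zeta> j g"
        using g by (simp add: j root_char_def car power_int_mult) (simp add: power_int_def)
    qed (use \<chi> in \<open>auto simp: char_group_def root_char_def\<close>)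
    then show ?thesis by blast
  qed
  ultimately show ?thesis by blast
qed

context central_twist
begin

abbreviation \<Gamma> where "\<Gamma> \<equiv> integer_mod_group m"
abbreviation chi where "chi \<equiv> root_char m \<zeta>"

lemma carrier_\<Gamma>: "carrier \<Gamma> = I"
  using m_pos by (simp add: carrier_integer_mod_group)

lemma m_gt_one [simp]: "1 < m" "Suc 0 < m"
  using prime_gt_1_nat[OF prime_m] by simp_all

lemma carrier_chars: "carrier (char_group \<Gamma> :: (int \<Rightarrow> 'k) monoid) = range chi"
  by (rule carrier_char_group_mod[OF prime_m zeta_pow_m zeta_neq_one])

lemma chi_apply: "g \<in> I \<Longrightarrow> chi j g = \<zeta> powi (j * g)"
  by (simp add: root_char_def carrier_\<Gamma>)

lemma chi_mult: "chi i \<otimes>\<^bsub>char_group \<Gamma>\<^esub> chi j = chi (i + j)"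
  unfolding char_group_def root_char_def carrier_\<Gamma> using zeta_nz
  by (auto simp: distrib_right power_int_add intro!: restrict_ext)

lemma chi_eq_iff: "chi i = chi j \<longleftrightarrow> i mod int m = j mod int m"
proof
  assume "chi i = chi j"
  then have "chi i 1 = chi j 1" by simp
  then show "i mod int m = j mod int m" by (simp add: chi_apply zeta_eq_iff)
next
  assume "i mod int m = j mod int m"
  then show "chi i = chi j"
    unfolding root_char_def carrier_\<Gamma> by (intro restrict_ext) (metis zeta_mod_mult(2))
qed

lemma cocentral_exists:
  assumes a: "a \<in> torsion_auts"
  shows "\<exists>i \<alpha>. cocentral_action G \<Gamma> i \<alpha> \<and> i (chi 1) = z \<and> \<alpha> 1 = a"
proof (intro exI conjI)
  \<comment> \<open>The choice of the exponent is harmless: \<open>chi j\<close> and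
    \<open>z [^] j\<close> depend on \<open>j\<close> with the same period \<open>m\<close>.\<close>
  let ?i = "\<lambda>\<chi>. z [^] (SOME j. \<chi> = chi j)"
  let ?\<alpha> = "\<lambda>g. ap a g"
  have i: "?i (chi j) = z [^] j" for j
  proof -
    have "chi j = chi (SOME k. chi j = chi k)" by (rule someI) (rule refl)
    then show ?thesis by (simp add: chi_eq_iff zp_eq_iff)
  qed
  show "?i (chi 1) = z" using i[of 1] by simp
  show "?\<alpha> 1 = a" using a by simp
  show "cocentral_action G \<Gamma> ?i ?\<alpha>"
  proof (intro cocentral_action.intro cocentral_action_axioms.intro)
    show "group G" by (rule is_group)
    show "comm_group \<Gamma>" by simp
    show "finite (carrier G)" by (rule finite_G)
    show "finite (carrier \<Gamma>)" by (simp add: carrier_\<Gamma>)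
    show "?i \<in> hom (char_group \<Gamma>) G"
    proof (rule homI)
      fix \<chi> \<psi> assume "(\<chi> :: int \<Rightarrow> 'k) \<in> carrier (char_group \<Gamma>)" "(\<psi> :: int \<Rightarrow> 'k) \<in> carrier (char_group \<Gamma>)"
      then obtain j k where jk: "\<chi> = chi j" "\<psi> = chi k" by (auto simp: carrier_chars)
      show "?i (\<chi> \<otimes>\<^bsub>char_group \<Gamma>\<^esub> \<psi>) = ?i \<chi> \<otimes> ?i \<psi>"
        unfolding jk chi_mult i by (simp add: int_pow_mult)
    qed auto
    show "?i ` carrier (char_group \<Gamma>) \<subseteq> group_center G"
      by (auto simp: group_center_def zp_comm)
    show "inj_on ?i (carrier (char_group \<Gamma>))"
    proof (rule inj_onI)
      fix \<chi> \<psi> assume "(\<chi> :: int \<Rightarrow> 'k) \<in> carrier (char_group \<Gamma>)" "(\<psi> :: int \<Rightarrow> 'k) \<in> carrier (char_group \<Gamma>)" and eq: "?i \<chi> = ?i \<psi>"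
      then obtain j k where jk: "\<chi> = chi j" "\<psi> = chi k" by (auto simp: carrier_chars)
      show "\<chi> = \<psi>" using eq unfolding jk i by (simp add: zp_eq_iff chi_eq_iff)
    qed
    show "?\<alpha> \<in> hom \<Gamma> (AutoGroup G)"
    proof (rule homI)
      fix g h
      have "ap a ((g + h) mod int m) = ap a (g + h)" using a by simp
      also have "\<dots> = ap a g \<otimes>\<^bsub>AutoGroup G\<^esub> ap a h"
        using a by (intro AG.int_pow_mult) (simp add: torsion_auts_def)
      finally show "ap a (g \<otimes>\<^bsub>\<Gamma>\<^esub> h) = ap a g \<otimes>\<^bsub>AutoGroup G\<^esub> ap a h" by simp
    qed (use ap_auto[OF a] in simp)
    fix g and \<chi> :: "int \<Rightarrow> 'k" assume "\<chi> \<in> carrier (char_group \<Gamma>)"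
    show "?\<alpha> g (?i \<chi>) = ?i \<chi>" using a by (simp add: auto_int_pow[OF ap_auto] ap_z)
  qed
qed

text \<open>Uniqueness: applying \<open>proj\<close> in degree \<open>h\<close> to any homogeneous
  decomposition isolates its term of degree \<open>h\<close>. This replaces the definite description
  by the Fourier formula.\<close>

lemma components_eq:
  assumes hom: "\<And>g. g \<in> I \<Longrightarrow> homogeneous G \<Gamma> i g = {\<phi> \<in> extensional (carrier G). homog g \<phi>}"
    and g: "g \<in> I" and x: "x \<in> carrier G"
  shows "components G \<Gamma> i \<phi> g x = proj \<phi> g x"
proof -
  let ?c = "\<lambda>g\<in>I. restrict (proj \<phi> g) (carrier G)"
  have "components G \<Gamma> i \<phi> = ?c"
    unfolding components_def carrier_\<Gamma>
  proof (rule the_equality)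
    have "homog g (restrict (proj \<phi> g) (carrier G))" for g
      by (rule homog_cong[OF homog_proj]) simp
    then show "?c \<in> (\<Pi>\<^sub>E g\<in>I. homogeneous G \<Gamma> i g) \<and> (\<forall>x\<in>carrier G. \<phi> x = (\<Sum>g\<in>I. ?c g x))"
      using hom by (auto simp: sum_proj)
  next
    fix c assume c: "c \<in> (\<Pi>\<^sub>E g\<in>I. homogeneous G \<Gamma> i g) \<and> (\<forall>x\<in>carrier G. \<phi> x = (\<Sum>g\<in>I. c g x))"
    show "c = ?c"
    proof (rule extensionalityI[where A=I])
      fix h assume h: "h \<in> I"
      have ch: "c g \<in> extensional (carrier G)" "homog g (c g)" if "g \<in> I" for g
        using c hom[OF that] that by (auto simp: PiE_iff)
      show "c h = ?c h"
      proof (rule extensionalityI[where A="carrier G"])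
        fix x assume x: "x \<in> carrier G"
        have "proj \<phi> h x = proj (\<lambda>x. \<Sum>g\<in>I. c g x) h x"
          by (rule proj_cong) (use c x in auto)
        also have "\<dots> = (\<Sum>g\<in>I. if g = h then c g x else 0)"
          unfolding proj_sum by (rule sum.cong[OF refl]) (use proj_homog[OF ch(2) x, of _ h] h in auto)
        finally show "c h x = ?c h x" using h x by simp
      qed (use h ch in auto)
    qed (use c in \<open>auto simp: PiE_iff\<close>)
  qed
  then show ?thesis using g x by simp
qed

lemma cocentral_chi_power:
  assumes co: "cocentral_action G \<Gamma> i \<alpha>"
  shows "i (chi 1) \<in> carrier G" "i (chi (int n)) = i (chi 1) [^] n"
proof -
  interpret C: cocentral_action G \<Gamma> i \<alpha> by (rule co)
  have imult: "i (chi j \<otimes>\<^bsub>char_group \<Gamma>\<^esub> chi k) = i (chi j) \<otimes> i (chi k)" for j k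
    by (rule hom_mult[OF C.i_hom]) (simp_all add: carrier_chars)
  have icl: "i (chi j) \<in> carrier G" for j
    using hom_in_carrier[OF C.i_hom, of "chi j"] by (simp add: carrier_chars)
  have i0: "i (chi 0) = \<one>" using imult[of 0 0] icl[of 0] by (simp add: chi_mult)
  show "i (chi (int n)) = i (chi 1) [^] n"
  proof (induction n)
    case (Suc n)
    have "i (chi (int (Suc n))) = i (chi 1) \<otimes> i (chi 1) [^] n" using imult[of 1 "int n"] Suc by (simp add: chi_mult)
    then show ?case by (simp only: nat_pow_Suc2[OF icl])
  qed (simp add: i0)
qed (rule hom_in_carrier[OF cocentral_action.i_hom[OF co]], simp add: carrier_chars)

text \<open>Any cocentral action supplies a central element of order \<open>m\<close>, so the locale
  can be instantiated anew with that element in place of \<open>z\<close>.\<close>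

lemma cocentral_central_twist:
  assumes co: "cocentral_action G \<Gamma> i \<alpha>"
  shows "central_twist G m (i (chi 1)) \<zeta>"
proof -
  interpret C: cocentral_action G \<Gamma> i \<alpha> by (rule co)
  note inat = cocentral_chi_power(2)[OF co]
  have i0: "i (chi 0) = \<one>" using inat[of 0] by simp
  show ?thesis
  proof
    show "i (chi 1) \<in> group_center G"
      using C.i_central by (auto simp: carrier_chars)
    have "chi (int m) = chi 0" by (simp add: chi_eq_iff)
    then show "i (chi 1) [^] m = \<one>" using inat[of m] i0 by simp
    show "i (chi 1) \<noteq> \<one>"
    proof
      assume "i (chi 1) = \<one>"
      then have "chi 1 = chi 0"
        using C.i_inj i0 by (auto simp: inj_on_def carrier_chars)
      then show False using prime_gt_1_nat[OF prime_m] by (simp add: chi_eq_iff)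
    qed
  qed (use finite_G prime_m zeta_pow_m zeta_neq_one in auto)
qed

text \<open>Both Z_m and its character group are cyclic, so the whole action is recovered from
  \<open>\<alpha> 1\<close> and \<open>i (chi 1)\<close>.\<close>

lemma cocentral_imp_twist:
  assumes co: "cocentral_action G \<Gamma> i \<alpha>" and z: "i (chi 1) = z"
  shows "\<alpha> 1 \<in> torsion_auts \<and> graded_twisting G \<Gamma> i \<alpha> = twist (\<alpha> 1)"
proof -
  interpret C: cocentral_action G \<Gamma> i \<alpha> by (rule co)
  have inat: "i (chi (int n)) = z [^] n" for n using cocentral_chi_power(2)[OF co] z by simp
  have ichi: "i (chi j) = z [^] j" for j
  proof -
    have "chi j = chi (int (nat (j mod int m)))" using m_pos by (simp add: chi_eq_iff)
    then have "i (chi j) = z [^] int (nat (j mod int m))" by (simp only: inat int_pow_int)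
    then show ?thesis using m_pos by simp
  qed
  have aauto: "\<alpha> g \<in> auto G" if "g \<in> I" for g
    using hom_in_carrier[OF C.alpha_hom, of g] that by (simp add: carrier_\<Gamma>)
  have amult: "\<alpha> ((g + h) mod int m) = \<alpha> g \<otimes>\<^bsub>AutoGroup G\<^esub> \<alpha> h" if "g \<in> I" "h \<in> I" for g h
    using hom_mult[OF C.alpha_hom, of g h] that by (simp add: carrier_\<Gamma>)
  have a0: "\<alpha> 0 = \<one>\<^bsub>AutoGroup G\<^esub>"
    by (rule hom_one[OF C.alpha_hom C.\<Gamma>.is_group AG.is_group, simplified])
  have anat: "\<alpha> (int n mod int m) = \<alpha> 1 [^]\<^bsub>AutoGroup G\<^esub> n" for n
  proof (induction n)
    case (Suc n)
    have "\<alpha> (int (Suc n) mod int m) = \<alpha> ((int n mod int m + 1) mod int m)"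
      by (metis mod_add_left_eq of_nat_Suc add.commute)
    also have "\<dots> = \<alpha> (int n mod int m) \<otimes>\<^bsub>AutoGroup G\<^esub> \<alpha> 1"
      using m_pos by (intro amult) auto
    finally show ?case using Suc by simp
  qed (simp add: a0)
  have a1: "\<alpha> 1 \<in> torsion_auts"
    using aauto[of 1] anat[of m] a0 C.alpha_fixes[of 1 "chi 1"] z
    by (simp add: torsion_auts_def carrier_\<Gamma> carrier_chars)
  have ag: "\<alpha> g = ap (\<alpha> 1) g" if "g \<in> I" for g
    using anat[of "nat g"] that by (simp add: int_pow_int[symmetric])
  have hom: "homogeneous G \<Gamma> i g = {\<phi> \<in> extensional (carrier G). homog g \<phi>}" if "g \<in> I" for g
    using that unfolding homogeneous_def homog_def
    by (auto simp: function_hopf_def carrier_chars ichi chi_apply)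
  have act: "act G \<alpha> g \<psi> x = \<psi> (ap (\<alpha> 1) (- g) x)" if "g \<in> I" "x \<in> carrier G" for g \<psi> x
    using that inv_AutoGroup_apply(3)[OF ap_auto[OF a1, of g] that(2)]
      AG.int_pow_neg[of "\<alpha> 1" g] torsion_auts_auto[OF a1]
    by (simp add: act_def ag[OF that(1)])
  have comp: "components G \<Gamma> i \<phi> g x = proj \<phi> g x" if "g \<in> I" "x \<in> carrier G" for \<phi> g x
    using hom that by (rule components_eq)
  have "monoid.mult (graded_twisting G \<Gamma> i \<alpha>) = tmult (\<alpha> 1)"
  proof (rule ext, rule ext)
    fix \<phi> \<psi>
    have "monoid.mult (graded_twisting G \<Gamma> i \<alpha>) \<phi> \<psi>
        = (\<lambda>x\<in>carrier G. \<Sum>g\<in>I. components G \<Gamma> i \<phi> g x * act G \<alpha> g \<psi> x)"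
      unfolding graded_twisting_def carrier_\<Gamma> by simp
    also have "\<dots> = tmult (\<alpha> 1) \<phi> \<psi>"
      unfolding tmult_def by (rule restrict_ext, rule sum.cong[OF refl]) (simp add: comp act)
    finally show "monoid.mult (graded_twisting G \<Gamma> i \<alpha>) \<phi> \<psi> = tmult (\<alpha> 1) \<phi> \<psi>" .
  qed
  moreover have "antipode (graded_twisting G \<Gamma> i \<alpha>) = tanti (\<alpha> 1)"
  proof (rule ext)
    fix \<phi>
    have eq: "act G \<alpha> (inv\<^bsub>\<Gamma>\<^esub> g) (antipode (function_hopf G) (components G \<Gamma> i \<phi> g)) x
        = proj \<phi> g (inv (ap (\<alpha> 1) g x))" if gx: "g \<in> I" "x \<in> carrier G" for g x
    proof -
      have inv: "inv\<^bsub>\<Gamma>\<^esub> g = (- g) mod int m" using gx by (intro inv_integer_mod_group) (simp add: carrier_\<Gamma>)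
      have "ap (\<alpha> 1) (- ((- g) mod int m)) = ap (\<alpha> 1) g" using a1 by simp
      then show ?thesis
        unfolding inv using gx a1 m_pos by (simp add: act function_hopf_def comp)
    qed
    have "antipode (graded_twisting G \<Gamma> i \<alpha>) \<phi>
        = (\<lambda>x\<in>carrier G. \<Sum>g\<in>I. act G \<alpha> (inv\<^bsub>\<Gamma>\<^esub> g) (antipode (function_hopf G) (components G \<Gamma> i \<phi> g)) x)"
      unfolding graded_twisting_def carrier_\<Gamma> by simp
    also have "\<dots> = tanti (\<alpha> 1) \<phi>"
      unfolding tanti_def by (rule restrict_ext, rule sum.cong[OF refl]) (rule eq)
    finally show "antipode (graded_twisting G \<Gamma> i \<alpha>) \<phi> = tanti (\<alpha> 1) \<phi>" .
  qed
  ultimately have "graded_twisting G \<Gamma> i \<alpha> = twist (\<alpha> 1)"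
    unfolding twist_def graded_twisting_def by simp
  then show ?thesis using a1 by simp
qed

lemma central_twist_power:
  assumes "coprime l (int m)"
  shows "central_twist G m (z [^] l) \<zeta>"
proof (unfold_locales)
  show "z [^] l \<in> group_center G" by (simp add: group_center_def zp_comm)
  have "(z [^] l) [^] m = z [^] (l * int m)" by (simp add: int_pow_pow int_pow_int[symmetric])
  also have "\<dots> = \<one>" by (subst zp_one_iff) simp
  finally show "(z [^] l) [^] m = \<one>" .
  show "z [^] l \<noteq> \<one>"
  proof
    assume "z [^] l = \<one>"
    then have "int m dvd 1" using assms by (metis zp_one_iff coprime_common_divisor dvd_refl)
    then show False using prime_gt_1_nat[OF prime_m] by simp
  qed
qed (use finite_G prime_m zeta_pow_m zeta_neq_one in auto)

lemma coprime_inverse: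
  assumes "coprime l (int m)"
  obtains l' where "(l * l') mod int m = 1 mod int m" "coprime l' (int m)"
proof -
  obtain u v where "u * l + v * int m = 1"
    using assms by (metis bezout_int coprime_imp_gcd_eq_1)
  then have *: "l * u - 1 = int m * (- v)" "l * u + int m * v = 1" by (simp_all add: algebra_simps)
  then have "(l * u) mod int m = 1 mod int m" unfolding mod_eq_dvd_iff by (metis dvd_triv_left)
  moreover have "coprime u (int m)"
    using *(2) by (metis coprime_iff_gcd_eq_1 coprime_commute gcd_dvd1 gcd_dvd2 dvd_add dvd_mult dvd_mult2 is_unit_gcd)
  ultimately show ?thesis by (rule that)
qed

text \<open>Degree \<open>g\<close> with respect to \<open>z [^] l\<close> is degree
  \<open>l' * g\<close> with respect to \<open>z\<close>, where \<open>l'\<close> inverts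
  \<open>l\<close> modulo \<open>m\<close>. Since \<open>ap a g\<close> is the power
  \<open>l' * g\<close> of \<open>ap a l\<close>, rescaling the degrees and replacing
  \<open>a\<close> by \<open>ap a l\<close> compensate each other.\<close>

lemma twist_power:
  assumes l: "coprime l (int m)" and a: "a \<in> central_twist.torsion_auts G m (z [^] l)"
  shows "a \<in> torsion_auts" and "central_twist.twist G m (z [^] l) \<zeta> a = twist (ap a l)"
proof -
  interpret Z: central_twist G m "z [^] l" \<zeta> by (rule central_twist_power[OF l])
  obtain l' where l': "(l * l') mod int m = 1 mod int m" using coprime_inverse[OF l] by blast
  then have l'2: "(l' * l) mod int m = 1 mod int m" by (simp add: mult.commute)
  have ll: "(l * l' * j) mod int m = j mod int m" "(l' * l * j) mod int m = j mod int m" for j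
    using l' l'2 by (metis mod_mult_left_eq mult_1)+
  have zz: "z = (z [^] l) [^] l'"
  proof -
    have "z [^] (l * l') = z [^] (1::int)" using l' by (simp only: zp_eq_iff)
    then show ?thesis by (simp add: int_pow_pow)
  qed
  have "a z = a (z [^] l) [^] l'"
    using auto_int_pow[OF Z.torsion_auts_auto[OF a], of "z [^] l" l'] zz by simp
  then show at: "a \<in> torsion_auts" using a zz by (simp add: torsion_auts_def Z.torsion_auts_def)
  have proj: "Z.proj \<phi> g x = proj \<phi> (l' * g) x" for \<phi> g x
  proof -
    let ?f = "\<lambda>j. \<zeta> powi (- (j * (l' * g))) * \<phi> (x \<otimes> z [^] j)"
    have "\<zeta> powi (- (j * g)) * \<phi> (x \<otimes> (z [^] l) [^] j) = ?f (l * j)" for j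
    proof -
      have "(- (j * g)) mod int m = (- (l * j * (l' * g))) mod int m"
        using ll(1)[of "j * g"] by (intro mod_minus_cong) (simp add: ac_simps)
      then show ?thesis by (simp add: int_pow_pow zeta_eq_iff[symmetric])
    qed
    then have "(\<Sum>j\<in>I. \<zeta> powi (- (j * g)) * \<phi> (x \<otimes> (z [^] l) [^] j)) = (\<Sum>j\<in>I. ?f (l * j))"
      by simp
    also have "\<dots> = (\<Sum>j\<in>I. ?f j)"
      by (rule sum_mod_mult[OF m_pos _ l']) (simp add: power_int_minus zeta_mod_mult)
    finally show ?thesis by (simp add: Z.proj_def proj_def)
  qed
  have ap: "ap (ap a l) (l' * g) = ap a g" for g
    using at ll(1)[of g] by (simp add: ap_ap mult.assoc[symmetric]) (rule ap_eq)
  have "Z.tmult a = tmult (ap a l)"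
    unfolding tmult_def Z.tmult_def
  proof (rule ext, rule ext, rule restrict_ext)
    fix \<phi> \<psi> x assume x: "x \<in> carrier G"
    let ?f = "\<lambda>g. proj \<phi> g x * \<psi> (ap (ap a l) (- g) x)"
    have "(\<Sum>g\<in>I. Z.proj \<phi> g x * \<psi> (ap a (- g) x)) = (\<Sum>g\<in>I. ?f (l' * g))"
      using ap[of "- _"] by (simp add: proj)
    also have "\<dots> = (\<Sum>g\<in>I. ?f g)"
      by (rule sum_mod_mult[OF m_pos _ l'2]) (simp add: ap_torsion_auts[OF at])
    finally show "(\<Sum>g\<in>I. Z.proj \<phi> g x * \<psi> (ap a (- g) x)) = (\<Sum>g\<in>I. ?f g)" .
  qed
  moreover have "Z.tanti a = tanti (ap a l)"
    unfolding tanti_def Z.tanti_def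
  proof (rule ext, rule restrict_ext)
    fix \<phi> x assume x: "x \<in> carrier G"
    let ?f = "\<lambda>g. proj \<phi> g (inv (ap (ap a l) g x))"
    have "(\<Sum>g\<in>I. Z.proj \<phi> g (inv (ap a g x))) = (\<Sum>g\<in>I. ?f (l' * g))"
      using ap by (simp add: proj)
    also have "\<dots> = (\<Sum>g\<in>I. ?f g)"
      by (rule sum_mod_mult[OF m_pos _ l'2]) (simp add: ap_torsion_auts[OF at])
    finally show "(\<Sum>g\<in>I. Z.proj \<phi> g (inv (ap a g x))) = (\<Sum>g\<in>I. ?f g)" .
  qed
  ultimately show "Z.twist a = twist (ap a l)" by (simp add: twist_def Z.twist_def)
qed

theorem noncomm_graded_twistings_eq:
  assumes center: "group_center G = range (\<lambda>j::int. z [^] j)"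
  shows "noncomm_graded_twistings G \<Gamma> = twist ` {a \<in> torsion_auts. noncommutative (twist a)}"
proof (intro equalityI subsetI)
  fix H assume "H \<in> twist ` {a \<in> torsion_auts. noncommutative (twist a)}"
  then obtain a where a: "a \<in> torsion_auts" and nc: "noncommutative (twist a)" and H: "H = twist a" by blast
  obtain i \<alpha> where "cocentral_action G \<Gamma> i \<alpha>" "i (chi 1) = z" "\<alpha> 1 = a"
    using cocentral_exists[OF a] by blast
  then have "\<exists>i \<alpha>. cocentral_action G \<Gamma> i \<alpha> \<and> H = graded_twisting G \<Gamma> i \<alpha>"
    using cocentral_imp_twist H by metis
  then show "H \<in> noncomm_graded_twistings G \<Gamma>"
    using hopf_algebra_twist[OF a] nc by (simp add: noncomm_graded_twistings_def H)
next
  fix H :: "('k, 'g \<Rightarrow> 'k) hopf" assume "H \<in> noncomm_graded_twistings G \<Gamma>"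
  then obtain i \<alpha> where co: "cocentral_action G \<Gamma> i \<alpha>" and H: "H = graded_twisting G \<Gamma> i \<alpha>"
    and nc: "noncommutative H"
    by (auto simp: noncomm_graded_twistings_def)
  interpret Z: central_twist G m "i (chi 1)" \<zeta> by (rule cocentral_central_twist[OF co])
  \<comment> \<open>The centre is generated by \<open>z\<close>, and a nontrivial element of it is a
    power with exponent prime to \<open>m\<close>.\<close>
  obtain l :: int where l: "i (chi 1) = z [^] l" using Z.z_center center by auto
  have "\<not> int m dvd l" using Z.z_neq_one zp_one_iff[of l] l by auto
  then have cop: "coprime l (int m)"
    using prime_m by (metis coprime_commute prime_imp_coprime prime_nat_int_transfer)
  have "\<alpha> 1 \<in> Z.torsion_auts" "H = Z.twist (\<alpha> 1)" using Z.cocentral_imp_twist[OF co refl] H by simp_all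
  then have "\<alpha> 1 \<in> torsion_auts" "H = twist (ap (\<alpha> 1) l)" using twist_power[OF cop, of "\<alpha> 1"] by (simp_all add: l)
  then show "H \<in> twist ` {a \<in> torsion_auts. noncommutative (twist a)}"
    using ap_torsion_auts nc by blast
qed

end

section \<open>Hopf isomorphisms between twistings\<close>

context central_twist
begin

lemma homog_coset_indicator:
  assumes w: "w \<in> carrier G"
  shows "homog 0 (\<lambda>x. if \<exists>j::int. x = w \<otimes> z [^] j then 1 else 0)"
proof (rule homogI)
  fix x assume x: "x \<in> carrier G"
  have "(\<exists>j::int. x \<otimes> z = w \<otimes> z [^] j) \<longleftrightarrow> (\<exists>j::int. x = w \<otimes> z [^] j)"
  proof
    assume "\<exists>j::int. x = w \<otimes> z [^] j"
    then obtain j :: int where "x = w \<otimes> z [^] j" by blast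
    then have "x \<otimes> z = w \<otimes> z [^] (j + 1)" using w by (simp add: int_pow_mult m_assoc)
    then show "\<exists>j::int. x \<otimes> z = w \<otimes> z [^] j" by blast
  next
    assume "\<exists>j::int. x \<otimes> z = w \<otimes> z [^] j"
    then obtain j :: int where "x \<otimes> z = w \<otimes> z [^] j" by blast
    also have "z [^] j = z [^] (j - 1) \<otimes> z" using int_pow_mult[of z "j - 1" 1] by simp
    finally have "x \<otimes> z = (w \<otimes> z [^] (j - 1)) \<otimes> z" using w by (simp add: m_assoc)
    then have "x = w \<otimes> z [^] (j - 1)" using x w by simp
    then show "\<exists>j::int. x = w \<otimes> z [^] j" by blast
  qed
  then show "(if \<exists>j::int. x \<otimes> z = w \<otimes> z [^] j then 1 else 0)
    = \<zeta> powi 0 * (if \<exists>j::int. x = w \<otimes> z [^] j then 1 else 0)" by simp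
qed

text \<open>Degree 0 functions are those constant on the cosets of the powers of \<open>z\<close>.
  The separating one is the average of a delta function, nonzero exactly on one coset.\<close>

lemma coset_sep:
  assumes "u \<in> carrier G" "v \<in> carrier G" "\<And>\<phi>. homog 0 \<phi> \<Longrightarrow> \<phi> u = \<phi> v"
  shows "\<exists>j::int. u = v \<otimes> z [^] j"
proof -
  have "proj (delta_fun G v) 0 v \<noteq> 0"
  proof -
    have "(\<Sum>j\<in>I. \<zeta> powi (- (j * 0)) * delta_fun G v (v \<otimes> z [^] j)) = (\<Sum>j\<in>I. if j = 0 then 1 else 0)"
    proof (rule sum.cong[OF refl])
      fix j assume j: "j \<in> I"
      have "v \<otimes> z [^] j = v \<longleftrightarrow> z [^] j = \<one>"
        using assms(2) by (metis int_pow_closed l_cancel_one' r_one z_closed)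
      also have "\<dots> \<longleftrightarrow> j = 0" using j zdvd_imp_le[of "int m" j] by (cases "j = 0") (auto simp: zp_one_iff)
      finally show "\<zeta> powi (- (j * 0)) * delta_fun G v (v \<otimes> z [^] j) = (if j = 0 then 1 else 0)"
        using assms(2) by (simp add: delta_fun_def)
    qed
    then show ?thesis using m_pos by (simp add: proj_def)
  qed
  then have "proj (delta_fun G v) 0 u \<noteq> 0"
    using assms(3)[OF homog_proj[of 0]] by simp
  then obtain j :: int where "delta_fun G v (u \<otimes> z [^] j) \<noteq> (0 :: 'k)"
    by (auto simp: proj_def elim!: sum.not_neutral_contains_not_neutral)
  then have "v = u \<otimes> z [^] j" using assms by (auto simp: delta_fun_def split: if_splits)
  then have "u = v \<otimes> z [^] (- j)"
    using assms by (simp add: m_assoc int_pow_mult[symmetric])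
  then show ?thesis by blast
qed

text \<open>Choosing a representative in each coset, the function sends the representative times
  \<open>z [^] j\<close> to \<open>\<zeta> powi j\<close>. The representative is picked from the set
  \<open>S x\<close>, which depends only on the coset, so that it is the same for all its
  elements.\<close>

lemma ex_nonvanishing_homog:
  "\<exists>u. homog 1 u \<and> (\<forall>x\<in>carrier G. u x \<noteq> 0)"
proof -
  define S where "S x = {w \<in> carrier G. \<exists>j::int. w = x \<otimes> z [^] j}" for x
  define rep where "rep x = (SOME w. w \<in> S x)" for x
  define e where "e x = (SOME j::int. x = rep x \<otimes> z [^] j)" for x
  have rep: "rep x \<in> carrier G" "x = rep x \<otimes> z [^] e x" if x: "x \<in> carrier G" for x
  proof -
    have "x = x \<otimes> z [^] (0::int)" using x by simp
    then have "x \<in> S x" using x unfolding S_def by blast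
    then have "rep x \<in> S x" unfolding rep_def by (rule someI)
    then obtain j :: int where j: "rep x = x \<otimes> z [^] j" "rep x \<in> carrier G" by (auto simp: S_def)
    then have "x = rep x \<otimes> z [^] (- j)" using x by (simp add: m_assoc int_pow_mult[symmetric])
    then show "x = rep x \<otimes> z [^] e x" unfolding e_def by (rule someI)
    show "rep x \<in> carrier G" by (rule j)
  qed
  have S: "S (x \<otimes> z) = S x" if x: "x \<in> carrier G" for x
  proof -
    have "x \<otimes> z \<otimes> z [^] j = x \<otimes> z [^] (j + 1)" for j :: int
      using x zp_comm[of z j] by (simp add: m_assoc int_pow_mult)
    moreover have "x \<otimes> z [^] j = x \<otimes> z \<otimes> z [^] (j - 1)" for j :: int
      using calculation[of "j - 1"] by simp
    ultimately show ?thesis unfolding S_def by blast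
  qed
  have "homog 1 (\<lambda>x. \<zeta> powi e x)"
  proof (rule homogI)
    fix x assume x: "x \<in> carrier G"
    have "rep (x \<otimes> z) = rep x" by (simp add: rep_def S[OF x])
    then have "rep x \<otimes> z [^] e (x \<otimes> z) = x \<otimes> z" using rep(2)[of "x \<otimes> z"] x by simp
    also have "\<dots> = rep x \<otimes> z [^] e x \<otimes> z" using rep(2)[OF x] by simp
    also have "\<dots> = rep x \<otimes> z [^] (e x + 1)" using rep(1)[OF x] by (simp add: m_assoc int_pow_mult)
    finally have "z [^] e (x \<otimes> z) = z [^] (e x + 1)" using rep(1)[OF x] by simp
    then have "\<zeta> powi e (x \<otimes> z) = \<zeta> powi (e x + 1)" by (simp only: zp_eq_iff zeta_eq_iff)
    then show "\<zeta> powi e (x \<otimes> z) = \<zeta> powi 1 * \<zeta> powi e x" using zeta_nz by (simp add: power_int_add)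
  qed
  then show ?thesis using zeta_nz by (intro exI[of _ "\<lambda>x. \<zeta> powi e x"]) simp
qed

lemma ap_conj:
  assumes a: "a \<in> torsion_auts" and b: "b \<in> torsion_auts" and f: "f \<in> auto G" and x: "x \<in> carrier G"
    and conj: "\<And>x. x \<in> carrier G \<Longrightarrow> a (f x) = f (ap b l x)"
  shows "ap a j (f x) = f (ap b (l * j) x)"
proof -
  have nat: "ap a (int n) (f x) = f (ap b (l * int n) x)" for n
  proof (induction n)
    case 0 then show ?case using x f by (simp add: auto_closed)
  next
    case (Suc n)
    have "ap a (int (Suc n)) (f x) = a (ap a (int n) (f x))"
      using ap_add[OF a, of "f x" 1 "int n"] a f x by (simp add: auto_closed)
    also have "\<dots> = f (ap b (l + l * int n) x)"
      using Suc b x conj by (simp add: ap_add[OF b])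
    finally show ?case by (simp add: distrib_left)
  qed
  have "ap a j = ap a (int (nat (j mod int m)))" using a m_pos by simp
  moreover have "ap b (l * int (nat (j mod int m))) = ap b (l * j)"
    using m_pos by (intro ap_eq[OF b]) (simp add: mod_mult_right_eq)
  ultimately show ?thesis using nat by metis
qed

text \<open>Since \<open>f z = z [^] l\<close>, composition with \<open>f\<close> multiplies degrees
  by \<open>l\<close>, and the relation between \<open>a\<close> and \<open>b\<close> rescales the
  acting power by the same factor. After reindexing by the inverse \<open>l'\<close>, both twisted
  operations correspond.\<close>

lemma hopf_iso_of_auto:
  assumes a: "a \<in> torsion_auts" and b: "b \<in> torsion_auts" and f: "f \<in> auto G" and l: "coprime l (int m)"
    and fz: "f z = z [^] l"
    and conj: "\<And>x. x \<in> carrier G \<Longrightarrow> a (f x) = f (ap b l x)"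
  shows "(\<lambda>\<phi>. \<lambda>x\<in>carrier G. \<phi> (f x)) \<in> hopf_isos (twist a) (twist b)"
proof -
  let ?F = "\<lambda>\<phi>. \<lambda>x\<in>carrier G. \<phi> (f x)"
  obtain l' where l': "(l * l') mod int m = 1 mod int m" using coprime_inverse[OF l] by blast
  then have l'2: "(l' * l) mod int m = 1 mod int m" by (simp add: mult.commute)
  have ll: "(l * l' * j) mod int m = j mod int m" for j
    using l' by (metis mod_mult_left_eq mult_1)
  have fc: "f x \<in> carrier G" if "x \<in> carrier G" for x using auto_closed[OF f that] .
  have bij: "bij_betw f (carrier G) (carrier G)" by (rule auto_bij[OF f])
  have proj: "proj (?F \<phi>) g x = proj \<phi> (l' * g) (f x)" if x: "x \<in> carrier G" for \<phi> g x
  proof -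
    let ?f = "\<lambda>j. \<zeta> powi (- (j * (l' * g))) * \<phi> (f x \<otimes> z [^] j)"
    have "\<zeta> powi (- (j * g)) * ?F \<phi> (x \<otimes> z [^] j) = ?f (l * j)" for j
    proof -
      have "(- (j * g)) mod int m = (- (l * j * (l' * g))) mod int m"
        using ll[of "j * g"] by (intro mod_minus_cong) (simp add: ac_simps)
      then have "\<zeta> powi (- (j * g)) = \<zeta> powi (- (l * j * (l' * g)))" by (simp only: zeta_eq_iff)
      then show ?thesis using x by (simp add: auto_mult[OF f] auto_int_pow[OF f] fz int_pow_pow)
    qed
    then have "(\<Sum>j\<in>I. \<zeta> powi (- (j * g)) * ?F \<phi> (x \<otimes> z [^] j)) = (\<Sum>j\<in>I. ?f (l * j))"
      by simp
    also have "\<dots> = (\<Sum>j\<in>I. ?f j)"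
      by (rule sum_mod_mult[OF m_pos _ l']) (simp add: power_int_minus zeta_mod_mult)
    finally show ?thesis by (simp add: proj_def)
  qed
  have ap: "f (ap b g x) = ap a (l' * g) (f x)" if "x \<in> carrier G" for g x
    using ap_conj[OF a b f that conj, of "l' * g"] ap_eq[OF b ll[of g]] by (simp add: mult.assoc)
  have mult: "?F (tmult a \<phi> \<psi>) = tmult b (?F \<phi>) (?F \<psi>)" for \<phi> \<psi>
  proof (rule extensionalityI[where A="carrier G"])
    fix x assume x: "x \<in> carrier G"
    let ?f = "\<lambda>g. proj \<phi> g (f x) * \<psi> (ap a (- g) (f x))"
    have "tmult b (?F \<phi>) (?F \<psi>) x = (\<Sum>g\<in>I. ?f (l' * g))"
      using x b by (simp add: tmult_def proj ap)
    also have "\<dots> = (\<Sum>g\<in>I. ?f g)"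
      by (rule sum_mod_mult[OF m_pos _ l'2]) (simp add: a)
    also have "\<dots> = ?F (tmult a \<phi> \<psi>) x" using x fc by (simp add: tmult_def)
    finally show "?F (tmult a \<phi> \<psi>) x = tmult b (?F \<phi>) (?F \<psi>) x" by simp
  qed (simp_all add: tmult_def)
  have anti: "?F (tanti a \<phi>) = tanti b (?F \<phi>)" for \<phi>
  proof (rule extensionalityI[where A="carrier G"])
    fix x assume x: "x \<in> carrier G"
    let ?f = "\<lambda>g. proj \<phi> g (inv (ap a g (f x)))"
    have "tanti b (?F \<phi>) x = (\<Sum>g\<in>I. ?f (l' * g))"
      using x b by (simp add: tanti_def proj auto_inv[OF f] ap)
    also have "\<dots> = (\<Sum>g\<in>I. ?f g)"
      by (rule sum_mod_mult[OF m_pos _ l'2]) (simp add: a)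
    also have "\<dots> = ?F (tanti a \<phi>) x" using x fc by (simp add: tanti_def)
    finally show "?F (tanti a \<phi>) x = tanti b (?F \<phi>) x" by simp
  qed (simp_all add: tanti_def)
  have Fdelta: "?F (delta_fun G (f x)) = delta_fun G x" if "x \<in> carrier G" for x
    using bij that unfolding delta_fun_def
    by (intro restrict_ext) (auto simp: fc bij_betw_def inj_on_eq_iff)
  have comult: "comult (twist b) (?F \<phi>) \<beta> = comult (twist a) \<phi> (\<lambda>x y. \<beta> (?F x) (?F y))" for \<phi> \<beta>
  proof -
    have reindex: "(\<Sum>x\<in>carrier G. h x) = (\<Sum>x\<in>carrier G. h (f x))" for h :: "'g \<Rightarrow> 'k"
      by (rule sum.reindex_bij_betw[OF bij, symmetric])
    have "comult (twist a) \<phi> (\<lambda>x y. \<beta> (?F x) (?F y))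
       = (\<Sum>x\<in>carrier G. \<Sum>y\<in>carrier G. \<phi> (x \<otimes> y) * \<beta> (?F (delta_fun G x)) (?F (delta_fun G y)))"
      by simp
    also have "\<dots> = (\<Sum>x\<in>carrier G. \<Sum>y\<in>carrier G. \<phi> (f x \<otimes> f y) * \<beta> (?F (delta_fun G (f x))) (?F (delta_fun G (f y))))"
      by (rule trans[OF reindex], rule sum.cong[OF refl], rule reindex)
    also have "\<dots> = (\<Sum>x\<in>carrier G. \<Sum>y\<in>carrier G. \<phi> (f (x \<otimes> y)) * \<beta> (delta_fun G x) (delta_fun G y))"
      by (intro sum.cong refl) (simp only: Fdelta auto_mult[OF f])
    finally show ?thesis by simp
  qed
  have bijF: "bij_betw ?F (extensional (carrier G)) (extensional (carrier G))"
  proof (rule bij_betw_byWitness[where f'="\<lambda>\<phi>. \<lambda>x\<in>carrier G. \<phi> ((inv\<^bsub>AutoGroup G\<^esub> f) x)"])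
    have i: "inv\<^bsub>AutoGroup G\<^esub> f \<in> auto G" using AG.inv_closed[of f] f by simp
    show "\<forall>\<phi>\<in>extensional (carrier G). (\<lambda>x\<in>carrier G. ?F \<phi> ((inv\<^bsub>AutoGroup G\<^esub> f) x)) = \<phi>"
      using auto_closed[OF i] inv_AutoGroup_apply(1)[OF f]
      by (auto intro!: extensionalityI[where A="carrier G"])
    show "\<forall>\<phi>\<in>extensional (carrier G). ?F (\<lambda>x\<in>carrier G. \<phi> ((inv\<^bsub>AutoGroup G\<^esub> f) x)) = \<phi>"
      using fc inv_AutoGroup_apply(2)[OF f] by (auto intro!: extensionalityI[where A="carrier G"])
  qed auto
  show ?thesis
    unfolding hopf_isos_def
    using mult anti comult bijF fc auto_one[OF f]
    by (auto simp: linear_map_def intro!: restrict_ext)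
qed

end

text \<open>The properties of SL_n on which the classification rests: the quotient by the powers of
  \<open>z\<close> has trivial centre, and linear characters have exponent dividing some
  \<open>r\<close> prime to \<open>m\<close>.\<close>

locale centreless_twist = central_twist G m z \<zeta>
  for G :: "('g, 'r) monoid_scheme" (structure) and m z and \<zeta> :: "'k::field_char_0" +
  fixes r :: nat
  assumes centreless: "\<lbrakk>x \<in> carrier G; \<And>y. y \<in> carrier G \<Longrightarrow> \<exists>j::int. x \<otimes> y = y \<otimes> x \<otimes> z [^] j\<rbrakk>
      \<Longrightarrow> \<exists>j::int. x = z [^] j"
    and coprime_r: "coprime r m"
    and char_torsion: "\<lbrakk>\<And>x y. \<lbrakk>x \<in> carrier G; y \<in> carrier G\<rbrakk> \<Longrightarrow> D (x \<otimes> y) = D x * D y;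
      \<And>x. x \<in> carrier G \<Longrightarrow> D x \<noteq> 0; x \<in> carrier G\<rbrakk> \<Longrightarrow> (D x :: 'k) ^ r = 1"
begin

text \<open>The discrepancy between the two homomorphisms is a homomorphism to the powers of
  \<open>z\<close>. Read through \<open>\<zeta>\<close> it is a linear character whose values are
  both r-th and m-th roots of unity, hence 1.\<close>

lemma hom_eq_of_cong:
  assumes A: "\<And>x y. \<lbrakk>x \<in> carrier G; y \<in> carrier G\<rbrakk> \<Longrightarrow> A (x \<otimes> y) = A x \<otimes> A y"
    and B: "\<And>x y. \<lbrakk>x \<in> carrier G; y \<in> carrier G\<rbrakk> \<Longrightarrow> B (x \<otimes> y) = B x \<otimes> B y"
    and Ac: "\<And>x. x \<in> carrier G \<Longrightarrow> A x \<in> carrier G"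
    and cong: "\<And>x. x \<in> carrier G \<Longrightarrow> \<exists>j::int. B x = A x \<otimes> z [^] j"
    and x: "x \<in> carrier G"
  shows "B x = A x"
proof -
  define e where "e x = (SOME j::int. B x = A x \<otimes> z [^] j)" for x
  have e: "B x = A x \<otimes> z [^] e x" if "x \<in> carrier G" for x
    unfolding e_def by (rule someI_ex) (rule cong[OF that])
  have "(\<zeta> powi e x) ^ r = 1"
  proof (rule char_torsion[OF _ _ x])
    fix x y assume xy: "x \<in> carrier G" "y \<in> carrier G"
    have "A (x \<otimes> y) \<otimes> z [^] e (x \<otimes> y) = B x \<otimes> B y"
      using e[of "x \<otimes> y"] B xy by simp
    also have "\<dots> = (A x \<otimes> z [^] e x) \<otimes> (A y \<otimes> z [^] e y)"
      using e xy by simp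
    also have "\<dots> = A (x \<otimes> y) \<otimes> z [^] (e x + e y)"
      using xy by (simp add: A Ac zp_middle2)
    finally have "z [^] e (x \<otimes> y) = z [^] (e x + e y)"
      using xy Ac by (metis Units_eq Units_l_cancel int_pow_closed z_closed m_closed)
    then have "\<zeta> powi e (x \<otimes> y) = \<zeta> powi (e x + e y)" by (simp only: zp_eq_iff zeta_eq_iff)
    then show "\<zeta> powi e (x \<otimes> y) = \<zeta> powi e x * \<zeta> powi e y" using zeta_nz by (simp add: power_int_add)
  qed (simp add: zeta_nz)
  then have "\<zeta> powi (e x * int r) = 1" by (simp add: power_int_mult)
  then have "int m dvd e x * int r" by (simp add: zeta_one_iff)
  then have "int m dvd e x" using coprime_r
    by (metis coprime_commute coprime_dvd_mult_left_iff coprime_int_iff)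
  then show ?thesis using e[OF x] Ac[OF x] by (simp add: zp_one_iff[THEN iffD2])
qed

text \<open>If \<open>a\<close> is the identity modulo powers of \<open>z\<close>, it is the
  identity and the product is pointwise. Otherwise a degree 0 function separating \<open>a x\<close>
  from \<open>x\<close> fails to commute with a nonvanishing function of degree 1: at
  \<open>a x\<close> the two products involve its values at \<open>x\<close> and at
  \<open>a x\<close>.\<close>

lemma noncommutative_twist_iff:
  assumes a: "a \<in> torsion_auts"
  shows "noncommutative (twist a) \<longleftrightarrow> \<not> (\<forall>x\<in>carrier G. \<exists>j::int. a x = x \<otimes> z [^] j)"
proof
  assume nc: "noncommutative (twist a)"
  show "\<not> (\<forall>x\<in>carrier G. \<exists>j::int. a x = x \<otimes> z [^] j)"
  proof
    assume id: "\<forall>x\<in>carrier G. \<exists>j::int. a x = x \<otimes> z [^] j"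
    have "a x = x" if "x \<in> carrier G" for x
      using hom_eq_of_cong[of "\<lambda>x. x" a, OF _ _ _ _ that] id auto_mult[OF torsion_auts_auto[OF a]] by auto
    then have "a = \<one>\<^bsub>AutoGroup G\<^esub>"
      using AG.one_closed by (intro auto_eqI[OF torsion_auts_auto[OF a]]) auto
    then have "ap a j x = x" if "x \<in> carrier G" for j x using that by simp
    then have "tmult a \<phi> \<psi> = (\<lambda>x\<in>carrier G. \<phi> x * \<psi> x)" for \<phi> \<psi>
      unfolding tmult_def by (intro restrict_ext) (simp add: sum_distrib_right[symmetric] sum_proj)
    then show False using nc by (simp add: noncommutative_def mult.commute)
  qed
next
  assume "\<not> (\<forall>x\<in>carrier G. \<exists>j::int. a x = x \<otimes> z [^] j)"
  then obtain x where x: "x \<in> carrier G" "\<nexists>j::int. a x = x \<otimes> z [^] j" by blast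
  have ax: "a x \<in> carrier G" by (rule auto_closed[OF torsion_auts_auto[OF a] x(1)])
  obtain \<phi> where \<phi>: "homog 0 \<phi>" "\<phi> (a x) \<noteq> \<phi> x" using coset_sep[OF ax x(1)] x(2) by blast
  obtain u where u: "homog 1 u" "\<forall>x\<in>carrier G. u x \<noteq> 0" using ex_nonvanishing_homog by blast
  have h: "homog 0 (restrict \<phi> (carrier G))" "homog 1 (restrict u (carrier G))"
    using homog_cong[OF \<phi>(1)] homog_cong[OF u(1)] by simp_all
  have "tmult a (restrict u (carrier G)) (restrict \<phi> (carrier G)) (a x) = u (a x) * \<phi> x"
    using tmult_homog[OF a h(2) ax] ax a x ap_neg_apply(2)[OF a x(1), of 1] by simp
  moreover have "tmult a (restrict \<phi> (carrier G)) (restrict u (carrier G)) (a x) = u (a x) * \<phi> (a x)"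
    using tmult_homog[OF a h(1) ax] ax a by simp
  ultimately have "tmult a (restrict u (carrier G)) (restrict \<phi> (carrier G))
      \<noteq> tmult a (restrict \<phi> (carrier G)) (restrict u (carrier G))"
    using \<phi>(2) u(2) ax by (metis mult_cancel_left)
  then show "noncommutative (twist a)"
    by (simp add: noncommutative_def) (blast intro: restrict_extensional)
qed

end

section \<open>The transpose of a Hopf isomorphism on the group algebra\<close>

locale twist_iso = centreless_twist G m z \<zeta> r
  for G :: "('g, 'r) monoid_scheme" (structure) and m z and \<zeta> :: "'k::field_char_0" and r +
  fixes a b F
  assumes a: "a \<in> torsion_auts" and b: "b \<in> torsion_auts" and F: "F \<in> hopf_isos (twist a) (twist b)"
begin

text \<open>The transpose of \<open>F\<close> applied to the group element \<open>y\<close>, as a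
  functional. Restricting the argument lets it act on arbitrary functions.\<close>

definition ev :: "'g \<Rightarrow> ('g \<Rightarrow> 'k) \<Rightarrow> 'k" where
  "ev y \<phi> = F (restrict \<phi> (carrier G)) y"

lemma ev_expand:
  assumes "y \<in> carrier G"
  shows "ev y \<phi> = (\<Sum>x\<in>carrier G. \<phi> x * ev y (delta_fun G x))"
proof -
  have "linear_form (twist a) (\<lambda>\<phi>. F \<phi> y)"
    using F assms unfolding hopf_isos_def linear_form_def linear_map_def by simp
  from linear_form_expand[OF this, of "restrict \<phi> (carrier G)"]
  show ?thesis by (simp add: ev_def extensional_restrict)
qed

lemma ev_cong: "(\<And>x. x \<in> carrier G \<Longrightarrow> \<phi> x = \<psi> x) \<Longrightarrow> ev y \<phi> = ev y \<psi>"
  by (simp add: ev_def cong: restrict_cong)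

lemma ev_scale: "y \<in> carrier G \<Longrightarrow> ev y (\<lambda>x. c * \<phi> x) = c * ev y \<phi>"
  by (simp add: ev_expand[of y "\<lambda>x. c * \<phi> x"] ev_expand[of y \<phi>] sum_distrib_left mult.assoc)

lemma ev_sum: "y \<in> carrier G \<Longrightarrow> ev y (\<lambda>x. \<Sum>i\<in>S. f i x) = (\<Sum>i\<in>S. ev y (f i))"
  using ev_expand[of y "\<lambda>x. \<Sum>i\<in>S. f i x"] ev_expand[of y "f i" for i]
  by (simp add: sum_distrib_right) (rule sum.swap)

lemma ev_one: "y \<in> carrier G \<Longrightarrow> ev y (\<lambda>x. 1) = 1"
  using F by (simp add: ev_def hopf_isos_def)

lemma F_closed: "\<phi> \<in> extensional (carrier G) \<Longrightarrow> F \<phi> \<in> extensional (carrier G)"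
  using F by (auto simp: hopf_isos_def linear_map_def)

lemma ev_inj:
  assumes "\<And>y. y \<in> carrier G \<Longrightarrow> ev y \<phi> = ev y \<psi>" "x \<in> carrier G"
  shows "\<phi> x = \<psi> x"
proof -
  have "F (restrict \<phi> (carrier G)) = F (restrict \<psi> (carrier G))"
    by (rule extensionalityI[where A="carrier G"]) (use assms F_closed in \<open>simp_all add: ev_def\<close>)
  moreover have "inj_on F (extensional (carrier G))" using F by (simp add: hopf_isos_def bij_betw_def)
  ultimately have "restrict \<phi> (carrier G) = restrict \<psi> (carrier G)"
    by (auto dest: inj_onD)
  then show ?thesis using assms(2) by (metis restrict_apply')
qed

lemma ev_surj: "\<exists>\<phi>. \<forall>y\<in>carrier G. ev y \<phi> = \<psi> y"
proof -
  have "F ` extensional (carrier G) = extensional (carrier G)" using F by (simp add: hopf_isos_def bij_betw_def)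
  then obtain \<phi> where "\<phi> \<in> extensional (carrier G)" "F \<phi> = restrict \<psi> (carrier G)"
    by (metis imageE restrict_extensional)
  then show ?thesis by (intro exI[of _ \<phi>]) (simp add: ev_def extensional_restrict)
qed

lemma ev_mult:
  assumes "y \<in> carrier G" "y' \<in> carrier G"
  shows "ev (y \<otimes> y') \<phi> = ev y (\<lambda>x. ev y' (\<lambda>x'. \<phi> (x \<otimes> x')))"
proof -
  \<comment> \<open>Testing comultiplication against evaluation at a pair of points shows that the
    transpose is multiplicative for convolution.\<close>
  let ?\<beta> = "\<lambda>f h :: 'g \<Rightarrow> 'k. f y * h y'"
  have \<beta>: "?\<beta> \<in> bilinear_forms (twist b)"
    using assms by (intro bilinear_formI) (simp_all add: algebra_simps)
  have comult: "\<forall>f\<in>carrier (twist a). \<forall>\<beta>\<in>bilinear_forms (twist b).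
      comult (twist b) (F f) \<beta> = comult (twist a) f (\<lambda>x y. \<beta> (F x) (F y))"
    using F unfolding hopf_isos_def by blast
  have "comult (twist b) (F (restrict \<phi> (carrier G))) ?\<beta>
      = comult (twist a) (restrict \<phi> (carrier G)) (\<lambda>f h. ?\<beta> (F f) (F h))"
    by (rule comult[rule_format]) (simp, rule \<beta>)
  moreover have "comult (twist b) (F (restrict \<phi> (carrier G))) ?\<beta> = ev (y \<otimes> y') \<phi>"
  proof -
    have "comult (twist b) (F (restrict \<phi> (carrier G))) ?\<beta>
       = (\<Sum>u\<in>carrier G. (\<Sum>v\<in>carrier G. ev (u \<otimes> v) \<phi> * delta_fun G v y') * delta_fun G u y)"
      by (simp add: ev_def sum_distrib_left sum_distrib_right mult.commute mult.left_commute)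
    also have "\<dots> = ev (y \<otimes> y') \<phi>"
      using assms by (simp add: sum_delta_fun(1)[of _ "\<lambda>v. ev (_ \<otimes> v) \<phi>"] sum_delta_fun(1)[of _ "\<lambda>u. ev (u \<otimes> _) \<phi>"])
    finally show ?thesis .
  qed
  moreover have "comult (twist a) (restrict \<phi> (carrier G)) (\<lambda>f h. ?\<beta> (F f) (F h))
     = ev y (\<lambda>x. ev y' (\<lambda>x'. \<phi> (x \<otimes> x')))"
    unfolding ev_expand[OF assms(1), of "\<lambda>x. ev y' (\<lambda>x'. \<phi> (x \<otimes> x'))"]
    by (subst ev_expand[OF assms(2)])
       (simp add: ev_def extensional_restrict sum_distrib_left sum_distrib_right mult.commute mult.left_commute)
  ultimately show ?thesis by simp
qed

lemma ev_tmult: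
  assumes "y \<in> carrier G"
  shows "ev y (tmult a \<phi> \<psi>) = tmult b (\<lambda>x. ev x \<phi>) (\<lambda>x. ev x \<psi>) y"
proof -
  have "restrict (tmult a \<phi> \<psi>) (carrier G) = tmult a (restrict \<phi> (carrier G)) (restrict \<psi> (carrier G))"
    using tmult_cong[OF a, of \<phi> "restrict \<phi> (carrier G)" \<psi> "restrict \<psi> (carrier G)"]
    by (simp add: extensional_restrict) (simp add: tmult_def)
  then have "ev y (tmult a \<phi> \<psi>) = F (tmult a (restrict \<phi> (carrier G)) (restrict \<psi> (carrier G))) y"
    by (simp add: ev_def)
  also have "\<dots> = tmult b (F (restrict \<phi> (carrier G))) (F (restrict \<psi> (carrier G))) y"
    using F by (simp add: hopf_isos_def)
  finally show ?thesis by (simp add: ev_def)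
qed


text \<open>The averaged delta functions sum to 1, so the functional is nonzero on one of them; as
  that one is supported on a single coset, every degree 0 function multiplies it by a constant,
  which must be the value of the functional.\<close>

lemma point_evaluation:
  assumes y: "y \<in> carrier G"
    and mult: "\<And>\<phi> \<psi>. homog 0 \<phi> \<Longrightarrow> homog 0 \<psi> \<Longrightarrow> ev y (\<lambda>x. \<phi> x * \<psi> x) = ev y \<phi> * ev y \<psi>"
  shows "\<exists>w\<in>carrier G. \<forall>\<phi>. homog 0 \<phi> \<longrightarrow> ev y \<phi> = \<phi> w"
proof -
  let ?e = "\<lambda>x. proj (delta_fun G x) 0"
  have "(\<Sum>x\<in>carrier G. ev y (?e x)) = ev y (\<lambda>w. \<Sum>x\<in>carrier G. 1 * ?e x w)"
    using y by (simp add: ev_sum)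
  also have "\<dots> = ev y (\<lambda>w. 1)"
    by (rule ev_cong) (simp only: proj_delta[of _ "\<lambda>x. 1"], simp add: proj_const_one)
  also have "\<dots> = 1" using y by (rule ev_one)
  finally have "(\<Sum>x\<in>carrier G. ev y (?e x)) \<noteq> 0" by simp
  then obtain x where x: "x \<in> carrier G" "ev y (?e x) \<noteq> 0"
    by (auto elim!: sum.not_neutral_contains_not_neutral)
  have "ev y \<phi> = \<phi> x" if \<phi>: "homog 0 \<phi>" for \<phi>
  proof -
    have "\<phi> w * ?e x w = \<phi> x * ?e x w" if w: "w \<in> carrier G" for w
    proof -
      have "\<phi> w * ?e x w = proj (\<lambda>v. \<phi> v * delta_fun G x v) 0 w"
        using proj_mult_homog[OF \<phi> w, of "delta_fun G x" 0] by simp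
      also have "\<dots> = proj (\<lambda>v. \<phi> x * delta_fun G x v) 0 w"
        by (rule proj_cong) (use w in \<open>simp_all add: delta_fun_def\<close>)
      finally show ?thesis by (simp add: proj_scale)
    qed
    then have "ev y (\<lambda>w. \<phi> w * ?e x w) = ev y (\<lambda>w. \<phi> x * ?e x w)" by (rule ev_cong)
    then have "ev y \<phi> * ev y (?e x) = \<phi> x * ev y (?e x)"
      using mult[OF \<phi> homog_proj] y by (simp add: ev_scale)
    then show ?thesis using x by simp
  qed
  then show ?thesis using x by blast
qed

text \<open>The powers of \<open>b\<close> fix \<open>z [^] j\<close>, so at such points the target
  product is the pointwise one.\<close>

lemma ev_tmult_z:
  "ev (z [^] (j::int)) (tmult a \<phi> \<psi>) = ev (z [^] j) \<phi> * ev (z [^] j) \<psi>"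
proof -
  have "ev (z [^] j) (tmult a \<phi> \<psi>) = tmult b (\<lambda>x. ev x \<phi>) (\<lambda>x. ev x \<psi>) (z [^] j)"
    by (simp add: ev_tmult)
  also have "\<dots> = ev (z [^] j) \<phi> * ev (z [^] j) \<psi>"
    using b sum_proj[of "z [^] j" "\<lambda>x. ev x \<phi>"]
    by (simp add: tmult_def auto_int_pow[OF ap_auto] ap_z sum_distrib_right[symmetric])
  finally show ?thesis .
qed

lemma tmult_homog0:
  "homog 0 \<phi> \<Longrightarrow> x \<in> carrier G \<Longrightarrow> tmult a \<phi> \<psi> x = \<phi> x * \<psi> x"
  using tmult_homog[OF a] by simp

text \<open>
  Evaluation at a central element is central in the convolution algebra, so the point of
  \<open>G / T\<close> by which it acts on \<open>T\<close>-invariant functions is central as well, hence trivial.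
\<close>

lemma ev_z_homog0:
  assumes \<phi>: "homog 0 \<phi>"
  shows "ev (z [^] (j::int)) \<phi> = \<phi> \<one>"
proof -
  let ?t = "z [^] j"
  have "ev ?t (\<lambda>x. \<phi> x * \<psi> x) = ev ?t \<phi> * ev ?t \<psi>" if "homog 0 \<phi>" for \<phi> \<psi>
    using ev_tmult_z[of j \<phi> \<psi>] ev_cong[of "tmult a \<phi> \<psi>" "\<lambda>x. \<phi> x * \<psi> x"] tmult_homog0[OF that] by simp
  then obtain w where w: "w \<in> carrier G" "\<And>\<phi>. homog 0 \<phi> \<Longrightarrow> ev ?t \<phi> = \<phi> w"
    using point_evaluation[of ?t] by auto
  have comm: "\<phi> (x \<otimes> w) = \<phi> (w \<otimes> x)" if \<phi>: "homog 0 \<phi>" and x: "x \<in> carrier G" for \<phi> x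
  proof (rule ev_inj[OF _ x, of "\<lambda>x. \<phi> (x \<otimes> w)" "\<lambda>x. \<phi> (w \<otimes> x)"])
    fix y assume y: "y \<in> carrier G"
    have "ev y (\<lambda>x. \<phi> (x \<otimes> w)) = ev y (\<lambda>x. ev ?t (\<lambda>x'. \<phi> (x \<otimes> x')))"
      by (rule ev_cong) (simp add: w(2)[OF homog_ltrans[OF \<phi>]])
    also have "\<dots> = ev (y \<otimes> ?t) \<phi>" using y by (simp add: ev_mult)
    also have "\<dots> = ev (?t \<otimes> y) \<phi>" using y by (simp add: zp_comm)
    also have "\<dots> = ev ?t (\<lambda>x. ev y (\<lambda>x'. \<phi> (x \<otimes> x')))" using y by (simp add: ev_mult)
    \<comment> \<open>Expanding the inner functional in delta functions allows the two evaluations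
      to be interchanged.\<close>
    also have "\<dots> = ev ?t (\<lambda>x. \<Sum>x'\<in>carrier G. ev y (delta_fun G x') * \<phi> (x \<otimes> x'))"
      by (subst ev_expand[OF y]) (simp add: mult.commute)
    also have "\<dots> = (\<Sum>x'\<in>carrier G. ev y (delta_fun G x') * ev ?t (\<lambda>x. \<phi> (x \<otimes> x')))"
      by (simp add: ev_sum ev_scale)
    also have "\<dots> = (\<Sum>x'\<in>carrier G. ev y (delta_fun G x') * \<phi> (w \<otimes> x'))"
    proof (intro sum.cong refl arg_cong2[where f="(*)"])
      fix x' assume x': "x' \<in> carrier G"
      have "homog 0 (\<lambda>x. \<phi> (x \<otimes> x'))" using homogD[OF \<phi>] x' by (simp add: homog_def zp_middle)
      then show "ev ?t (\<lambda>x. \<phi> (x \<otimes> x')) = \<phi> (w \<otimes> x')" by (rule w(2))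
    qed
    also have "\<dots> = ev y (\<lambda>x'. \<phi> (w \<otimes> x'))"
      by (subst ev_expand[OF y, of "\<lambda>x'. \<phi> (w \<otimes> x')"]) (simp add: mult.commute)
    finally show "ev y (\<lambda>x. \<phi> (x \<otimes> w)) = ev y (\<lambda>x'. \<phi> (w \<otimes> x'))" .
  qed
  have "\<exists>k::int. w \<otimes> x = x \<otimes> w \<otimes> z [^] k" if "x \<in> carrier G" for x
    by (rule coset_sep) (use that w(1) in \<open>simp_all add: comm[symmetric]\<close>)
  then obtain k :: int where k: "w = z [^] k" using centreless[OF w(1)] by blast
  have "\<phi> w = \<phi> \<one>" using homogD[OF \<phi> one_closed, of k] by (simp add: k)
  then show ?thesis using w(2)[OF \<phi>] by simp
qed

text \<open>Multiplication by the indicator of the powers of \<open>z\<close>, a degree 0 function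
  with value 1 at the identity, does not change the functional; only values on these powers are
  seen.\<close>

lemma ev_z_cong:
  assumes "\<And>k::int. \<phi> (z [^] k) = \<psi> (z [^] k)"
  shows "ev (z [^] (j::int)) \<phi> = ev (z [^] j) \<psi>"
proof -
  define e :: "'g \<Rightarrow> 'k" where "e x = (if \<exists>j::int. x = \<one> \<otimes> z [^] j then 1 else 0)" for x
  have e: "homog 0 e" unfolding e_def by (rule homog_coset_indicator) simp
  have "\<one> = \<one> \<otimes> z [^] (0::int)" by simp
  then have e1: "e \<one> = 1" unfolding e_def by metis
  have "ev (z [^] j) (tmult a e \<theta>) = ev (z [^] j) \<theta>" for \<theta>
    by (simp add: ev_tmult_z ev_z_homog0[OF e] e1)
  moreover have "ev (z [^] j) (tmult a e \<phi>) = ev (z [^] j) (tmult a e \<psi>)"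
    by (rule ev_cong) (use assms in \<open>auto simp: tmult_homog0[OF e] e_def\<close>)
  ultimately show ?thesis by simp
qed

text \<open>On the powers of \<open>z\<close> the source product is pointwise too, so the functional
  is multiplicative on all functions and hence a point evaluation. Its point is a power of
  \<open>z\<close>, as only values there matter.\<close>

lemma ev_z:
  "\<exists>s::int. \<forall>\<phi>. ev z \<phi> = \<phi> (z [^] s)"
proof -
  have mult: "ev z (\<lambda>x. \<phi> x * \<psi> x) = ev z \<phi> * ev z \<psi>" for \<phi> \<psi>
  proof -
    have "tmult a \<phi> \<psi> (z [^] k) = \<phi> (z [^] k) * \<psi> (z [^] k)" for k :: int
      using a sum_proj[of "z [^] k" \<phi>]
      by (simp add: tmult_def auto_int_pow[OF ap_auto] ap_z sum_distrib_right[symmetric])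
    then show ?thesis
      using ev_z_cong[of "\<lambda>x. \<phi> x * \<psi> x" "tmult a \<phi> \<psi>" 1] ev_tmult_z[of 1 \<phi> \<psi>] by simp
  qed
  have "ev z (\<lambda>x. \<Sum>w\<in>carrier G. 1 * delta_fun G w x) = ev z (\<lambda>x. 1)"
    by (rule ev_cong) (simp only: sum_delta_fun(1)[of _ "\<lambda>x. 1"])
  then have "(\<Sum>w\<in>carrier G. ev z (delta_fun G w)) \<noteq> 0"
    by (simp add: ev_sum ev_one)
  then obtain w where w: "w \<in> carrier G" "ev z (delta_fun G w) \<noteq> 0"
    by (auto elim!: sum.not_neutral_contains_not_neutral)
  have ev: "ev z \<phi> = \<phi> w" for \<phi>
  proof -
    have "ev z \<phi> * ev z (delta_fun G w) = ev z (\<lambda>x. \<phi> x * delta_fun G w x)"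
      by (rule mult[symmetric])
    also have "\<dots> = ev z (\<lambda>x. \<phi> w * delta_fun G w x)"
      by (rule ev_cong) (simp add: delta_fun_def)
    also have "\<dots> = \<phi> w * ev z (delta_fun G w)"
      by (rule ev_scale[OF z_closed])
    finally show ?thesis using w by simp
  qed
  have "\<exists>s::int. w = z [^] s"
  proof (rule ccontr)
    assume "\<nexists>s::int. w = z [^] s"
    then have "delta_fun G w (z [^] k) = (0 :: 'k)" for k :: int
      by (auto simp: delta_fun_def)
    then have "ev z (delta_fun G w) = ev z (\<lambda>x. 0 * 1)"
      using ev_z_cong[of "delta_fun G w" "\<lambda>x. 0 * 1" 1] by simp
    then show False using w ev[of "\<lambda>x. 0 * 1"] by simp
  qed
  then show ?thesis using ev by blast
qed

definition s :: int where "s = (SOME s. \<forall>\<phi>. ev z \<phi> = \<phi> (z [^] s))"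

lemma ev_z_s: "ev z \<phi> = \<phi> (z [^] s)"
  using someI_ex[OF ev_z] unfolding s_def by blast

lemma ev_mult_z: "y \<in> carrier G \<Longrightarrow> ev (y \<otimes> z) \<phi> = ev y (\<lambda>x. \<phi> (x \<otimes> z [^] s))"
  by (simp add: ev_mult ev_z_s)

lemma homog_ev: "homog g \<phi> \<Longrightarrow> homog (s * g) (\<lambda>y. ev y \<phi>)"
proof (rule homogI)
  fix y assume \<phi>: "homog g \<phi>" and y: "y \<in> carrier G"
  have "ev (y \<otimes> z) \<phi> = ev y (\<lambda>x. \<zeta> powi (s * g) * \<phi> x)"
    unfolding ev_mult_z[OF y] by (rule ev_cong) (simp add: homogD[OF \<phi>])
  then show "ev (y \<otimes> z) \<phi> = \<zeta> powi (s * g) * ev y \<phi>" using y by (simp add: ev_scale)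
qed

text \<open>Otherwise every function in the image of \<open>F\<close> would be invariant under
  translation by \<open>z\<close>, against surjectivity.\<close>

lemma coprime_s: "coprime s (int m)"
proof (rule ccontr)
  assume "\<not> coprime s (int m)"
  then have "int m dvd s" using prime_m
    by (metis coprime_commute prime_imp_coprime prime_nat_int_transfer)
  then have "z [^] s = \<one>" by (simp add: zp_one_iff)
  then have inv: "ev (y \<otimes> z) \<phi> = ev y \<phi>" if "y \<in> carrier G" for y \<phi>
    unfolding ev_mult_z[OF that] by (intro ev_cong) simp
  obtain \<phi> where "\<forall>y\<in>carrier G. ev y \<phi> = delta_fun G \<one> y" using ev_surj by blast
  then have "delta_fun G \<one> z = (delta_fun G \<one> \<one> :: 'k)" using inv[of \<one> \<phi>] by simp
  then show False using z_neq_one by (simp add: delta_fun_def)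
qed

section \<open>The induced map modulo the powers of \<open>z\<close>\<close>

lemma ev_homog0_mult:
  assumes \<phi>: "homog 0 \<phi>" and y: "y \<in> carrier G"
  shows "ev y (\<lambda>x. \<phi> x * \<psi> x) = ev y \<phi> * ev y \<psi>"
proof -
  have "ev y (\<lambda>x. \<phi> x * \<psi> x) = ev y (tmult a \<phi> \<psi>)"
    by (rule ev_cong) (simp add: tmult_homog0[OF \<phi>])
  also have "\<dots> = ev y \<phi> * ev y \<psi>"
    using tmult_homog[OF b homog_ev[OF \<phi>] y, of "\<lambda>x. ev x \<psi>"] y by (simp add: ev_tmult)
  finally show ?thesis .
qed

text \<open>Only the coset of this element is determined by \<open>y\<close>, so the map is
  multiplicative merely modulo powers of \<open>z\<close>; a correction follows.\<close>

definition theta0 :: "'g \<Rightarrow> 'g" where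
  "theta0 y = (SOME w. w \<in> carrier G \<and> (\<forall>\<phi>. homog 0 \<phi> \<longrightarrow> ev y \<phi> = \<phi> w))"

lemma theta0:
  assumes "y \<in> carrier G"
  shows "theta0 y \<in> carrier G" "homog 0 \<phi> \<Longrightarrow> ev y \<phi> = \<phi> (theta0 y)"
proof -
  have "\<exists>w. w \<in> carrier G \<and> (\<forall>\<phi>. homog 0 \<phi> \<longrightarrow> ev y \<phi> = \<phi> w)"
    using point_evaluation[OF assms] ev_homog0_mult[OF _ assms] by blast
  from someI_ex[OF this] show "theta0 y \<in> carrier G" "homog 0 \<phi> \<Longrightarrow> ev y \<phi> = \<phi> (theta0 y)"
    unfolding theta0_def by blast+
qed

lemma homog_rtrans:
  assumes "homog g \<phi>" "w \<in> carrier G"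
  shows "homog g (\<lambda>y. \<phi> (y \<otimes> w))"
  using homogD[OF assms(1)] assms(2) by (simp add: homog_def zp_middle)

lemma ev_mult_homog0:
  assumes y: "y \<in> carrier G" "y' \<in> carrier G" and w': "w' \<in> carrier G"
    and ev: "\<And>\<phi>. homog 0 \<phi> \<Longrightarrow> ev y \<phi> = \<phi> w" "\<And>\<phi>. homog 0 \<phi> \<Longrightarrow> ev y' \<phi> = \<phi> w'"
    and \<phi>: "homog 0 \<phi>"
  shows "ev (y \<otimes> y') \<phi> = \<phi> (w \<otimes> w')"
proof -
  have "ev (y \<otimes> y') \<phi> = ev y (\<lambda>x. \<phi> (x \<otimes> w'))"
    unfolding ev_mult[OF y] by (rule ev_cong) (simp add: ev(2)[OF homog_ltrans[OF \<phi>]])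
  then show ?thesis using ev(1)[OF homog_rtrans[OF \<phi> w']] by simp
qed

text \<open>The indicator of a coset missed by \<open>theta0\<close> would be sent to 0 by every
  \<open>ev y\<close>, against injectivity.\<close>

lemma theta0_surj:
  assumes w: "w \<in> carrier G"
  shows "\<exists>y\<in>carrier G. \<exists>j::int. theta0 y = w \<otimes> z [^] j"
proof (rule ccontr)
  assume none: "\<not> (\<exists>y\<in>carrier G. \<exists>j::int. theta0 y = w \<otimes> z [^] j)"
  let ?e = "\<lambda>x. if \<exists>j::int. x = w \<otimes> z [^] j then 1 else 0 :: 'k"
  have e: "homog 0 ?e" using w by (rule homog_coset_indicator)
  have "ev y ?e = ev y (\<lambda>x. 0 * 1)" if y: "y \<in> carrier G" for y
    using none y theta0(2)[OF y e] ev_scale[OF y, of 0 "\<lambda>x. 1"] by auto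
  then have "?e w = 0 * 1" using w by (rule ev_inj)
  moreover have "w = w \<otimes> z [^] (0::int)" using w by simp
  ultimately show False by (metis mult_zero_left zero_neq_one)
qed


text \<open>
  The function \<open>u\<close> trivialises the degree 1 component. The cocycle \<open>u (x x') / (u x u x')\<close> on \<open>G / T\<close>
  describes the central extension \<open>G\<close>, and comparing it with the cocycle of \<open>v = F u\<close> lifts the automorphism
  of \<open>G / T\<close> induced by \<open>F\<close> to \<open>G\<close>.
\<close>

definition u :: "'g \<Rightarrow> 'k" where
  "u = (SOME u. homog 1 u \<and> (\<forall>x\<in>carrier G. u x \<noteq> 0))"

abbreviation v :: "'g \<Rightarrow> 'k" where "v y \<equiv> ev y u"

lemma u: "homog 1 u" "x \<in> carrier G \<Longrightarrow> u x \<noteq> 0"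
  using someI_ex[OF ex_nonvanishing_homog] unfolding u_def by blast+

lemma u_zp: "x \<in> carrier G \<Longrightarrow> u (x \<otimes> z [^] (j::int)) = \<zeta> powi j * u x"
  using homogD[OF u(1)] by simp

lemma homog_v: "homog s v"
  using homog_ev[OF u(1)] by simp

lemma v_nz:
  assumes y: "y \<in> carrier G"
  shows "v y \<noteq> 0"
proof -
  \<comment> \<open>A right inverse of \<open>u\<close> for the twisted product: in degree 1 the
    second factor is evaluated at \<open>ap a (- 1) x\<close>, which cancels
    \<open>a\<close>.\<close>
  let ?w = "\<lambda>x. inverse (u (a x))"
  have "tmult a u ?w x = 1" if x: "x \<in> carrier G" for x
    using tmult_homog[OF a u(1) x, of ?w] u(2)[OF x] ap_neg_apply(1)[OF a x, of 1] a by simp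
  then have "ev y (tmult a u ?w) = ev y (\<lambda>x. 1)" by (rule ev_cong)
  then have "v y * ev (ap b (- s) y) ?w = 1"
    using tmult_homog[OF b homog_v y, of "\<lambda>x. ev x ?w"] y by (simp add: ev_tmult ev_one)
  then show ?thesis by auto
qed

text \<open>The cocycle \<open>c\<close> has degree 0 in each variable, because numerator and
  denominator scale alike. The convolution formula for \<open>ev\<close> can therefore be evaluated
  one variable at a time at \<open>w\<close> and \<open>w'\<close>.\<close>

lemma v_mult:
  assumes y: "y \<in> carrier G" "y' \<in> carrier G" and w: "w \<in> carrier G" "w' \<in> carrier G"
    and ev: "\<And>\<phi>. homog 0 \<phi> \<Longrightarrow> ev y \<phi> = \<phi> w" "\<And>\<phi>. homog 0 \<phi> \<Longrightarrow> ev y' \<phi> = \<phi> w'"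
  shows "v (y \<otimes> y') * (u w * u w') = u (w \<otimes> w') * (v y * v y')"
proof -
  define c where "c x x' = u (x \<otimes> x') / (u x * u x')" for x x'
  have hr: "homog 0 (c x)" if "x \<in> carrier G" for x
    using that zeta_nz by (simp add: homog_def c_def m_assoc[symmetric] u_zp)
  have hl: "homog 0 (\<lambda>x. c x x')" if "x' \<in> carrier G" for x'
    using that zeta_nz by (simp add: homog_def c_def zp_middle u_zp)
  have inner: "ev y' (\<lambda>x'. u (x \<otimes> x')) = v y' * (c x w' * u x)" if x: "x \<in> carrier G" for x
  proof -
    have "ev y' (\<lambda>x'. u (x \<otimes> x')) = ev y' (\<lambda>x'. u x * (c x x' * u x'))"
      by (rule ev_cong) (use u(2) x in \<open>simp add: c_def\<close>)
    also have "\<dots> = u x * (c x w' * v y')"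
      using y by (simp add: ev_scale ev_homog0_mult[OF hr[OF x]] ev(2)[OF hr[OF x]])
    finally show ?thesis by (simp add: ac_simps)
  qed
  have "v (y \<otimes> y') = ev y (\<lambda>x. v y' * (c x w' * u x))"
    unfolding ev_mult[OF y] by (rule ev_cong) (rule inner)
  also have "\<dots> = v y' * (c w w' * v y)"
    using y by (simp add: ev_scale ev_homog0_mult[OF hl[OF w(2)]] ev(1)[OF hl[OF w(2)]])
  finally show ?thesis using u(2) w by (simp add: c_def)
qed

text \<open>
  The quotient of \<open>v y\<close> by the value of \<open>u\<close> at a lift of \<open>y\<close> is a root of unity of order dividing \<open>m r\<close>. Raising it
  to a power \<open>k\<close> with \<open>r dvd k\<close> and \<open>k = 1\<close> modulo \<open>m\<close> removes the \<open>r\<close>-part and leaves the powers of \<open>\<zeta>\<close>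
  unchanged, which singles out one lift.
\<close>

lemma ex_exponent: "\<exists>k. r dvd k \<and> int k mod int m = 1 mod int m"
proof -
  have "coprime (int r) (int m)" using coprime_r by simp
  then obtain x where x: "(int r * x) mod int m = 1 mod int m" using coprime_inverse by blast
  have "int (r * nat (x mod int m)) mod int m = 1 mod int m"
    using x m_pos by (simp add: mod_mult_right_eq)
  then show ?thesis by (intro exI[of _ "r * nat (x mod int m)"]) simp
qed

definition k :: nat where "k = (SOME k. r dvd k \<and> int k mod int m = 1 mod int m)"

lemma k: "r dvd k" "int k mod int m = 1 mod int m"
  using someI_ex[OF ex_exponent] unfolding k_def by blast+

lemma zeta_k: "(\<zeta> powi j) ^ k = \<zeta> powi j"
proof -
  have "(j * int k) mod int m = j mod int m" using k(2) by (metis mod_mult_right_eq mult.right_neutral)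
  then have "\<zeta> powi (j * int k) = \<zeta> powi j" by (simp only: zeta_eq_iff)
  then show ?thesis by (simp add: power_int_mult)
qed

definition lifts :: "'g \<Rightarrow> 'g \<Rightarrow> bool" where
  "lifts y w \<longleftrightarrow> w \<in> carrier G \<and> (\<forall>\<phi>. homog 0 \<phi> \<longrightarrow> ev y \<phi> = \<phi> w) \<and> u w ^ k = v y ^ k"

text \<open>Two candidates differ by some \<open>z [^] j\<close>, which multiplies the k-th power of
  \<open>u\<close> by \<open>\<zeta> powi j\<close> itself, by the choice of
  \<open>k\<close>.\<close>

lemma lifts_unique:
  assumes "lifts y w" "lifts y w'"
  shows "w = w'"
proof -
  have w: "w \<in> carrier G" "w' \<in> carrier G" using assms by (auto simp: lifts_def)
  obtain j :: int where j: "w = w' \<otimes> z [^] j"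
    using coset_sep[OF w] assms unfolding lifts_def by metis
  have "u w ^ k = u w' ^ k" using assms by (simp add: lifts_def)
  then have "\<zeta> powi j * u w' ^ k = u w' ^ k" using w by (simp add: j u_zp power_mult_distrib zeta_k)
  then have "\<zeta> powi j = 1" using u(2)[OF w(2)] by simp
  then have "z [^] j = \<one>" by (simp add: zp_one_iff zeta_one_iff)
  then show ?thesis using w j by simp
qed

lemma lifts_mult:
  assumes y: "y \<in> carrier G" "y' \<in> carrier G" and w: "lifts y w" "lifts y' w'"
  shows "lifts (y \<otimes> y') (w \<otimes> w')"
proof -
  have wc: "w \<in> carrier G" "w' \<in> carrier G" using w by (auto simp: lifts_def)
  have ev: "homog 0 \<phi> \<Longrightarrow> ev y \<phi> = \<phi> w" "homog 0 \<phi> \<Longrightarrow> ev y' \<phi> = \<phi> w'" for \<phi>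
    using w by (auto simp: lifts_def)
  have "ev (y \<otimes> y') \<phi> = \<phi> (w \<otimes> w')" if "homog 0 \<phi>" for \<phi>
    by (rule ev_mult_homog0[OF y wc(2) ev that])
  moreover have "u (w \<otimes> w') ^ k = v (y \<otimes> y') ^ k"
  proof -
    have "(v (y \<otimes> y') * (u w * u w')) ^ k = (u (w \<otimes> w') * (v y * v y')) ^ k"
      using v_mult[OF y wc ev] by simp
    then show ?thesis
      using w v_nz[OF y(1)] v_nz[OF y(2)] by (simp add: power_mult_distrib lifts_def)
  qed
  ultimately show ?thesis using wc by (simp add: lifts_def)
qed

text \<open>The map \<open>theta0\<close> is multiplicative up to powers of \<open>z\<close>, and
  the m-th power removes the resulting powers of \<open>\<zeta>\<close>. What remains is a linear
  character.\<close>

lemma ratio_torsion: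
  assumes y: "y \<in> carrier G"
  shows "((v y / u (theta0 y)) ^ m) ^ r = 1"
proof (rule char_torsion[OF _ _ y])
  fix x y assume xy: "x \<in> carrier G" "y \<in> carrier G"
  have t: "theta0 x \<in> carrier G" "theta0 y \<in> carrier G" "theta0 (x \<otimes> y) \<in> carrier G" using theta0(1) xy by simp_all
  have "\<exists>j::int. theta0 (x \<otimes> y) = (theta0 x \<otimes> theta0 y) \<otimes> z [^] j"
  proof (rule coset_sep)
    fix \<phi> assume \<phi>: "homog 0 \<phi>"
    show "\<phi> (theta0 (x \<otimes> y)) = \<phi> (theta0 x \<otimes> theta0 y)"
      using ev_mult_homog0[OF xy t(2) theta0(2)[OF xy(1)] theta0(2)[OF xy(2)] \<phi>]
          theta0(2)[OF _ \<phi>, of "x \<otimes> y"] xy by simp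
  qed (use t in simp_all)
  then obtain j :: int where "theta0 (x \<otimes> y) = (theta0 x \<otimes> theta0 y) \<otimes> z [^] j" by blast
  then have "u (theta0 (x \<otimes> y)) ^ m = (\<zeta> powi j) ^ m * u (theta0 x \<otimes> theta0 y) ^ m"
    using t by (simp add: u_zp power_mult_distrib)
  also have "(\<zeta> powi j) ^ m = \<zeta> powi (j * int m)" by (simp add: power_int_mult)
  also have "\<dots> = 1" by (simp add: zeta_one_iff)
  finally have 1: "u (theta0 (x \<otimes> y)) ^ m = u (theta0 x \<otimes> theta0 y) ^ m" by simp
  have "(v (x \<otimes> y) * (u (theta0 x) * u (theta0 y))) ^ m = (u (theta0 x \<otimes> theta0 y) * (v x * v y)) ^ m"
    using v_mult[OF xy t(1,2)] theta0(2) xy by simp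
  then show "(v (x \<otimes> y) / u (theta0 (x \<otimes> y))) ^ m = (v x / u (theta0 x)) ^ m * (v y / u (theta0 y)) ^ m"
    using 1 u(2)[OF t(1)] u(2)[OF t(2)] u(2)[of "theta0 x \<otimes> theta0 y"] t
    by (simp add: power_divide power_mult_distrib field_simps)
next
  fix x assume "x \<in> carrier G"
  then show "(v x / u (theta0 x)) ^ m \<noteq> 0" using v_nz u(2) theta0(1) by simp
qed

lemma ex_lifts:
  assumes y: "y \<in> carrier G"
  shows "\<exists>w. lifts y w"
proof -
  let ?q = "v y / u (theta0 y)"
  have t: "theta0 y \<in> carrier G" by (rule theta0(1)[OF y])
  obtain k' where k': "k = r * k'" using k(1) by blast
  have "(?q ^ k) ^ m = ((?q ^ m) ^ r) ^ k'" by (simp only: k' power_mult[symmetric] ac_simps)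
  then have "(?q ^ k) ^ m = 1" using ratio_torsion[OF y] by simp
  \<comment> \<open>The defect of \<open>theta0 y\<close> is a power of \<open>\<zeta>\<close>,
    which is removed by multiplying with the same power of \<open>z\<close>.\<close>
  then obtain j where j: "?q ^ k = \<zeta> powi j"
    using root_of_unity_eq_power[OF prime_m zeta_pow_m zeta_neq_one] by (metis power_int_of_nat)
  let ?w = "theta0 y \<otimes> z [^] j"
  have "ev y \<phi> = \<phi> ?w" if "homog 0 \<phi>" for \<phi>
    using homogD[OF that t] theta0(2)[OF y that] by simp
  moreover have "u ?w ^ k = v y ^ k"
    using j u(2)[OF t] t by (simp add: u_zp power_mult_distrib zeta_k power_divide field_simps)
  ultimately show ?thesis
    unfolding lifts_def using t by (intro exI[of _ ?w] conjI allI impI) simp_all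
qed

definition theta :: "'g \<Rightarrow> 'g" where "theta = (\<lambda>y\<in>carrier G. SOME w. lifts y w)"

lemma lifts_theta: "y \<in> carrier G \<Longrightarrow> lifts y (theta y)"
  using someI_ex[OF ex_lifts] by (simp add: theta_def)

lemma theta_closed: "y \<in> carrier G \<Longrightarrow> theta y \<in> carrier G"
  using lifts_theta by (simp add: lifts_def)

lemma ev_theta: "y \<in> carrier G \<Longrightarrow> homog 0 \<phi> \<Longrightarrow> ev y \<phi> = \<phi> (theta y)"
  using lifts_theta by (simp add: lifts_def)

lemma theta_hom: "theta \<in> hom G G"
proof (rule homI)
  fix x y assume xy: "x \<in> carrier G" "y \<in> carrier G"
  show "theta (x \<otimes> y) = theta x \<otimes> theta y"
    by (rule lifts_unique[OF lifts_theta lifts_mult]) (use xy lifts_theta in simp_all)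
qed (rule theta_closed)

lemma theta_z: "theta z = z [^] s"
  by (rule lifts_unique[OF lifts_theta]) (simp_all add: lifts_def ev_z_s)

lemma theta_zp: "theta (z [^] (j::int)) = z [^] (s * j)"
  by (simp add: hom_int_pow[OF theta_hom _ is_group is_group] theta_z int_pow_pow)

lemma theta_auto: "theta \<in> auto G"
proof (rule autoI[OF theta_hom])
  have "w \<in> theta ` carrier G" if w: "w \<in> carrier G" for w
  proof -
    obtain y and i :: int where y: "y \<in> carrier G" "theta0 y = w \<otimes> z [^] i" using theta0_surj[OF w] by blast
    have "\<exists>j::int. theta y = theta0 y \<otimes> z [^] j"
    proof (rule coset_sep)
      fix \<phi> assume "homog 0 \<phi>"
      then show "\<phi> (theta y) = \<phi> (theta0 y)" using ev_theta theta0(2) y(1) by metis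
    qed (use y(1) theta_closed[OF y(1)] theta0(1)[OF y(1)] in simp_all)
    then obtain j :: int where j: "theta y = theta0 y \<otimes> z [^] j" by blast
    obtain s' where s': "(s * s') mod int m = 1 mod int m" using coprime_inverse[OF coprime_s] by blast
    \<comment> \<open>\<open>theta y\<close> differs from \<open>w\<close> by
      \<open>z [^] (i + j)\<close>; as \<open>theta\<close> raises \<open>z\<close> to the power
      \<open>s\<close>, the exponent is divided by \<open>s\<close> modulo \<open>m\<close>.\<close>
    let ?y = "y \<otimes> z [^] (- (s' * (i + j)))"
    have "theta ?y = w \<otimes> z [^] i \<otimes> z [^] j \<otimes> z [^] (s * - (s' * (i + j)))"
      using y j by (simp add: hom_mult[OF theta_hom] theta_zp)
    also have "\<dots> = w \<otimes> z [^] (i + j + s * - (s' * (i + j)))"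
      using w by (simp add: m_assoc int_pow_mult[symmetric] add.assoc)
    also have "z [^] (i + j + s * - (s' * (i + j))) = z [^] (0::int)"
    proof -
      have "int m dvd s * s' - 1" using s' by (simp only: mod_eq_dvd_iff)
      then have "int m dvd (s * s' - 1) * (- (i + j))" by (rule dvd_mult2)
      moreover have "i + j + s * - (s' * (i + j)) = (s * s' - 1) * (- (i + j))"
        by (simp add: algebra_simps)
      ultimately have "int m dvd i + j + s * - (s' * (i + j))" by (simp only:)
      then show ?thesis by (simp only: zp_one_iff int_pow_0)
    qed
    finally have "theta ?y = w" using w by simp
    then show ?thesis using y(1) by (intro image_eqI[of _ _ ?y]) simp_all
  qed
  then have surj: "theta ` carrier G = carrier G" using theta_closed by auto
  then show "bij_betw theta (carrier G) (carrier G)"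
    using finite_G by (simp add: bij_betw_def eq_card_imp_inj_on)
qed (simp add: theta_def)

text \<open>In the source, moving a degree 0 function past \<open>u\<close> composes it with a power
  of \<open>a\<close>. Applying \<open>F\<close> gives the same with \<open>v\<close>, of degree
  \<open>s\<close>, and \<open>ap b s\<close>. This yields equality modulo powers of
  \<open>z\<close>, which \<open>hom_eq_of_cong\<close> upgrades.\<close>

lemma theta_conj:
  assumes y: "y \<in> carrier G"
  shows "a (theta y) = theta (ap b s y)"
proof (rule hom_eq_of_cong[OF _ _ _ _ y, where A="\<lambda>y. theta (ap b s y)" and B="\<lambda>y. a (theta y)"])
  fix y assume y: "y \<in> carrier G"
  show "theta (ap b s y) \<in> carrier G" using b y by (simp add: theta_closed)
  let ?y = "ap b s y"
  have yc: "?y \<in> carrier G" using b y by simp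
  have "\<exists>j::int. theta y = ap a (- 1) (theta ?y) \<otimes> z [^] j"
  proof (rule coset_sep)
    fix \<phi> assume \<phi>: "homog 0 \<phi>"
    let ?\<psi> = "\<lambda>x. \<phi> (ap a (- 1) x)"
    have \<psi>: "homog 0 ?\<psi>" using homogD[OF \<phi>] a by (simp add: homog_def ap_zp)
    have "tmult a u \<phi> x = tmult a ?\<psi> u x" if x: "x \<in> carrier G" for x
      using tmult_homog[OF a u(1) x] tmult_homog0[OF \<psi> x] by (simp add: mult.commute)
    then have "ev ?y (tmult a u \<phi>) = ev ?y (tmult a ?\<psi> u)" by (rule ev_cong)
    then have "v ?y * ev (ap b (- s) ?y) \<phi> = ev ?y ?\<psi> * v ?y"
      using tmult_homog[OF b homog_v yc, of "\<lambda>x. ev x \<phi>"]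
        tmult_homog[OF b homog_ev[OF \<psi>] yc, of v] yc by (simp add: ev_tmult)
    then have "ev y \<phi> = ev ?y ?\<psi>" using v_nz[OF yc] b y by simp
    then show "\<phi> (theta y) = \<phi> (ap a (- 1) (theta ?y))"
      using ev_theta[OF y \<phi>] ev_theta[OF yc \<psi>] by simp
  qed (use a y yc theta_closed in simp_all)
  then obtain j :: int where j: "theta y = ap a (- 1) (theta ?y) \<otimes> z [^] j" by blast
  have "a (theta y) = ap a 1 (ap a (- 1) (theta ?y) \<otimes> z [^] j)" using a j by simp
  also have "\<dots> = theta ?y \<otimes> z [^] j"
    using ap_zp[OF a, of "ap a (- 1) (theta ?y)" 1 j] ap_neg_apply(1)[OF a theta_closed[OF yc], of 1] a theta_closed[OF yc]
    by (simp del: ap_1)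
  finally show "\<exists>j::int. a (theta y) = theta ?y \<otimes> z [^] j" by blast
qed (use a b theta_closed in \<open>simp_all add: ap_mult hom_mult[OF theta_hom] auto_mult[OF torsion_auts_auto]\<close>)

end

context centreless_twist
begin

theorem hopf_isos_twist_iff:
  assumes a: "a \<in> torsion_auts" and b: "b \<in> torsion_auts"
  shows "hopf_isos (twist a) (twist b) \<noteq> {} \<longleftrightarrow>
    (\<exists>f\<in>auto G. \<exists>l. coprime l (int m) \<and> f z = z [^] l \<and> (\<forall>x\<in>carrier G. a (f x) = f (ap b l x)))"
proof
  assume "hopf_isos (twist a) (twist b) \<noteq> {}"
  then obtain F where "F \<in> hopf_isos (twist a) (twist b)" by blast
  then interpret twist_iso G m z \<zeta> r a b F by unfold_locales (use a b in auto)
  show "\<exists>f\<in>auto G. \<exists>l. coprime l (int m) \<and> f z = z [^] l \<and> (\<forall>x\<in>carrier G. a (f x) = f (ap b l x))"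
    using theta_auto coprime_s theta_z theta_conj by blast
next
  assume "\<exists>f\<in>auto G. \<exists>l. coprime l (int m) \<and> f z = z [^] l \<and> (\<forall>x\<in>carrier G. a (f x) = f (ap b l x))"
  then show "hopf_isos (twist a) (twist b) \<noteq> {}" using hopf_iso_of_auto[OF a b] by blast
qed

end

section \<open>Classes of automorphisms\<close>

text \<open>A class on the left is sent to the saturation of its preimage. \<open>\<Phi>\<close> may
  identify elements of \<open>Y\<close>: the equivalence in \<open>iff\<close> places its fibres
  inside single classes of \<open>R\<close>.\<close>

lemma bij_betw_quotients:
  assumes R: "equiv X R" and Y: "Y \<subseteq> X" and S: "S = \<Phi> ` Y" and r: "r \<subseteq> S \<times> S"
    and iff: "\<And>a b. \<lbrakk>a \<in> Y; b \<in> Y\<rbrakk> \<Longrightarrow> (\<Phi> a, \<Phi> b) \<in> r \<longleftrightarrow> (a, b) \<in> R"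
  shows "\<exists>F. bij_betw F (S // r) {E \<in> X // R. \<exists>a\<in>E. a \<in> Y}"
proof -
  have sym: "(a, b) \<in> R \<Longrightarrow> (b, a) \<in> R" and trans: "(a, b) \<in> R \<Longrightarrow> (b, c) \<in> R \<Longrightarrow> (a, c) \<in> R" for a b c
    using R by (auto simp: equiv_def dest: symD transD)
  have refl: "a \<in> Y \<Longrightarrow> (a, a) \<in> R" for a
    using R Y by (auto simp: equiv_def refl_on_def)
  let ?F = "\<lambda>c. R `` {a \<in> Y. \<Phi> a \<in> c}"
  have F: "?F (r `` {\<Phi> a}) = R `` {a}" if a: "a \<in> Y" for a
  proof -
    have "{b \<in> Y. \<Phi> b \<in> r `` {\<Phi> a}} = {b \<in> Y. (a, b) \<in> R}" using iff a by auto
    moreover have "R `` {b \<in> Y. (a, b) \<in> R} = R `` {a}" using refl[OF a] a trans by blast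
    ultimately show ?thesis by simp
  qed
  have cls: "r `` {\<Phi> a} = r `` {\<Phi> b}" if "a \<in> Y" "b \<in> Y" "(a, b) \<in> R" for a b
  proof -
    have "r `` {\<Phi> c} = \<Phi> ` {d \<in> Y. (c, d) \<in> R}" if "c \<in> Y" for c
    proof (intro equalityI subsetI)
      fix w assume "w \<in> r `` {\<Phi> c}"
      then have w: "(\<Phi> c, w) \<in> r" by simp
      then have "w \<in> S" using r by blast
      then obtain d where "d \<in> Y" "w = \<Phi> d" using S by blast
      then show "w \<in> \<Phi> ` {d \<in> Y. (c, d) \<in> R}" using w iff[OF that] by simp
    next
      fix w assume "w \<in> \<Phi> ` {d \<in> Y. (c, d) \<in> R}"
      then show "w \<in> r `` {\<Phi> c}" using iff[OF that] by auto
    qed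
    moreover have "{d \<in> Y. (a, d) \<in> R} = {d \<in> Y. (b, d) \<in> R}"
      using that(3) sym trans by blast
    ultimately show ?thesis using that by simp
  qed
  have "bij_betw ?F (S // r) {E \<in> X // R. \<exists>a\<in>E. a \<in> Y}"
    unfolding bij_betw_def
  proof (intro conjI)
    show "inj_on ?F (S // r)"
    proof (rule inj_onI)
      fix c d assume "c \<in> S // r" "d \<in> S // r" and eq: "?F c = ?F d"
      then obtain a b where ab: "a \<in> Y" "b \<in> Y" "c = r `` {\<Phi> a}" "d = r `` {\<Phi> b}"
        by (auto simp: S quotient_def)
      then have "R `` {a} = R `` {b}" using eq F by simp
      then have "(a, b) \<in> R" using refl[OF ab(2)] by blast
      then show "c = d" using cls ab by simp
    qed
    show "?F ` (S // r) = {E \<in> X // R. \<exists>a\<in>E. a \<in> Y}"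
    proof (intro equalityI subsetI)
      fix E assume "E \<in> ?F ` (S // r)"
      then obtain a where a: "a \<in> Y" "E = R `` {a}" using F by (auto simp: S quotient_def)
      then show "E \<in> {E \<in> X // R. \<exists>a\<in>E. a \<in> Y}" using Y refl by (auto intro: quotientI)
    next
      fix E assume "E \<in> {E \<in> X // R. \<exists>a\<in>E. a \<in> Y}"
      then obtain a x where "a \<in> Y" "a \<in> E" "E = R `` {x}" by (auto simp: quotient_def)
      then have "E = R `` {a}" "a \<in> Y" using sym trans by blast+
      then have "E = ?F (r `` {\<Phi> a})" "r `` {\<Phi> a} \<in> S // r"
        using F by (simp_all add: S quotientI)
      then show "E \<in> ?F ` (S // r)" by blast
    qed
  qed
  then show ?thesis by blast
qed

section \<open>The set and relation defining \<open>X_set\<close>, expressed through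
  \<open>z\<close>\<close>

context central_twist
begin

abbreviation T where "T \<equiv> range (\<lambda>j::int. z [^] j)"

lemma card_T: "card T = m"
proof -
  have "T = (\<lambda>j::int. z [^] j) ` I"
  proof (intro equalityI subsetI)
    fix t assume "t \<in> T"
    then obtain j :: int where "t = z [^] (j mod int m)" by auto
    then show "t \<in> (\<lambda>j::int. z [^] j) ` I" using m_pos by (intro image_eqI[of _ _ "j mod int m"]) auto
  qed auto
  moreover have "inj_on (\<lambda>j::int. z [^] j) I"
    by (rule inj_onI) (simp add: zp_eq_iff)
  ultimately show ?thesis by (simp add: card_image)
qed

lemma subgroup_T: "subgroup T G"
proof
  fix x y assume "x \<in> T" "y \<in> T"
  then obtain i j :: int where ij: "x = z [^] i" "y = z [^] j" by auto
  have "x \<otimes> y = z [^] (i + j)" by (simp add: ij int_pow_mult)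
  then show "x \<otimes> y \<in> T" by blast
  have "inv x = z [^] (- i)" by (simp add: ij int_pow_neg)
  then show "inv x \<in> T" by blast
next
  have "\<one> = z [^] (0::int)" by simp
  then show "\<one> \<in> T" by blast
qed auto

lemma central_subgroup_eq:
  assumes center: "group_center G = T"
  shows "central_subgroup m G = T"
  unfolding central_subgroup_def center
proof (rule the_equality)
  have "group (G\<lparr>carrier := T\<rparr>)" by (rule subgroup.subgroup_is_group[OF subgroup_T is_group])
  then show "subgroup T (G\<lparr>carrier := T\<rparr>) \<and> card T = m"
    using group.subgroup_self[of "G\<lparr>carrier := T\<rparr>"] card_T by simp
  fix T' assume T': "subgroup T' (G\<lparr>carrier := T\<rparr>) \<and> card T' = m"
  then have "T' \<subseteq> T" using subgroup.subset by fastforce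
  moreover have "finite T" using card_T m_pos by (metis card.infinite less_irrefl)
  ultimately show "T' = T" using card_T T' by (intro card_subset_eq) simp_all
qed

lemma X_base_eq:
  assumes "group_center G = T"
  shows "X_base m G = torsion_auts"
proof -
  have "(\<forall>t\<in>T. f t = t) \<longleftrightarrow> f z = z" if f: "f \<in> auto G" for f
  proof
    assume "\<forall>t\<in>T. f t = t"
    then have "f (z [^] (1::int)) = z [^] (1::int)" by blast
    then show "f z = z" by simp
  qed (auto simp: auto_int_pow[OF f])
  then show ?thesis
    by (auto simp: X_base_def aut_fixing_def torsion_auts_def central_subgroup_eq[OF assms])
qed

text \<open>The relation of \<open>X_rel\<close> with the inverse of \<open>f\<close> cleared and
  the condition on \<open>T\<close> tested on its generator, in the form met by Hopf
  isomorphisms.\<close>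

definition twisted_conj :: "('g \<Rightarrow> 'g) \<Rightarrow> ('g \<Rightarrow> 'g) \<Rightarrow> ('g \<Rightarrow> 'g) \<Rightarrow> int \<Rightarrow> bool" where
  "twisted_conj a b f l \<longleftrightarrow> f \<in> auto G \<and> coprime l (int m) \<and> f z = z [^] l \<and>
     (\<forall>x\<in>carrier G. a (f x) = f (ap b l x))"

text \<open>The inverse of \<open>f\<close> raises \<open>z\<close> to the inverse \<open>l'\<close>
  of \<open>l\<close> modulo \<open>m\<close>; iterating the relation \<open>l'\<close> times turns
  the power of \<open>b\<close> into \<open>b\<close> itself.\<close>

lemma twisted_conj_inv:
  assumes a: "a \<in> torsion_auts" and b: "b \<in> torsion_auts" and c: "twisted_conj a b f l"
  shows "\<exists>l'. twisted_conj b a (inv\<^bsub>AutoGroup G\<^esub> f) l'"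
proof -
  let ?i = "inv\<^bsub>AutoGroup G\<^esub> f"
  have f: "f \<in> auto G" and l: "coprime l (int m)" and fz: "f z = z [^] l"
    and conj: "\<And>x. x \<in> carrier G \<Longrightarrow> a (f x) = f (ap b l x)" using c by (auto simp: twisted_conj_def)
  have i: "?i \<in> auto G" using AG.inv_closed[of f] f by simp
  obtain l' where l': "(l * l') mod int m = 1 mod int m" "coprime l' (int m)"
    using coprime_inverse[OF l] by blast
  have "z [^] (l * l') = z [^] (1::int)" using l'(1) by (simp only: zp_eq_iff)
  then have "?i z = ?i (f z) [^] l'"
    using auto_int_pow[OF i, of "z [^] l" l'] by (simp add: fz int_pow_pow)
  then have "?i z = z [^] l'" by (simp add: inv_AutoGroup_apply[OF f])
  moreover have "b (?i x) = ?i (ap a l' x)" if x: "x \<in> carrier G" for x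
  proof -
    let ?y = "?i x"
    have y: "?y \<in> carrier G" "f ?y = x" using auto_closed[OF i x] inv_AutoGroup_apply(1)[OF f x] by simp_all
    have "ap a l' x = f (ap b (l * l') ?y)" using ap_conj[OF a b f y(1) conj, of l'] y(2) by simp
    also have "\<dots> = f (b ?y)" using ap_eq[OF b l'(1)] b by simp
    finally show ?thesis
      using inv_AutoGroup_apply(2)[OF f auto_closed[OF torsion_auts_auto[OF b] y(1)]] by simp
  qed
  ultimately have "twisted_conj b a ?i l'" using i l'(2) by (simp add: twisted_conj_def)
  then show ?thesis by blast
qed

lemma twisted_conj_comp:
  assumes b: "b \<in> torsion_auts" and c: "c \<in> torsion_auts"
    and f: "twisted_conj a b f l" and g: "twisted_conj b c g l'"
  shows "twisted_conj a c (f \<otimes>\<^bsub>AutoGroup G\<^esub> g) (l' * l)"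
proof -
  have fa: "f \<in> auto G" and ga: "g \<in> auto G" using f g by (auto simp: twisted_conj_def)
  have fg: "f \<otimes>\<^bsub>AutoGroup G\<^esub> g \<in> auto G" using AG.m_closed[of f g] fa ga by simp
  have "(f \<otimes>\<^bsub>AutoGroup G\<^esub> g) z = f (g z)" by (rule mult_AutoGroup_apply[OF fa ga z_closed])
  also have "\<dots> = z [^] (l' * l)"
    using f g by (simp add: twisted_conj_def auto_int_pow[OF fa] int_pow_pow mult.commute)
  finally have "(f \<otimes>\<^bsub>AutoGroup G\<^esub> g) z = z [^] (l' * l)" .
  moreover have "a ((f \<otimes>\<^bsub>AutoGroup G\<^esub> g) x) = (f \<otimes>\<^bsub>AutoGroup G\<^esub> g) (ap c (l' * l) x)"
    if x: "x \<in> carrier G" for x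
  proof -
    have "a (f (g x)) = f (ap b l (g x))" using f auto_closed[OF ga x] by (simp add: twisted_conj_def)
    also have "ap b l (g x) = g (ap c (l' * l) x)"
      by (rule ap_conj[OF b c ga x]) (use g in \<open>simp add: twisted_conj_def\<close>)
    finally show ?thesis using x c by (simp add: mult_AutoGroup_apply[OF fa ga])
  qed
  ultimately show ?thesis using fg f g by (simp add: twisted_conj_def)
qed

lemma X_rel_eq:
  assumes center: "group_center G = T"
  shows "X_rel m G = {(a, b). a \<in> torsion_auts \<and> b \<in> torsion_auts \<and> (\<exists>f l. twisted_conj a b f l)}"
proof -
  have key: "(\<exists>f\<in>aut_preserving G T. \<exists>l::int. coprime l (int m) \<and>
        inv\<^bsub>AutoGroup G\<^esub> f \<otimes>\<^bsub>AutoGroup G\<^esub> a \<otimes>\<^bsub>AutoGroup G\<^esub> f = ap b l \<and> (\<forall>t\<in>T. f t = t [^] l))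
     \<longleftrightarrow> (\<exists>f l. twisted_conj a b f l)" (is "?L \<longleftrightarrow> ?R") if a: "a \<in> torsion_auts" and b: "b \<in> torsion_auts" for a b
  proof -
    have aa: "a \<in> auto G" by (rule torsion_auts_auto[OF a])
    have conj: "(inv\<^bsub>AutoGroup G\<^esub> f \<otimes>\<^bsub>AutoGroup G\<^esub> a \<otimes>\<^bsub>AutoGroup G\<^esub> f) x
        = (inv\<^bsub>AutoGroup G\<^esub> f) (a (f x))" if f: "f \<in> auto G" and x: "x \<in> carrier G" for f x
    proof -
      have i: "inv\<^bsub>AutoGroup G\<^esub> f \<in> auto G" using AG.inv_closed[of f] f by simp
      then have "inv\<^bsub>AutoGroup G\<^esub> f \<otimes>\<^bsub>AutoGroup G\<^esub> a \<in> auto G" using AG.m_closed[of _ a] aa by simp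
      then show ?thesis using mult_AutoGroup_apply f x i aa auto_closed by metis
    qed
    have cl: "inv\<^bsub>AutoGroup G\<^esub> f \<otimes>\<^bsub>AutoGroup G\<^esub> a \<otimes>\<^bsub>AutoGroup G\<^esub> f \<in> auto G" if "f \<in> auto G" for f
      using AG.m_closed AG.inv_closed aa that by simp
    show ?thesis
    proof
      assume ?L
      then obtain f and l :: int where f: "f \<in> auto G" and l: "coprime l (int m)"
        and eq: "inv\<^bsub>AutoGroup G\<^esub> f \<otimes>\<^bsub>AutoGroup G\<^esub> a \<otimes>\<^bsub>AutoGroup G\<^esub> f = ap b l"
        and T: "\<forall>t\<in>T. f t = t [^] l" by (auto simp: aut_preserving_def)
      have "z = z [^] (1::int)" by simp
      then have fz: "f z = z [^] l" using T by blast
      have "a (f x) = f (ap b l x)" if x: "x \<in> carrier G" for x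
        using conj[OF f x] inv_AutoGroup_apply(1)[OF f, of "a (f x)"] auto_closed[OF aa auto_closed[OF f x]]
        by (simp add: eq)
      then show ?R using f l fz by (auto simp: twisted_conj_def)
    next
      assume ?R
      then obtain f l where c: "twisted_conj a b f l" by blast
      then have f: "f \<in> auto G" and l: "coprime l (int m)" and fz: "f z = z [^] l"
        and fx: "\<And>x. x \<in> carrier G \<Longrightarrow> a (f x) = f (ap b l x)" by (auto simp: twisted_conj_def)
      have T: "\<forall>t\<in>T. f t = t [^] l"
        by (auto simp: auto_int_pow[OF f] fz int_pow_pow mult.commute)
      \<comment> \<open>\<open>f\<close> maps the finite set \<open>T\<close> injectively into
        itself.\<close>
      have "f ` T = T"
      proof (rule card_subset_eq)
        show fin: "finite T" using card_T m_pos by (metis card.infinite less_irrefl)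
        show "f ` T \<subseteq> T" by (auto simp: auto_int_pow[OF f] fz int_pow_pow)
        have "inj_on f T"
          by (rule inj_on_subset[of _ "carrier G"]) (use auto_bij[OF f] in \<open>auto simp: bij_betw_def\<close>)
        then show "card (f ` T) = card T" by (rule card_image)
      qed
      moreover have "inv\<^bsub>AutoGroup G\<^esub> f \<otimes>\<^bsub>AutoGroup G\<^esub> a \<otimes>\<^bsub>AutoGroup G\<^esub> f = ap b l"
        by (rule auto_eqI[OF cl[OF f] ap_auto[OF b]])
           (simp add: conj[OF f] fx inv_AutoGroup_apply(2)[OF f] b)
      moreover have "f \<in> aut_preserving G T" using f calculation(1) by (simp add: aut_preserving_def)
      ultimately show ?L using l T by blast
    qed
  qed
  show ?thesis
    unfolding X_rel_def X_base_eq[OF center] central_subgroup_eq[OF center]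
    by (simp only: key cong: conj_cong)
qed

lemma equiv_X_rel:
  assumes center: "group_center G = T"
  shows "equiv torsion_auts (X_rel m G)"
proof (rule equivI)
  show "X_rel m G \<subseteq> torsion_auts \<times> torsion_auts" by (auto simp: X_rel_eq[OF center])
  show "refl_on torsion_auts (X_rel m G)"
  proof (rule refl_onI)
    fix a assume a: "a \<in> torsion_auts"
    have "\<one>\<^bsub>AutoGroup G\<^esub> \<in> auto G" using AG.one_closed by simp
    then have "twisted_conj a a \<one>\<^bsub>AutoGroup G\<^esub> 1"
      using a auto_closed[OF torsion_auts_auto[OF a]] by (simp add: twisted_conj_def)
    then show "(a, a) \<in> X_rel m G" using a by (auto simp: X_rel_eq[OF center])
  qed
  show "sym (X_rel m G)"
    using twisted_conj_inv by (fastforce simp: X_rel_eq[OF center] intro!: symI)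
  show "trans (X_rel m G)"
    using twisted_conj_comp by (fastforce simp: X_rel_eq[OF center] intro!: transI)
qed

text \<open>As \<open>a\<close> fixes \<open>T\<close> pointwise, it carries the coset of
  \<open>x\<close> onto that of \<open>a x\<close>.\<close>

lemma induces_id_mod_iff:
  assumes a: "a \<in> torsion_auts"
  shows "induces_id_mod G T a \<longleftrightarrow> (\<forall>x\<in>carrier G. \<exists>j::int. a x = x \<otimes> z [^] j)"
proof -
  have aa: "a \<in> auto G" by (rule torsion_auts_auto[OF a])
  have coset: "T #> x = range (\<lambda>j::int. x \<otimes> z [^] j)" if "x \<in> carrier G" for x
    using zp_comm[OF that] by (auto simp: r_coset_def)
  have img: "a ` (T #> x) = T #> a x" if x: "x \<in> carrier G" for x
  proof -
    have "a (x \<otimes> z [^] j) = a x \<otimes> z [^] j" for j :: int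
      using ap_zp[OF a x, of 1 j] a by simp
    then show ?thesis by (simp add: coset x auto_closed[OF aa x] image_image)
  qed
  have "T #> a x = T #> x \<longleftrightarrow> (\<exists>j::int. a x = x \<otimes> z [^] j)" if x: "x \<in> carrier G" for x
  proof
    assume "T #> a x = T #> x"
    moreover have "a x = a x \<otimes> z [^] (0::int)" using auto_closed[OF aa x] by simp
    then have "a x \<in> T #> a x" unfolding coset[OF auto_closed[OF aa x]] by blast
    ultimately show "\<exists>j::int. a x = x \<otimes> z [^] j" using coset[OF x] by auto
  next
    assume "\<exists>j::int. a x = x \<otimes> z [^] j"
    then have "a x \<in> T #> x" using coset[OF x] by auto
    then show "T #> a x = T #> x" using repr_independence[OF _ x subgroup_T] by simp
  qed
  then show ?thesis
    by (simp add: induces_id_mod_def FactGroup_def RCOSETS_def img)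
qed

end

context centreless_twist
begin

theorem graded_twisting_classes_bij:
  assumes center: "group_center G = range (\<lambda>j::int. z [^] j)"
  shows "\<exists>F. bij_betw F
    (noncomm_graded_twisting_classes G \<Gamma> :: ('k, 'g \<Rightarrow> 'k) hopf set set) (X_bullet m G)"
proof -
  let ?Y = "{a \<in> torsion_auts. noncommutative (twist a)}"
  let ?S = "noncomm_graded_twistings G \<Gamma> :: ('k, 'g \<Rightarrow> 'k) hopf set"
  have S: "?S = twist ` ?Y" by (rule noncomm_graded_twistings_eq[OF center])
  have "\<exists>F. bij_betw F (?S // hopf_iso_rel ?S) {E \<in> torsion_auts // X_rel m G. \<exists>a\<in>E. a \<in> ?Y}"
  proof (rule bij_betw_quotients[OF equiv_X_rel[OF center] _ S])
    show "hopf_iso_rel ?S \<subseteq> ?S \<times> ?S" by (auto simp: hopf_iso_rel_def)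
    fix a b assume ab: "a \<in> ?Y" "b \<in> ?Y"
    have "(twist a, twist b) \<in> hopf_iso_rel ?S \<longleftrightarrow> hopf_isos (twist a) (twist b) \<noteq> {}"
      using ab S unfolding hopf_iso_rel_def by blast
    also have "\<dots> \<longleftrightarrow> (\<exists>f l. twisted_conj a b f l)"
      using ab hopf_isos_twist_iff[of a b] by (auto simp: twisted_conj_def)
    also have "\<dots> \<longleftrightarrow> (a, b) \<in> X_rel m G"
      using ab by (simp add: X_rel_eq[OF center])
    finally show "(twist a, twist b) \<in> hopf_iso_rel ?S \<longleftrightarrow> (a, b) \<in> X_rel m G" .
  qed auto
  moreover have "{E \<in> torsion_auts // X_rel m G. \<exists>a\<in>E. a \<in> ?Y} = X_bullet m G"
  proof -
    \<comment> \<open>Noncommutativity of the twisting is the condition that singles out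
      \<open>X_bullet\<close>.\<close>
    have "a \<in> ?Y \<longleftrightarrow> \<not> induces_id_mod G T a" if "a \<in> E" "E \<in> torsion_auts // X_rel m G" for a E
    proof -
      have "a \<in> torsion_auts" using that equiv_X_rel[OF center] by (meson in_quotient_imp_subset subsetD)
      then show ?thesis using noncommutative_twist_iff induces_id_mod_iff by simp
    qed
    then show ?thesis
      unfolding X_bullet_def X_set_def X_base_eq[OF center] central_subgroup_eq[OF center] by blast
  qed
  ultimately show ?thesis unfolding noncomm_graded_twisting_classes_def by simp
qed

end

section \<open>The special linear group\<close>

lemma special_linear_group_simps [simp]:
  "carrier (special_linear_group n) = {M \<in> carrier_mat n n. det M = 1}"
  "monoid.mult (special_linear_group n) = (*)"
  "\<one>\<^bsub>special_linear_group n\<^esub> = 1\<^sub>m n"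
  by (simp_all add: special_linear_group_def)

lemma scalar_mat_mult:
  assumes "A \<in> carrier_mat n n"
  shows "(c \<cdot>\<^sub>m 1\<^sub>m n) * A = c \<cdot>\<^sub>m A" "A * (c \<cdot>\<^sub>m 1\<^sub>m n) = (c :: 'a::field) \<cdot>\<^sub>m A"
  using assms by (simp_all add: mult_smult_assoc_mat[of _ n n _ n] mult_smult_distrib[of _ n n _ n])

lemma scalar_mat_pow:
  "(c \<cdot>\<^sub>m 1\<^sub>m n) [^]\<^bsub>special_linear_group n\<^esub> (k::nat) = (c ^ k :: 'a::field) \<cdot>\<^sub>m 1\<^sub>m n"
proof (induction k)
  case 0
  show ?case by (auto intro!: eq_matI)
next
  case (Suc k)
  have "(c ^ k \<cdot>\<^sub>m 1\<^sub>m n) * (c \<cdot>\<^sub>m 1\<^sub>m n) = c ^ Suc k \<cdot>\<^sub>m 1\<^sub>m n"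
    by (subst scalar_mat_mult(2)[of _ n]) (auto intro!: eq_matI)
  then show ?case using Suc by simp
qed

lemma scalar_mat_inject:
  assumes "n > 0" shows "c \<cdot>\<^sub>m 1\<^sub>m n = d \<cdot>\<^sub>m 1\<^sub>m n \<longleftrightarrow> c = (d :: 'a::field)"
proof
  assume "c \<cdot>\<^sub>m 1\<^sub>m n = d \<cdot>\<^sub>m 1\<^sub>m n"
  then have "(c \<cdot>\<^sub>m 1\<^sub>m n) $$ (0, 0) = (d \<cdot>\<^sub>m 1\<^sub>m n) $$ (0, 0)" by simp
  then show "c = d" using assms by simp
qed simp

theorem theorem5p2:
  fixes p a q n m :: nat
  assumes "prime p" and "a \<ge> 1" and "q = p ^ a"
    and "card (UNIV :: 'F::{field,finite} set) = q"
    and "n \<ge> 2"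
    and "m = gcd n (q - 1)" and "prime m"
    and "(n, q) \<notin> {(2, 9), (3, 4)}"
  shows "\<exists>F. bij_betw F
           (noncomm_graded_twisting_classes
              (special_linear_group n :: 'F mat monoid) (integer_mod_group m)
              :: ('k::{alg_closed_field,field_char_0}, 'F mat \<Rightarrow> 'k) hopf set set)
           (X_bullet m (special_linear_group n :: 'F mat monoid))"
proof -
  let ?G = "special_linear_group n :: 'F mat monoid"
  interpret G: group ?G by (rule group_special_linear)
  have mn: "m dvd n" and mq: "m dvd card (UNIV :: 'F set) - 1" using assms by simp_all
  obtain \<omega> :: 'F where \<omega>: "\<omega> ^ m = 1" "\<omega> \<noteq> 1"
    using ex_root_of_unity_finite_field[OF \<open>prime m\<close> mq] by blast
  obtain \<zeta> :: 'k where \<zeta>: "\<zeta> ^ m = 1" "\<zeta> \<noteq> 1"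
    using ex_root_of_unity_alg_closed[OF \<open>prime m\<close>] by blast
  define z where "z = \<omega> \<cdot>\<^sub>m 1\<^sub>m n"
  \<comment> \<open>The determinant of \<open>z\<close> is \<open>\<omega> ^ n\<close>; here
    \<open>m\<close> divides \<open>n\<close>.\<close>
  have \<omega>n: "\<omega> ^ n = 1" using mn \<omega>(1) by (auto simp: power_mult)
  interpret central_twist ?G m z \<zeta>
  proof
    show "finite (carrier ?G)" by (rule finite_special_linear)
    show "z \<in> group_center ?G"
      using \<omega>n by (auto simp: group_center_def z_def scalar_mat_mult)
    show "z [^]\<^bsub>?G\<^esub> m = \<one>\<^bsub>?G\<^esub>"
      using \<omega>(1) by (auto simp: z_def scalar_mat_pow intro!: eq_matI)
    have "1\<^sub>m n = 1 \<cdot>\<^sub>m (1\<^sub>m n :: 'F mat)" by (auto intro!: eq_matI)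
    then show "z \<noteq> \<one>\<^bsub>?G\<^esub>"
      using \<omega>(2) scalar_mat_inject[of n \<omega> 1] \<open>n \<ge> 2\<close> by (auto simp: z_def)
  qed (use \<open>prime m\<close> \<zeta> in auto)
  have scalar: "\<exists>c. z [^]\<^bsub>?G\<^esub> j = c \<cdot>\<^sub>m 1\<^sub>m n" for j :: int
  proof -
    have "z [^]\<^bsub>?G\<^esub> j = z [^]\<^bsub>?G\<^esub> int (nat (j mod int m))" using m_pos by simp
    also have "\<dots> = \<omega> ^ nat (j mod int m) \<cdot>\<^sub>m 1\<^sub>m n"
      unfolding int_pow_int z_def by (rule scalar_mat_pow)
    finally show ?thesis by blast
  qed
  have power_of_z: "\<exists>j::int. M = z [^]\<^bsub>?G\<^esub> j"
    if M: "M \<in> carrier ?G" and d: "M = d \<cdot>\<^sub>m 1\<^sub>m n" for M d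
  proof -
    have dn: "d ^ n = 1" using M by (simp add: d)
    then have "d \<noteq> 0" using \<open>n \<ge> 2\<close> by (metis power_0_left not_numeral_le_zero zero_neq_one)
    then have dq: "d ^ (q - 1) = 1" using finite_field_pow[of d] assms(4) by simp
    \<comment> \<open>The scalar \<open>d\<close> satisfies both \<open>d ^ n = 1\<close> and
      \<open>d ^ (q - 1) = 1\<close>, so Bezout reduces the exponent to the greatest common divisor
      \<open>m\<close>.\<close>
    obtain x y where "n * x = (q - 1) * y + m"
      using bezout_nat[of n "q - 1"] \<open>n \<ge> 2\<close> \<open>m = gcd n (q - 1)\<close> by auto
    then have "d ^ (n * x) = d ^ ((q - 1) * y + m)" by simp
    then have "d ^ m = 1" using dn dq by (simp add: power_add power_mult)
    then obtain j where "d = \<omega> ^ j"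
      using root_of_unity_eq_power[OF \<open>prime m\<close> \<omega>] by blast
    then have "M = z [^]\<^bsub>?G\<^esub> int j"
      unfolding int_pow_int z_def d by (simp add: scalar_mat_pow)
    then show ?thesis by blast
  qed
  have centreless: "\<exists>j::int. M = z [^]\<^bsub>?G\<^esub> j"
    if M: "M \<in> carrier ?G"
      and comm: "\<And>N. N \<in> carrier ?G \<Longrightarrow> \<exists>j::int. M \<otimes>\<^bsub>?G\<^esub> N = N \<otimes>\<^bsub>?G\<^esub> M \<otimes>\<^bsub>?G\<^esub> z [^]\<^bsub>?G\<^esub> j" for M
  proof -
    have Mc: "M \<in> carrier_mat n n" "det M \<noteq> 0" using M by auto
    have "\<exists>d. M = d \<cdot>\<^sub>m 1\<^sub>m n"
    proof (rule scalar_of_commute_up_to_scalar[OF Mc \<open>n \<ge> 2\<close>])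
      fix i j assume ij: "i < n" "j < n" "i \<noteq> j"
      let ?E = "addrow_mat n (1 :: 'F) i j"
      have "?E \<in> carrier ?G" using ij by (simp add: det_addrow_mat)
      from comm[OF this] obtain k :: int where "M * ?E = ?E * M * z [^]\<^bsub>?G\<^esub> k" by auto
      moreover obtain c where "z [^]\<^bsub>?G\<^esub> k = c \<cdot>\<^sub>m 1\<^sub>m n" using scalar by blast
      moreover have "?E * M \<in> carrier_mat n n" using Mc by (intro mult_carrier_mat[of _ n n]) simp_all
      ultimately show "\<exists>c. M * ?E = c \<cdot>\<^sub>m (?E * M)" by (auto simp: scalar_mat_mult)
    qed
    then show ?thesis using power_of_z[OF M] by blast
  qed
  have pF: "of_nat p = (0 :: 'F)"
    using of_nat_card_finite_field[where 'a='F] assms(3,4) by simp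
  have "q > 0" using \<open>prime p\<close> \<open>q = p ^ a\<close> by (simp add: prime_gt_0_nat)
  \<comment> \<open>Consecutive numbers are coprime, and \<open>p\<close> and \<open>m\<close>
    divide one each.\<close>
  then have "coprime q (q - 1)" using coprime_diff_one_right_nat[of q] by simp
  moreover have "p dvd q" using \<open>q = p ^ a\<close> \<open>a \<ge> 1\<close> by (simp add: dvd_power)
  moreover have "m dvd q - 1" using assms(6) by simp
  ultimately have coprime: "coprime p m" by (metis coprime_divisors)
  interpret centreless_twist ?G m z \<zeta> p
  proof
    fix D :: "'F mat \<Rightarrow> 'k" and M
    assume "\<And>x y. \<lbrakk>x \<in> carrier ?G; y \<in> carrier ?G\<rbrakk> \<Longrightarrow> D (x \<otimes>\<^bsub>?G\<^esub> y) = D x * D y"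
      and "\<And>x. x \<in> carrier ?G \<Longrightarrow> D x \<noteq> 0" and "M \<in> carrier ?G"
    then show "D M ^ p = 1"
      using pF by (intro SL_char_torsion[of p n D M]) auto
  qed (use centreless coprime in auto)
  have "group_center ?G = range (\<lambda>j::int. z [^]\<^bsub>?G\<^esub> j)"
  proof (intro equalityI subsetI)
    fix M assume "M \<in> group_center ?G"
    then have M: "M \<in> carrier ?G" and comm: "\<And>N. N \<in> carrier ?G \<Longrightarrow> M \<otimes>\<^bsub>?G\<^esub> N = N \<otimes>\<^bsub>?G\<^esub> M"
      by (auto simp: group_center_def)
    have "\<exists>j::int. M \<otimes>\<^bsub>?G\<^esub> N = N \<otimes>\<^bsub>?G\<^esub> M \<otimes>\<^bsub>?G\<^esub> z [^]\<^bsub>?G\<^esub> j" if N: "N \<in> carrier ?G" for N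
      using comm[OF N] G.r_one[OF G.m_closed[OF N M]] by (intro exI[of _ 0]) simp
    then show "M \<in> range (\<lambda>j::int. z [^]\<^bsub>?G\<^esub> j)" using centreless[OF M] by auto
  next
    fix M assume "M \<in> range (\<lambda>j::int. z [^]\<^bsub>?G\<^esub> j)"
    then show "M \<in> group_center ?G"
      unfolding group_center_def using zp_comm G.int_pow_closed[OF z_closed] by auto
  qed
  then show ?thesis by (rule graded_twisting_classes_bij)
qed

end
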